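(* Let $n\geq 2$ and let $X\subset \mathbb{S}^n$ be an $(n-1)$-dimensional Sierpiński space. Then there exist a Sierpiński space $Y\subset \mathbb{S}^n$ (that is, an $(n-1)$-dimensional Sierpiński space) of positive ($n$-dimensional) Lebesgue measure and a homeomorphism $f\colon \mathbb{S}^n\to \mathbb{S}^n$ which maps $X$ onto $Y$ and is conformal on $\mathbb{S}^n\setminus X$.
   Context: An $n$-cell is a space homeomorphic to the closed unit ball of $\mathbb{R}^n$. A continuum is a compact connected set. A continuum $X\subset \mathbb{S}^n$, $n\geq 2$, is an $(n-1)$-dimensional Sierpiński space if its complement $\mathbb{S}^n\setminus X$ consists of countably many components $U_i$, $i\in\mathbb{N}$, such that: (1) $\mathbb{S}^n\setminus U_i$ is an $n$-cell for each $i\in\mathbb{N}$; (2) $\overline{U_i}\cap\overline{U_j}=\emptyset$ for $i\neq j$; (3) $\bigcup_{i\in\mathbb{N}}U_i$ is dense in $\mathbb{S}^n$; and (4) $\operatorname{diam}(U_i)\to 0$ as $i\to\infty$. The boundaries $\partial U_i$ are not assumed to be flat spheres. Diameters are with respect to the standard metric on $\mathbb{S}^n$. The open set $\mathbb{S}^n\setminus X$ is not connected; conformality on it means conformality on each of its components. *)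

theory Defs
  imports "HOL-Analysis.Analysis"
begin

text \<open>
  Throughout, \<open>n = CARD('n)\<close>, and Euclidean \<open>(n+1)\<close>-space is realised as the product
  \<^typ>\<open>(real^'n) \<times> real\<close>, whose norm is the Euclidean one.
\<close>

abbreviation Sn :: "((real^'n) \<times> real) set"
  where "Sn \<equiv> sphere 0 1"

definition cell :: "((real^'n) \<times> real) set \<Rightarrow> bool"
  where "cell C \<longleftrightarrow> C homeomorphic cball (0 :: real^'n) 1"

definition continuum :: "'a::topological_space set \<Rightarrow> bool"
  where "continuum X \<longleftrightarrow> compact X \<and> connected X"

text \<open>
  The enumeration of the complementary components by all of \<open>\<nat>\<close> is injective, so there are
  infinitely many. Components, closures and diameters are taken in the ambient Euclidean space;
  as \<^term>\<open>Sn\<close> is closed, components and closures agree with those in \<^term>\<open>Sn\<close>. The diameters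
  are chordal; the geodesic distance \<open>d\<close> on the sphere satisfies
  \<open>dist x y \<le> d x y \<le> (pi / 2) * dist x y\<close>, so convergence to \<open>0\<close> does not depend on the choice.
\<close>

definition sierpinski_space :: "((real^'n) \<times> real) set \<Rightarrow> bool"
  where "sierpinski_space X \<longleftrightarrow>
    X \<subseteq> Sn \<and> continuum X \<and>
    (\<exists>U :: nat \<Rightarrow> ((real^'n) \<times> real) set.
       bij_betw U UNIV (components (Sn - X)) \<and>
       (\<forall>i. cell (Sn - U i)) \<and>
       (\<forall>i j. i \<noteq> j \<longrightarrow> closure (U i) \<inter> closure (U j) = {}) \<and>
       closure (\<Union>i. U i) = Sn \<and>
       (\<lambda>i. diameter (U i)) \<longlonglongrightarrow> 0)"

text \<open>
  Surface measure on the unit sphere, obtained from Lebesgue measure by polar coordinates: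
  the push-forward of Lebesgue measure on the punctured unit ball under \<open>x \<mapsto> x / norm x\<close>, scaled by
  the dimension of the ambient space (the reciprocal of \<open>\<integral> r^n dr\<close> over \<open>[0, 1]\<close>, where the ambient
  dimension is \<open>n + 1\<close>).
\<close>

definition sphere_measure :: "'a::euclidean_space measure"
  where "sphere_measure = scale_measure (of_nat DIM('a))
    (distr (restrict_space lborel (cball 0 1 - {0})) (restrict_space borel (sphere 0 1)) sgn)"

lemma sgn_measurable_sphere:
  "sgn \<in> measurable (restrict_space lborel (cball 0 1 - {0 :: 'a::euclidean_space}))
                     (restrict_space borel (sphere 0 1))"
proof (rule measurable_restrict_space2)
  show "sgn \<in> space (restrict_space lborel (cball 0 1 - {0 :: 'a})) \<rightarrow> sphere 0 1"
    by (auto simp: space_restrict_space norm_sgn)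
  have "(\<lambda>x::'a. x /\<^sub>R norm x) \<in> borel_measurable borel" by measurable
  hence "(sgn :: 'a \<Rightarrow> 'a) \<in> borel_measurable lborel"
    by (simp add: sgn_div_norm[abs_def])
  thus "(sgn :: 'a \<Rightarrow> 'a) \<in> borel_measurable (restrict_space lborel (cball 0 1 - {0}))"
    by (rule measurable_restrict_space1)
qed

lemma emeasure_sphere_measure:
  fixes A :: "'a::euclidean_space set"
  assumes "A \<in> sets borel" "A \<subseteq> sphere 0 1"
  shows "emeasure sphere_measure A =
    of_nat DIM('a) * emeasure lborel {t *\<^sub>R x | t x. 0 < t \<and> t \<le> 1 \<and> x \<in> A}"
proof -
  have A: "A \<in> sets (restrict_space borel (sphere 0 1))"
    using assms by (auto simp: sets_restrict_space_iff)
  have "sgn -` A \<inter> (cball 0 1 - {0}) = {t *\<^sub>R x | t x. 0 < t \<and> t \<le> 1 \<and> x \<in> A}" (is "?L = ?R")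
  proof (intro set_eqI iffI)
    fix y assume "y \<in> ?L"
    then have "y = norm y *\<^sub>R sgn y \<and> 0 < norm y \<and> norm y \<le> 1 \<and> sgn y \<in> A"
      by (auto simp: sgn_div_norm)
    then show "y \<in> ?R" by blast
  next
    fix y assume "y \<in> ?R"
    then obtain t x where y: "y = t *\<^sub>R x" "0 < t" "t \<le> 1" "x \<in> A" by blast
    then have "norm x = 1" using assms by auto
    with y show "y \<in> ?L" by (auto simp: sgn_div_norm)
  qed
  moreover from this have "emeasure (restrict_space lborel (cball 0 1 - {0})) ?R = emeasure lborel ?R"
    by (intro emeasure_restrict_space) auto
  ultimately show ?thesis
    unfolding sphere_measure_def
    by (simp add: emeasure_distr[OF sgn_measurable_sphere A] space_restrict_space)
qed

text \<open>
  Conformality of a map of \<^term>\<open>Sn\<close> on a relatively open set \<open>U\<close>: \<open>f\<close> is continuously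
  differentiable on \<open>U\<close> and its differential on each tangent space (the orthogonal complement of
  \<open>x\<close>) is a similarity. The derivative within \<open>U\<close> is determined only on the tangent space; the value
  of \<open>D x\<close> in the normal direction is immaterial. Orientation reversal is allowed.
\<close>

definition conformal_on :: "((real^'n) \<times> real) set \<Rightarrow> ((real^'n) \<times> real \<Rightarrow> (real^'n) \<times> real) \<Rightarrow> bool"
  where "conformal_on U f \<longleftrightarrow>
    (\<exists>D :: (real^'n) \<times> real \<Rightarrow> ((real^'n) \<times> real) \<Rightarrow>\<^sub>L ((real^'n) \<times> real).
       continuous_on U D \<and>
       (\<forall>x\<in>U. (f has_derivative blinfun_apply (D x)) (at x within U)) \<and>
       (\<forall>x\<in>U. \<exists>c>0. \<forall>v w. v \<bullet> x = 0 \<longrightarrow> w \<bullet> x = 0 \<longrightarrow>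
          blinfun_apply (D x) v \<bullet> blinfun_apply (D x) w = c\<^sup>2 * (v \<bullet> w)))"

end

theory Submission
  imports Defs
begin

text \<open>
  The homeomorphism is a uniform limit of homeomorphisms \<open>f\<close> of the sphere, each conformal on finitely
  many components \<open>U i\<close> with small images. To treat one more component \<open>U\<close>, first change \<open>f\<close>
  inside \<open>U\<close> so that it becomes conformal on some small open \<open>b \<subseteq> U\<close>. Then precompose it with a
  homeomorphism supported near the closure of \<open>U\<close> which maps \<open>U\<close> into \<open>b\<close> by a Moebius map;
  such a map exists, without any flatness of the boundary, because the complement of \<open>U\<close> is a cell. The
  other components are either left alone or acquire small images, so they can be treated in finite
  batches, with disjoint supports whose diameters, and those of whose images, tend to \<open>0\<close>. Hence the maps and
  their inverses converge uniformly. If the images of the components have total measure less than the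
  measure of the sphere, the image of \<open>X\<close> has positive measure.
\<close>

section \<open>Homeomorphisms of the sphere and ambient conformality\<close>

text \<open>For n \<ge> 3 conformal maps are Moebius maps by Liouville's theorem, so a component
  with a wild boundary can only be replaced by a Moebius copy of itself; the sole freedom is the
  place and size of the copy. Hence \<open>U\<close> is moved by a map that acts on it as a dilation
  of a stereographic chart, and the map applied afterwards must already be conformal where the copy
  lands. Such a place always exists: the process starts with the identity, and every later map is
  conformal on a component treated before. The obstacle is that a neighbourhood of the closure of
  \<open>U\<close> may meet infinitely many untreated components, and the shrinking map is not
  conformal there. Only their sizes can be controlled. The radial map of the cell has to be steep
  somewhere near the boundary, since it must press almost the whole cell towards its centre; its
  rise is therefore spread over many scales, so that no single component catches more than a small
  part of it.\<close>

abbreviation usph :: "'a::euclidean_space set" where "usph \<equiv> sphere 0 1"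

text \<open>Compactness of the sphere makes the inverse continuous. Values off the sphere are
  arbitrary; the inverse is \<open>inv_into usph f\<close>.\<close>

definition sphere_homeo :: "('a::euclidean_space \<Rightarrow> 'a) \<Rightarrow> bool"
  where "sphere_homeo f \<longleftrightarrow> continuous_on usph f \<and> bij_betw f usph usph"

lemma sphere_homeo_id: "sphere_homeo (\<lambda>x. x)"
  by (simp add: sphere_homeo_def bij_betw_def)

lemma sphere_homeo_in: "sphere_homeo f \<Longrightarrow> x \<in> usph \<Longrightarrow> f x \<in> usph"
  by (auto simp: sphere_homeo_def bij_betw_def)

lemma sphere_homeo_eq_iff:
  "sphere_homeo f \<Longrightarrow> x \<in> usph \<Longrightarrow> y \<in> usph \<Longrightarrow> f x = f y \<longleftrightarrow> x = y"
  unfolding sphere_homeo_def bij_betw_def by (auto dest: inj_onD)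

lemma sphere_homeo_compose:
  assumes "sphere_homeo f" "sphere_homeo g"
  shows "sphere_homeo (\<lambda>x. g (f x))"
proof -
  have "continuous_on usph (g \<circ> f)"
    using assms by (intro continuous_on_compose) (auto simp: sphere_homeo_def bij_betw_def)
  moreover have "bij_betw (g \<circ> f) usph usph"
    using assms by (auto simp: sphere_homeo_def intro: bij_betw_trans)
  ultimately show ?thesis by (simp add: sphere_homeo_def o_def)
qed

lemma sphere_homeo_homeomorphism:
  assumes "sphere_homeo f"
  shows "homeomorphism usph usph f (inv_into usph f)"
proof -
  obtain g where g: "homeomorphism usph usph f g"
    using homeomorphism_compact[of usph f usph] assms
    by (auto simp: sphere_homeo_def bij_betw_def)
  have "inv_into usph f y = g y" if "y \<in> usph" for y
  proof -
    have "g y \<in> usph" "f (g y) = y" "inj_on f usph"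
      using g that assms by (auto simp: homeomorphism_def sphere_homeo_def bij_betw_def)
    then show ?thesis by (metis inv_into_f_f)
  qed
  then show ?thesis
    using homeomorphism_cong[OF g refl refl refl] by blast
qed

lemma sphere_homeo_inv:
  assumes "sphere_homeo f"
  shows "sphere_homeo (inv_into usph f)"
  using sphere_homeo_homeomorphism[OF assms] assms
  by (simp add: sphere_homeo_def homeomorphism_def bij_betw_inv_into)

lemma sphere_homeo_inv_left:
  "sphere_homeo f \<Longrightarrow> x \<in> usph \<Longrightarrow> inv_into usph f (f x) = x"
  by (simp add: sphere_homeo_def bij_betw_def)

lemma sphere_homeo_inv_right:
  "sphere_homeo f \<Longrightarrow> x \<in> usph \<Longrightarrow> f (inv_into usph f x) = x"
  by (simp add: sphere_homeo_def bij_betw_def f_inv_into_f)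

lemma sphere_homeo_openin:
  "sphere_homeo f \<Longrightarrow> openin (top_of_set usph) U \<Longrightarrow> openin (top_of_set usph) (f ` U)"
  using sphere_homeo_homeomorphism homeomorphism_imp_open_map by blast

lemma sphere_homeo_compact:
  "sphere_homeo f \<Longrightarrow> A \<subseteq> usph \<Longrightarrow> compact A \<Longrightarrow> compact (f ` A)"
  by (meson compact_continuous_image continuous_on_subset sphere_homeo_def)

lemma sphere_homeo_vimage_openin:
  assumes "sphere_homeo f" "openin (top_of_set usph) U"
  shows "openin (top_of_set usph) {x \<in> usph. f x \<in> U}"
proof -
  have "f \<in> usph \<rightarrow> usph" "continuous_on usph f"
    using assms by (auto simp: sphere_homeo_def bij_betw_def)
  then have "openin (top_of_set usph) (usph \<inter> f -` U)"
    using assms(2) by (intro continuous_openin_preimage)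
  then show ?thesis by (simp add: Int_def vimage_def)
qed

text \<open>
  Conformality with a derivative of an extension to the ambient space. Since the derivative is taken
  at every point of \<open>A\<close> in the full space, compositions need no openness of \<open>A\<close>.
\<close>

definition aconf :: "'a set \<Rightarrow> ('a::euclidean_space \<Rightarrow> 'a) \<Rightarrow> bool"
  where "aconf A f \<longleftrightarrow> (\<exists>F D. continuous_on A (D :: 'a \<Rightarrow> 'a \<Rightarrow>\<^sub>L 'a) \<and>
    (\<forall>x\<in>A. F x = f x \<and> (F has_derivative blinfun_apply (D x)) (at x) \<and>
      (\<exists>c>0. \<forall>v w. D x v \<bullet> D x w = c\<^sup>2 * (v \<bullet> w))))"

lemma aconfE:
  assumes "aconf A f"
  obtains F D where "continuous_on A D" "\<And>x. x \<in> A \<Longrightarrow> F x = f x"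
    "\<And>x. x \<in> A \<Longrightarrow> (F has_derivative blinfun_apply (D x)) (at x)"
    "\<And>x. x \<in> A \<Longrightarrow> \<exists>c>0. \<forall>v w. D x v \<bullet> D x w = c\<^sup>2 * (v \<bullet> w)"
proof -
  from assms obtain F D where *: "continuous_on A (D :: 'a \<Rightarrow> 'a \<Rightarrow>\<^sub>L 'a)"
    "\<forall>x\<in>A. F x = f x \<and> (F has_derivative blinfun_apply (D x)) (at x) \<and>
      (\<exists>c>0. \<forall>v w. D x v \<bullet> D x w = c\<^sup>2 * (v \<bullet> w))"
    unfolding aconf_def by (elim exE conjE)
  show ?thesis by (rule that[of D F]) (use * in simp_all)
qed

lemma aconfI:
  assumes "continuous_on A D" "\<And>x. x \<in> A \<Longrightarrow> F x = f x"
    "\<And>x. x \<in> A \<Longrightarrow> (F has_derivative blinfun_apply (D x)) (at x)"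
    "\<And>x. x \<in> A \<Longrightarrow> \<exists>c>0. \<forall>v w. D x v \<bullet> D x w = c\<^sup>2 * (v \<bullet> w)"
  shows "aconf A f"
  unfolding aconf_def using assms by (intro exI[of _ F] exI[of _ D] conjI ballI)

lemma aconf_id: "aconf A (\<lambda>x. x)"
proof (rule aconfI[of A "\<lambda>x. id_blinfun" "\<lambda>x. x"])
  show "\<exists>c>0. \<forall>v w. id_blinfun v \<bullet> id_blinfun w = c\<^sup>2 * (v \<bullet> w)"
    by (intro exI[of _ 1]) simp
qed (simp_all add: id_blinfun.rep_eq)

lemma aconf_subset:
  assumes "aconf A f" "B \<subseteq> A" shows "aconf B f"
proof (rule aconfE[OF assms(1)])
  fix F D assume *: "continuous_on A D" "\<And>x. x \<in> A \<Longrightarrow> F x = f x"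
    "\<And>x. x \<in> A \<Longrightarrow> (F has_derivative blinfun_apply (D x)) (at x)"
    "\<And>x. x \<in> A \<Longrightarrow> \<exists>c>0. \<forall>v w. D x v \<bullet> D x w = c\<^sup>2 * (v \<bullet> w)"
  show ?thesis
    by (rule aconfI[of B D F]) (use * assms(2) continuous_on_subset in auto)
qed

lemma aconf_cong:
  assumes "aconf A f" "\<And>x. x \<in> A \<Longrightarrow> g x = f x"
  shows "aconf A g"
proof (rule aconfE[OF assms(1)])
  fix F D assume *: "continuous_on A D" "\<And>x. x \<in> A \<Longrightarrow> F x = f x"
    "\<And>x. x \<in> A \<Longrightarrow> (F has_derivative blinfun_apply (D x)) (at x)"
    "\<And>x. x \<in> A \<Longrightarrow> \<exists>c>0. \<forall>v w. D x v \<bullet> D x w = c\<^sup>2 * (v \<bullet> w)"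
  have "F x = g x" if "x \<in> A" for x
    by (rule trans[OF *(2)[OF that] assms(2)[OF that, symmetric]])
  then show ?thesis
    by (rule aconfI[of A D F g, OF *(1) _ *(3,4)])
qed

lemma aconf_compose:
  assumes "aconf A f" "aconf B g" "\<And>x. x \<in> A \<Longrightarrow> f x \<in> B"
  shows "aconf A (\<lambda>x. g (f x))"
proof -
  obtain F D where F: "continuous_on A D"
    "\<And>x. x \<in> A \<Longrightarrow> F x = f x" "\<And>x. x \<in> A \<Longrightarrow> (F has_derivative blinfun_apply (D x)) (at x)"
    "\<And>x. x \<in> A \<Longrightarrow> \<exists>c>0. \<forall>v w. D x v \<bullet> D x w = c\<^sup>2 * (v \<bullet> w)"
    by (rule aconfE[OF assms(1)]) (rule that)
  obtain G E where G: "continuous_on B E"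
    "\<And>x. x \<in> B \<Longrightarrow> G x = g x" "\<And>x. x \<in> B \<Longrightarrow> (G has_derivative blinfun_apply (E x)) (at x)"
    "\<And>x. x \<in> B \<Longrightarrow> \<exists>c>0. \<forall>v w. E x v \<bullet> E x w = c\<^sup>2 * (v \<bullet> w)"
    by (rule aconfE[OF assms(2)]) (rule that)
  have "continuous_on A F"
    by (meson F(3) continuous_at_imp_continuous_on has_derivative_continuous)
  then have "continuous_on A f"
    using F(2) by (simp cong: continuous_on_cong)
  then have cE: "continuous_on A (\<lambda>x. E (f x))"
    using assms(3) by (intro continuous_on_compose2[OF G(1)]) auto
  let ?H = "\<lambda>x. E (f x) o\<^sub>L D x"
  have "continuous_on A ?H"
    by (intro continuous_intros bounded_bilinear.continuous_on[OF bounded_bilinear_blinfun_compose] cE F(1))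
  moreover have "((\<lambda>x. G (F x)) has_derivative blinfun_apply (?H x)) (at x)" if "x \<in> A" for x
  proof -
    have "(G has_derivative blinfun_apply (E (f x))) (at (F x))"
      using F(2) G(3) assms(3) that by auto
    from diff_chain_at[OF F(3)[OF that] this] show ?thesis by (simp add: o_def blinfun_compose.rep_eq)
  qed
  moreover have "\<exists>c>0. \<forall>v w. ?H x v \<bullet> ?H x w = c\<^sup>2 * (v \<bullet> w)" if x: "x \<in> A" for x
  proof -
    obtain c d where "c > 0" "d > 0" and "\<forall>v w. D x v \<bullet> D x w = c\<^sup>2 * (v \<bullet> w)"
      "\<forall>v w. E (f x) v \<bullet> E (f x) w = d\<^sup>2 * (v \<bullet> w)"
      using F(4)[OF x] G(4)[OF assms(3)[OF x]] by blast
    then show ?thesis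
      by (intro exI[of _ "d * c"]) (simp add: power_mult_distrib blinfun_compose.rep_eq mult.assoc)
  qed
  ultimately show ?thesis
    using F(2) G(2) assms(3) by (intro aconfI[of A ?H "\<lambda>x. G (F x)"]) auto
qed

lemma aconf_homothety:
  assumes "k > 0" shows "aconf A (\<lambda>x. a + k *\<^sub>R (x - b))"
proof -
  have "((\<lambda>x. a + k *\<^sub>R (x - b)) has_derivative blinfun_apply (k *\<^sub>R id_blinfun)) (at x)" for x
    by (auto intro!: derivative_eq_intros simp: blinfun.scaleR_left)
  moreover have "\<exists>c>0. \<forall>v w. (k *\<^sub>R id_blinfun) v \<bullet> (k *\<^sub>R id_blinfun) w = c\<^sup>2 * (v \<bullet> w)"
    using assms by (intro exI[of _ k]) (simp add: blinfun.scaleR_left power2_eq_square)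
  ultimately show ?thesis
    by (intro aconfI[of A "\<lambda>x. k *\<^sub>R id_blinfun" "\<lambda>x. a + k *\<^sub>R (x - b)"]) auto
qed

lemma aconf_conformal_on:
  assumes "aconf A f" shows "conformal_on A f"
proof -
  obtain F D where F: "continuous_on A D"
    "\<And>x. x \<in> A \<Longrightarrow> F x = f x" "\<And>x. x \<in> A \<Longrightarrow> (F has_derivative blinfun_apply (D x)) (at x)"
    "\<And>x. x \<in> A \<Longrightarrow> \<exists>c>0. \<forall>v w. D x v \<bullet> D x w = c\<^sup>2 * (v \<bullet> w)"
    by (rule aconfE[OF assms]) (rule that)
  have "(f has_derivative blinfun_apply (D x)) (at x within A)" if "x \<in> A" for x
    using has_derivative_transform[OF that _ has_derivative_at_withinI[OF F(3)[OF that]]] F(2) by metis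
  then show ?thesis
    unfolding conformal_on_def using F(1,4) by (intro exI[of _ D]) blast
qed

section \<open>Radial maps in stereographic charts\<close>

text \<open>
  For \<open>q\<close> on the sphere, the inversion with centre \<open>q\<close> and radius \<open>sqrt 2\<close> is the stereographic
  projection from \<open>q\<close> onto the hyperplane orthogonal to \<open>q\<close>, and its own inverse.
\<close>

definition sinv :: "'a::euclidean_space \<Rightarrow> 'a \<Rightarrow> 'a"
  where "sinv q x = q + (2 / (norm (x - q))\<^sup>2) *\<^sub>R (x - q)"

lemma norm_sinv_diff: "norm (sinv q x - q) = 2 / norm (x - q)"
  by (simp add: sinv_def power2_eq_square)

lemma sinv_neq: "x \<noteq> q \<Longrightarrow> sinv q x \<noteq> q"
  using norm_sinv_diff[of q x] by auto

lemma sinv_sinv: "x \<noteq> q \<Longrightarrow> sinv q (sinv q x) = x"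
  unfolding sinv_def[of q "sinv q x"] norm_sinv_diff
  by (simp add: sinv_def power2_eq_square)

lemma sinv_sphere_orth:
  assumes "q \<in> usph" "x \<in> usph" "x \<noteq> q"
  shows "sinv q x \<bullet> q = 0"
proof -
  have "x \<bullet> x = 1" "q \<bullet> q = 1" using assms by (auto simp: norm_eq_1)
  then have n: "(norm (x - q))\<^sup>2 = 2 - 2 * (x \<bullet> q)"
    by (simp add: power2_norm_eq_inner inner_diff_left inner_diff_right inner_commute)
  moreover have "norm (x - q) > 0" using assms by simp
  ultimately have "2 - 2 * (x \<bullet> q) \<noteq> 0" by (metis less_irrefl zero_less_power2 less_numeral_extra(3))
  then show ?thesis
    using \<open>q \<bullet> q = 1\<close> unfolding sinv_def n
    by (simp add: inner_add_left inner_diff_left divide_simps)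
qed

lemma sinv_orth_sphere:
  assumes "q \<in> usph" "y \<bullet> q = 0"
  shows "sinv q y \<in> usph" "y \<noteq> q"
proof -
  have q: "q \<bullet> q = 1" using assms by (auto simp: norm_eq_1)
  then show "y \<noteq> q" using assms by auto
  define k where "k = 2 / (norm (y - q))\<^sup>2"
  have "k * ((y - q) \<bullet> (y - q)) = 2" using \<open>y \<noteq> q\<close>
    by (simp add: k_def power2_norm_eq_inner)
  moreover have "sinv q y \<bullet> sinv q y = q \<bullet> q + 2 * (k * ((y - q) \<bullet> q)) + k * (k * ((y - q) \<bullet> (y - q)))"
    by (simp add: sinv_def k_def[symmetric] inner_add_left inner_add_right inner_commute algebra_simps)
  moreover have "(y - q) \<bullet> q = -1" using assms q by (simp add: inner_diff_left)
  ultimately have "sinv q y \<bullet> sinv q y = 1" using q by simp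
  then show "sinv q y \<in> usph" by (simp add: norm_eq_1)
qed

lemma continuous_on_sinv: "q \<notin> A \<Longrightarrow> continuous_on A (sinv q)"
  unfolding sinv_def by (intro continuous_intros) auto

lemma aconf_sinv:
  fixes q :: "'a::euclidean_space"
  assumes "q \<notin> A" shows "aconf A (sinv q)"
proof -
  \<comment> \<open>The derivative of an inversion: the reflection in the hyperplane orthogonal to
    \<open>x - q\<close>, which is an isometry, followed by scaling with
    \<open>2 / (norm (x - q))\<^sup>2\<close>.\<close>
  define L where "L x v = (2 / (norm (x - q))\<^sup>2) *\<^sub>R (v - (2 * ((x - q) \<bullet> v) / (norm (x - q))\<^sup>2) *\<^sub>R (x - q))" for x v :: 'a
  have L: "bounded_linear (L x)" for x
    unfolding L_def
    by (intro bounded_linear_const_scaleR bounded_linear_sub bounded_linear_ident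
        bounded_linear_scaleR_const bounded_linear_divide[THEN bounded_linear_compose]
        bounded_linear_const_mult bounded_linear_inner_right)
  have bL: "blinfun_apply (Blinfun (L x)) = L x" for x
    by (simp add: L bounded_linear_Blinfun_apply)
  have "continuous_on A (\<lambda>x. Blinfun (L x))"
  proof (rule continuous_on_blinfun_componentwise)
    fix i :: 'a
    have "continuous_on A (\<lambda>x. L x i)"
      unfolding L_def using assms by (intro continuous_intros) auto
    then show "continuous_on A (\<lambda>x. blinfun_apply (Blinfun (L x)) i)" by (simp add: bL)
  qed
  moreover have "(sinv q has_derivative L x) (at x)" if "x \<in> A" for x
  proof -
    have ne: "x - q \<noteq> 0" using that assms by auto
    have eq: "sinv q = (\<lambda>x. q + (2 / ((x - q) \<bullet> (x - q))) *\<^sub>R (x - q))"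
      by (auto simp: sinv_def power2_norm_eq_inner)
    let ?s = "(x - q) \<bullet> (x - q)"
    have s: "?s \<noteq> 0" using ne by simp
    have 1: "((\<lambda>x. (x - q) \<bullet> (x - q)) has_derivative (\<lambda>v. 2 * ((x - q) \<bullet> v))) (at x)"
      by (auto intro!: derivative_eq_intros simp: inner_commute)
    have 2: "((\<lambda>x. 2 / ((x - q) \<bullet> (x - q))) has_derivative (\<lambda>v. - (4 * ((x - q) \<bullet> v)) / (?s * ?s))) (at x)"
      using has_derivative_divide'[OF has_derivative_const[of 2] 1 s] by simp
    have 3: "((\<lambda>x. x - q) has_derivative (\<lambda>v. v)) (at x)"
      by (auto intro!: derivative_eq_intros)
    have 4: "(2 / ?s) *\<^sub>R v + (- (4 * ((x - q) \<bullet> v)) / (?s * ?s)) *\<^sub>R (x - q) = L x v" for v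
      by (simp add: L_def power2_norm_eq_inner scaleR_diff_right)
    show ?thesis
      unfolding eq
      by (rule has_derivative_eq_rhs[OF has_derivative_add[OF has_derivative_const has_derivative_scaleR[OF 2 3]]])
         (simp only: 4 add_0)
  qed
  moreover
  have "L x v \<bullet> L x w = (2 / (norm (x - q))\<^sup>2)\<^sup>2 * (v \<bullet> w)" if "x \<in> A" for x v w
  proof -
    define u where "u = x - q"
    have ne: "u \<bullet> u \<noteq> 0" using that assms by (auto simp: u_def)
    have "(v - (2 * (u \<bullet> v) / (u \<bullet> u)) *\<^sub>R u) \<bullet> (w - (2 * (u \<bullet> w) / (u \<bullet> u)) *\<^sub>R u) = v \<bullet> w"
      using ne by (simp add: inner_diff_left inner_diff_right inner_commute)
    then show ?thesis
      unfolding L_def u_def[symmetric] power2_norm_eq_inner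
      by (simp add: power2_eq_square)
  qed
  then have "\<exists>c>0. \<forall>v w. L x v \<bullet> L x w = c\<^sup>2 * (v \<bullet> w)" if "x \<in> A" for x
    using that assms by (intro exI[of _ "2 / (norm (x - q))\<^sup>2"]) auto
  ultimately show ?thesis
    by (intro aconfI[of A "\<lambda>x. Blinfun (L x)" "sinv q"]) (auto simp: bL)
qed

section \<open>Radial maps with a prescribed profile\<close>

definition profile :: "real \<Rightarrow> (real \<Rightarrow> real) \<Rightarrow> bool"
  where "profile l h \<longleftrightarrow> l > 0 \<and> h 0 = 0 \<and> continuous_on {0..} h \<and> strict_mono_on {0..} h \<and>
    (\<forall>r\<ge>0. l * r \<le> h r)"

lemma profile_nonneg: "profile l h \<Longrightarrow> 0 \<le> r \<Longrightarrow> 0 \<le> h r"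
  unfolding profile_def by (meson mult_nonneg_nonneg less_imp_le order_trans)

lemma profile_eq_iff:
  assumes "profile l h" "0 \<le> r" "0 \<le> s"
  shows "h r = h s \<longleftrightarrow> r = s"
  using assms strict_mono_on_imp_inj_on[of "{0..}" h] by (auto simp: profile_def dest: inj_onD)

text \<open>The linear lower bound in \<open>profile\<close> forces \<open>h\<close> past every
  value, so the intermediate value theorem applies. The same bound gives continuity at the pole in
  \<open>smap_homeo\<close>.\<close>

lemma profile_surj:
  assumes "profile l h" "0 \<le> s"
  obtains r where "0 \<le> r" "h r = s"
proof -
  have l: "l > 0" using assms by (simp add: profile_def)
  have "0 \<le> s / l" using assms l by simp
  then have "l * (s / l) \<le> h (s / l)"
    using assms unfolding profile_def by blast
  then have "s \<le> h (s / l)" using l by simp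
  moreover have "h 0 \<le> s" using assms by (simp add: profile_def)
  moreover have "continuous_on {0..s / l} h"
    using assms continuous_on_subset[of "{0..}" h "{0..s / l}"] by (auto simp: profile_def)
  ultimately obtain r where "0 \<le> r" "r \<le> s / l" "h r = s"
    using IVT'[of h 0 s "s / l"] assms l by (auto simp: divide_nonneg_pos)
  then show ?thesis using that by blast
qed

definition rad :: "(real \<Rightarrow> real) \<Rightarrow> 'a::real_normed_vector \<Rightarrow> 'a"
  where "rad h y = h (norm y) *\<^sub>R sgn y"

lemma norm_scaleR_sgn: "norm x *\<^sub>R sgn x = (x :: 'a::real_normed_vector)"
  by (cases "x = 0") (simp_all add: sgn_div_norm)

lemma norm_rad: "profile l h \<Longrightarrow> norm (rad h y) = h (norm y)"
  using profile_nonneg[of l h "norm y"] by (simp add: rad_def norm_sgn profile_def)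

lemma rad_eq_scaleR: "h (norm y) = k * norm y \<Longrightarrow> rad h y = k *\<^sub>R y"
  unfolding rad_def by (metis norm_scaleR_sgn scaleR_scaleR)

lemma sgn_rad:
  assumes "profile l h" shows "sgn (rad h y) = sgn y"
proof (cases "y = 0")
  case False
  then have "h (norm y) \<noteq> 0"
    using profile_eq_iff[OF assms, of "norm y" 0] assms by (simp add: profile_def)
  then have "h (norm y) > 0" using profile_nonneg[OF assms, of "norm y"] by simp
  then show ?thesis using False by (simp add: rad_def sgn_scaleR sgn_div_norm[of "sgn y"] norm_sgn)
qed (simp add: rad_def)

lemma rad_eq_iff:
  assumes "profile l h" shows "rad h x = rad h y \<longleftrightarrow> x = y"
proof
  assume eq: "rad h x = rad h y"
  have "h (norm x) = h (norm y)" using eq norm_rad[OF assms] by metis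
  then have "norm x = norm y" using profile_eq_iff[OF assms] by simp
  moreover have "sgn x = sgn y" using eq sgn_rad[OF assms] by metis
  ultimately show "x = y" using norm_scaleR_sgn by metis
qed simp

lemma rad_surj:
  assumes h: "profile l h"
  obtains r where "0 \<le> r" "h r = norm w" "rad h (r *\<^sub>R sgn w) = w"
proof -
  obtain r where r: "0 \<le> r" "h r = norm w" using profile_surj[OF h, of "norm w"] by auto
  have "rad h (r *\<^sub>R sgn w) = w"
  proof (cases "w = 0")
    case False
    then have "r \<noteq> 0" using r h by (auto simp: profile_def)
    then have "norm (r *\<^sub>R sgn w) = r" "sgn (r *\<^sub>R sgn w) = sgn w"
      using r(1) False by (auto simp: norm_sgn sgn_scaleR sgn_div_norm[of "sgn w"])
    then show ?thesis using r(2) norm_scaleR_sgn by (metis rad_def)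
  qed (simp add: rad_def)
  then show ?thesis using that r by blast
qed

lemma continuous_on_rad:
  assumes h: "profile l h" and g: "continuous_on A g"
  shows "continuous_on A (\<lambda>x. rad h (g x))"
proof -
  have ch: "continuous_on A (\<lambda>x. h (norm (g x)))"
    by (rule continuous_on_compose2[of "{0..}" h])
       (use h g in \<open>auto simp: profile_def intro!: continuous_intros\<close>)
  show ?thesis
    unfolding continuous_on_def
  proof
    fix x assume x: "x \<in> A"
    have cs: "(g \<longlongrightarrow> g x) (at x within A)" using g x by (auto simp: continuous_on_def)
    have chx: "((\<lambda>x. h (norm (g x))) \<longlongrightarrow> h (norm (g x))) (at x within A)"
      using ch x by (simp add: continuous_on_def)
    show "((\<lambda>x. rad h (g x)) \<longlongrightarrow> rad h (g x)) (at x within A)"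
    proof (cases "g x = 0")
      case False
      then show ?thesis
        unfolding rad_def using cs chx by (intro tendsto_scaleR tendsto_sgn)
    next
      case True
      then have "((\<lambda>x. h (norm (g x))) \<longlongrightarrow> 0) (at x within A)"
        using chx h by (simp add: profile_def)
      \<comment> \<open>\<open>sgn\<close> jumps at 0, so continuity there comes from the norm
        alone, which is \<open>h (norm (g x))\<close> and tends to \<open>h 0 = 0\<close>.\<close>
      then have "((\<lambda>x. rad h (g x)) \<longlongrightarrow> 0) (at x within A)"
        by (rule Lim_null_comparison[rotated])
           (simp add: norm_rad[OF h] always_eventually)
      then show ?thesis using True by (simp add: rad_def)
    qed
  qed
qed

text \<open>The centre \<open>c\<close> is a point of the chart, that is of the hyperplane
  orthogonal to \<open>q\<close>, and not of the sphere. The pole \<open>q\<close> is the point at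
  infinity of the chart.\<close>

definition smap :: "'a::euclidean_space \<Rightarrow> 'a \<Rightarrow> (real \<Rightarrow> real) \<Rightarrow> 'a \<Rightarrow> 'a"
  where "smap q c h x = (if x = q then q else sinv q (c + rad h (sinv q x - c)))"

text \<open>Scaling by \<open>l\<close> on \<open>[0, B / 2]\<close> and the identity from
  \<open>B\<close> on, joined by a piece of slope 2: the map of the sphere is a dilation near the
  centre and trivial near the pole.\<close>

definition squeeze :: "real \<Rightarrow> real \<Rightarrow> real \<Rightarrow> real"
  where "squeeze l B r = min r (max (l * r) (2 * r - B))"

lemma profile_squeeze:
  assumes "0 < l" "l < 1" "0 < B" shows "profile l (squeeze l B)"
proof -
  have "strict_mono_on {0..} (squeeze l B)"
  proof (rule strict_mono_onI)
    fix r s :: real assume "r < s"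
    then have "l * r < l * s" "2 * r - B < 2 * s - B" using assms by auto
    with \<open>r < s\<close> show "squeeze l B r < squeeze l B s" by (auto simp: squeeze_def min_def max_def)
  qed
  moreover have "l * r \<le> squeeze l B r" if "0 \<le> r" for r
    using assms that mult_right_mono[of l 1 r] by (simp add: squeeze_def)
  moreover have "continuous_on {0..} (squeeze l B)"
    unfolding squeeze_def by (intro continuous_intros)
  ultimately show ?thesis using assms by (auto simp: profile_def squeeze_def)
qed

lemma squeeze_small:
  assumes "0 < l" "l < 1" "0 \<le> r" "2 * r \<le> B" shows "squeeze l B r = l * r"
proof -
  have "l * r \<le> r" "0 \<le> l * r" using assms mult_right_mono[of l 1 r] by auto
  moreover have "2 * r - B \<le> l * r" using calculation assms(4) by linarith
  ultimately show ?thesis by (simp add: squeeze_def max_absorb1)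
qed

lemma squeeze_large: "B \<le> r \<Longrightarrow> squeeze l B r = r"
  by (auto simp: squeeze_def min_def max_def)

text \<open>The opposite of \<open>squeeze\<close>: the identity on \<open>[0, a]\<close>, and
  scaling by \<open>l\<close> once \<open>l * r\<close> reaches \<open>2 * a\<close>, joined by a
  piece of slope \<open>l / 2\<close>. It compresses a large region but leaves a neighbourhood of
  the centre alone.\<close>

definition core :: "real \<Rightarrow> real \<Rightarrow> real \<Rightarrow> real"
  where "core l a r = max (l * r) (min r (a + l * r / 2))"

lemma profile_core:
  assumes "0 < l" "l < 1" "0 < a" shows "profile l (core l a)"
proof -
  have "strict_mono_on {0..} (core l a)"
  proof (rule strict_mono_onI)
    fix r s :: real assume "r < s"
    then have "l * r < l * s" using assms by auto
    with \<open>r < s\<close> show "core l a r < core l a s" by (auto simp: core_def min_def max_def)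
  qed
  moreover have "continuous_on {0..} (core l a)"
    unfolding core_def by (intro continuous_intros) auto
  ultimately show ?thesis using assms by (auto simp: profile_def core_def)
qed

lemma core_small:
  assumes "0 < l" "l < 1" "0 \<le> r" "r \<le> a" shows "core l a r = r"
proof -
  have "l * r \<le> r" "0 \<le> l * r" using assms mult_right_mono[of l 1 r] by auto
  then have "r \<le> a + l * r / 2" using assms by linarith
  then show ?thesis using \<open>l * r \<le> r\<close> by (simp add: core_def)
qed

lemma core_large: "2 * a \<le> l * r \<Longrightarrow> core l a r = l * r"
  unfolding core_def by (intro max_absorb1 order_trans[OF min.cobounded2]) simp

lemma core_bound:
  assumes "0 < l" "0 \<le> r" "r \<le> R" "2 * a \<le> l * R" shows "core l a r \<le> l * R"
proof -
  have "l * r \<le> l * R" using assms by simp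
  then show ?thesis using assms by (auto simp: core_def min_def max_def)
qed

lemma smap_pole [simp]: "smap q c h q = q"
  by (simp add: smap_def)

lemma smap_chart:
  assumes "q \<in> usph" "c \<bullet> q = 0" "x \<in> usph" "x \<noteq> q"
  shows "smap q c h x \<in> usph" "smap q c h x \<noteq> q"
    "sinv q (smap q c h x) = c + rad h (sinv q x - c)"
proof -
  let ?y = "sinv q x - c"
  let ?z = "c + rad h ?y"
  have "?z \<bullet> q = 0"
    using assms sinv_sphere_orth[of q x] by (simp add: inner_add_left inner_diff_left sgn_div_norm rad_def)
  then have *: "sinv q ?z \<in> usph" "?z \<noteq> q" using sinv_orth_sphere assms(1) by blast+
  have eq: "smap q c h x = sinv q ?z" using assms by (simp add: smap_def)
  show "smap q c h x \<in> usph" "smap q c h x \<noteq> q" "sinv q (smap q c h x) = ?z"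
    unfolding eq using * sinv_neq sinv_sinv by auto
qed

lemma smap_chart_norm:
  assumes "q \<in> usph" "c \<bullet> q = 0" "x \<in> usph" "x \<noteq> q" "profile l h"
  shows "norm (sinv q (smap q c h x) - c) = h (norm (sinv q x - c))"
  using smap_chart(3)[OF assms(1-4)] norm_rad[OF assms(5)] by simp

lemma sinv_eq_iff: "x \<noteq> q \<Longrightarrow> y \<noteq> q \<Longrightarrow> sinv q x = sinv q y \<longleftrightarrow> x = y"
  by (metis sinv_sinv)

lemma smap_homeo:
  fixes q c :: "'a::euclidean_space"
  assumes q: "q \<in> usph" and c: "c \<bullet> q = 0" and h: "profile l h"
  shows "sphere_homeo (smap q c h)"
proof -
  have l: "l > 0" using h by (simp add: profile_def)
  have "inj_on (smap q c h) usph"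
  proof (rule inj_onI)
    fix x y assume x: "x \<in> usph" and y: "y \<in> usph" and eq: "smap q c h x = smap q c h y"
    show "x = y"
    proof (cases "x = q \<or> y = q")
      case True
      then show ?thesis using smap_chart(2)[OF q c] x y eq by (metis smap_pole)
    next
      case False
      have "rad h (sinv q x - c) = rad h (sinv q y - c)"
        using smap_chart(3)[OF q c x] smap_chart(3)[OF q c y] eq False
        by (metis add_left_cancel)
      then have "sinv q x - c = sinv q y - c" using rad_eq_iff[OF h] by blast
      then have "sinv q x = sinv q y" by simp
      then show ?thesis using sinv_eq_iff False by auto
    qed
  qed
  moreover have "smap q c h ` usph = usph"
  proof
    show "smap q c h ` usph \<subseteq> usph"
      using smap_chart(1)[OF q c] q by (metis image_subsetI smap_pole)
    show "usph \<subseteq> smap q c h ` usph"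
    proof
      fix y :: 'a assume y: "y \<in> usph"
      show "y \<in> smap q c h ` usph"
      proof (cases "y = q")
        case True
        then show ?thesis using q by (metis image_eqI smap_pole)
      next
        case False
        let ?w = "sinv q y - c"
        have w: "?w \<bullet> q = 0" using sinv_sphere_orth[OF q y False] c by (simp add: inner_diff_left)
        obtain r where r: "rad h (r *\<^sub>R sgn ?w) = ?w" using rad_surj[OF h, of ?w] by metis
        let ?z = "c + r *\<^sub>R sgn ?w"
        have z: "?z \<bullet> q = 0" using w c by (simp add: inner_add_left sgn_div_norm)
        have x: "sinv q ?z \<in> usph" "?z \<noteq> q" using sinv_orth_sphere[OF q z] by auto
        have "rad h (?z - c) = ?w" using r by simp
        then have "smap q c h (sinv q ?z) = y"
          using x sinv_sinv[of ?z q] sinv_neq[of ?z q] sinv_sinv[OF False] by (simp add: smap_def)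
        then show ?thesis using x(1) by (metis image_eqI)
      qed
    qed
  qed
  moreover have "continuous_on usph (smap q c h)"
  proof (rule continuous_on_eq_continuous_within[THEN iffD2], rule ballI)
    fix x :: 'a assume x: "x \<in> usph"
    show "continuous (at x within usph) (smap q c h)"
    proof (cases "x = q")
      case False
      let ?C = "usph - {q} :: 'a set"
      have cg: "continuous_on ?C (\<lambda>x. rad h (sinv q x - c))"
        by (intro continuous_on_rad[OF h] continuous_intros continuous_on_sinv) auto
      have "continuous_on ?C (\<lambda>x. sinv q (c + rad h (sinv q x - c)))"
      proof (rule continuous_on_compose2[of "-{q}" "sinv q"])
        show "continuous_on (-{q}) (sinv q)" by (rule continuous_on_sinv) simp
        show "continuous_on ?C (\<lambda>x. c + rad h (sinv q x - c))"
          by (intro continuous_intros cg)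
        show "(\<lambda>x. c + rad h (sinv q x - c)) ` ?C \<subseteq> - {q}"
        proof clarify
          fix x assume "x \<in> usph" "x \<noteq> q" "c + rad h (sinv q x - c) = q"
          then show False using smap_chart[OF q c, of x h] sinv_neq by metis
        qed
      qed
      then have "continuous_on ?C (smap q c h)"
        by (rule continuous_on_eq) (simp add: smap_def)
      moreover have "at x within usph = at x within ?C"
        by (rule at_within_nhd[of x "- {q}"]) (use False in auto)
      ultimately show ?thesis using x False by (simp add: continuous_on_eq_continuous_within)
    next
      case True
      define K where "K = norm (c - q)"
      have "\<exists>d>0. \<forall>x'\<in>usph. dist x' q < d \<longrightarrow> dist (smap q c h x') q < e" if "e > 0" for e
      proof -
        \<comment> \<open>\<open>dist x q < d\<close> puts \<open>sinv q x\<close> farther than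
          \<open>2 / d\<close> from \<open>q\<close>. The profile keeps at least the fraction
          \<open>l\<close> of the distance from \<open>c\<close>, and passing between
          \<open>c\<close> and \<open>q\<close> costs at most \<open>K\<close> before and after;
          \<open>d\<close> is chosen so that more than \<open>2 / e\<close> remains.\<close>
        define d where "d = 2 * l / (l * K + K + 2 / e)"
        have den: "l * K + K + 2 / e > 0"
          using l that by (auto simp: K_def intro!: add_nonneg_pos)
        then have d: "d > 0" using l by (simp add: d_def)
        have "dist (smap q c h x) q < e" if x: "x \<in> usph" "dist x q < d" for x
        proof (cases "x = q")
          case False
          let ?y = "sinv q x - c"
          let ?z = "c + rad h ?y"
          have xq: "norm (x - q) > 0" using False by simp
          have "norm (?z - c) = h (norm ?y)"
            using smap_chart_norm[OF q c x(1) False h] smap_chart(3)[OF q c x(1) False] by metis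
          then have "norm (?z - q) \<ge> h (norm ?y) - K"
            unfolding K_def using norm_triangle_ineq[of "?z - q" "q - c"] by (simp add: norm_minus_commute)
          moreover have "h (norm ?y) \<ge> l * norm ?y" using h by (simp add: profile_def)
          moreover have "norm ?y \<ge> 2 / norm (x - q) - K"
            unfolding K_def norm_sinv_diff[symmetric] using norm_triangle_ineq[of ?y "c - q"] by simp
          then have "l * norm ?y \<ge> l * (2 / norm (x - q) - K)" using l by simp
          moreover have "2 / d < 2 / norm (x - q)"
            using x(2) xq by (simp add: dist_norm frac_less2)
          then have "l * (2 / d) < l * (2 / norm (x - q))" by (rule mult_strict_left_mono[OF _ l])
          moreover have "l * (2 / d) = l * K + K + 2 / e" using l den by (simp add: d_def)
          ultimately have "2 / e < norm (?z - q)" by (simp add: right_diff_distrib)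
          moreover have "dist (smap q c h x) q = 2 / norm (?z - q)"
            using False norm_sinv_diff[of q ?z] by (simp add: smap_def dist_norm)
          moreover have "0 < 2 / e" using \<open>e > 0\<close> by simp
          ultimately show ?thesis
            using frac_less2[of 2 2 "2 / e" "norm (?z - q)"] by simp
        qed (use \<open>e > 0\<close> in simp)
        then show ?thesis using d by blast
      qed
      then show ?thesis unfolding True continuous_within_eps_delta by simp
    qed
  qed
  ultimately show ?thesis by (simp add: sphere_homeo_def bij_betw_def)
qed

text \<open>A dilation about \<open>c\<close> in the chart, hence a Moebius map: what
  \<open>smap\<close> is wherever its profile is linear. It is used off the pole only; unlike
  \<open>smap\<close> it is not corrected at \<open>q\<close>.\<close>

definition shom :: "'a::euclidean_space \<Rightarrow> 'a \<Rightarrow> real \<Rightarrow> 'a \<Rightarrow> 'a"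
  where "shom q c k x = sinv q (c + k *\<^sub>R (sinv q x - c))"

lemma shom_pre:
  assumes "q \<in> usph" "c \<bullet> q = 0" "x \<in> usph" "x \<noteq> q"
  shows "c + k *\<^sub>R (sinv q x - c) \<noteq> q"
  by (rule sinv_orth_sphere(2)[OF assms(1)])
     (use assms sinv_sphere_orth[of q x] in \<open>simp add: inner_add_left inner_diff_left\<close>)

lemma aconf_shom:
  assumes "q \<in> usph" "c \<bullet> q = 0" "k > 0" "A \<subseteq> usph - {q}"
  shows "aconf A (shom q c k)"
proof -
  have "aconf A (\<lambda>x. c + k *\<^sub>R (sinv q x - c))"
    by (rule aconf_compose[OF aconf_sinv aconf_homothety[of k UNIV]]) (use assms in auto)
  then show ?thesis
    unfolding shom_def[abs_def]
    by (rule aconf_compose[OF _ aconf_sinv[of q "-{q}"]]) (use assms shom_pre in blast)+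
qed

lemma smap_eq_shom:
  assumes "x \<noteq> q" "h (norm (sinv q x - c)) = k * norm (sinv q x - c)"
  shows "smap q c h x = shom q c k x"
proof -
  have "rad h (sinv q x - c) = k *\<^sub>R (sinv q x - c)"
    by (rule rad_eq_scaleR) (rule assms(2))
  then show ?thesis using assms(1) by (simp add: smap_def shom_def)
qed

lemma smap_eq_self:
  assumes "x \<noteq> q" "h (norm (sinv q x - c)) = norm (sinv q x - c)"
  shows "smap q c h x = x"
  using smap_eq_shom[of x q h c 1] assms by (simp add: shom_def sinv_sinv)

lemma shom_shom:
  assumes "q \<in> usph" "c \<bullet> q = 0" "x \<in> usph" "x \<noteq> q" "k \<noteq> 0"
  shows "shom q c (1 / k) (shom q c k x) = x"
  using shom_pre[OF assms(1-4), of k] assms(4,5) unfolding shom_def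
  by (simp add: sinv_sinv)

section \<open>Transplanting conformality\<close>

lemma chart_openin:
  assumes "open G"
  shows "openin (top_of_set usph) {x \<in> usph. x \<noteq> q \<and> sinv q x \<in> G}"
proof -
  have "openin (top_of_set (usph - {q})) ((usph - {q}) \<inter> sinv q -` G)"
    by (rule continuous_openin_preimage_gen[OF continuous_on_sinv assms]) simp
  moreover have "openin (top_of_set usph) (usph - {q})"
    by (simp add: openin_delete)
  ultimately have "openin (top_of_set usph) ((usph - {q}) \<inter> sinv q -` G)"
    by (rule openin_trans)
  moreover have "(usph - {q}) \<inter> sinv q -` G = {x \<in> usph. x \<noteq> q \<and> sinv q x \<in> G}" by auto
  ultimately show ?thesis by simp
qed

lemma chart_ball:
  assumes U: "openin (top_of_set usph) U" and c: "c \<in> U" "c \<noteq> q"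
  obtains e where "e > 0"
    "\<And>x. x \<in> usph \<Longrightarrow> x \<noteq> q \<Longrightarrow> norm (sinv q x - sinv q c) < e \<Longrightarrow> x \<in> U"
proof -
  obtain O' where O': "open O'" "U = usph \<inter> O'" using U by (auto simp: openin_open)
  have "continuous (at (sinv q c)) (sinv q)"
    by (rule continuous_on_interior[OF continuous_on_sinv[of q "-{q}"]])
       (use sinv_neq[OF c(2)] in \<open>simp_all add: interior_open open_Compl\<close>)
  moreover have "sinv q (sinv q c) \<in> O'" using sinv_sinv[OF c(2)] c(1) O' by auto
  ultimately obtain e where e: "e > 0" "\<And>y. dist y (sinv q c) < e \<Longrightarrow> sinv q y \<in> O'"
    using O'(1) continuous_at_open[of "sinv q c" "sinv q"] open_dist by (metis (no_types, lifting))
  show ?thesis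
  proof (rule that[OF e(1)])
    fix x assume "x \<in> usph" "x \<noteq> q" "norm (sinv q x - sinv q c) < e"
    then show "x \<in> U" using e(2)[of "sinv q x"] O' by (simp add: dist_norm sinv_sinv)
  qed
qed

lemma chart_bounded:
  assumes "compact K" "q \<notin> K"
  obtains R where "R > 0" "\<And>x. x \<in> K \<Longrightarrow> norm (sinv q x - c) \<le> R"
proof -
  have "bounded ((\<lambda>x. sinv q x - c) ` K)"
    using assms by (intro compact_imp_bounded compact_continuous_image continuous_intros continuous_on_sinv)
  then show ?thesis using that by (auto simp: bounded_pos)
qed

text \<open>A connected set with more than one point has no isolated points, and with
  \<open>x\<close> the sphere contains \<open>- x\<close>. This supplies a point of the conformal
  germ in general position.\<close>

lemma infinite_openin_sphere:
  fixes W :: "'a::euclidean_space set"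
  assumes "DIM('a) \<ge> 2" "openin (top_of_set usph) W" "W \<noteq> {}"
  shows "infinite W"
proof -
  obtain x where x: "x \<in> W" using assms by blast
  then have xs: "x \<in> usph" using assms(2) openin_imp_subset by blast
  then have "- x \<in> usph" "- x \<noteq> x"
    using scaleR_2[of x] by (auto simp: neg_eq_iff_add_eq_0)
  moreover have "connected (usph :: 'a set)" using assms(1) by (simp add: connected_sphere)
  moreover have "\<nexists>a. usph = {a :: 'a}" using calculation xs by (metis singletonD)
  ultimately have "x islimpt usph"
    using xs by (intro connected_imp_perfect) auto
  then show ?thesis using infinite_openin[OF assms(2) x] by blast
qed

text \<open>
  A homeomorphism that is conformal somewhere is turned into one that is conformal somewhere in
  \<open>U\<close>, without changing it off \<open>U\<close>: \<open>\<sigma>\<close> carries a large region containing the point \<open>x\<^sub>1\<close> into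
  \<open>U\<close>, and \<open>d\<close> moves \<open>f x\<^sub>1\<close> into the place where \<open>f \<circ> \<sigma> \<circ> f\<^sup>-\<^sup>1\<close> is the identity.
\<close>

lemma conformal_germ_transplant:
  fixes f :: "'a::euclidean_space \<Rightarrow> 'a"
  assumes dim: "DIM('a) \<ge> 2" and f: "sphere_homeo f"
    and W: "openin (top_of_set usph) W" "W \<noteq> {}" "aconf W f"
    and U: "openin (top_of_set usph) U" "U \<noteq> {}" and q: "q \<in> usph - U"
  obtains f' b where "sphere_homeo f'" "\<And>x. x \<in> usph - U \<Longrightarrow> f' x = f x"
    "openin (top_of_set usph) b" "b \<noteq> {}" "b \<subseteq> U" "aconf b f'"
proof -
  obtain c where c: "c \<in> U" using U by blast
  have Us: "U \<subseteq> usph" and Ws: "W \<subseteq> usph" using U W openin_imp_subset by blast+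
  have qs: "q \<in> usph" and qc: "c \<noteq> q" and cs: "c \<in> usph" using q c Us by auto
  \<comment> \<open>\<open>c\<close> and \<open>f c\<close> will be the centres of the charts at
    \<open>q\<close> and \<open>f q\<close>. The point \<open>x1\<close> must avoid \<open>c\<close>
    too, because near \<open>c\<close> the map \<sigma> is the identity and not a dilation.\<close>
  have "infinite (W - {q, c})" using infinite_openin_sphere[OF dim W(1,2)] by simp
  then obtain x1 where x1: "x1 \<in> W" "x1 \<noteq> q" "x1 \<noteq> c"
    by (metis Diff_iff all_not_in_conv finite.emptyI insertCI)
  have x1s: "x1 \<in> usph" using x1 Ws by blast
  define c0 where "c0 = sinv q c"
  have c0: "c0 \<bullet> q = 0" unfolding c0_def by (rule sinv_sphere_orth[OF qs cs qc])
  define p where "p = f q"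
  have ps: "p \<in> usph" unfolding p_def by (rule sphere_homeo_in[OF f qs])
  have fp: "f x \<noteq> p" if "x \<in> usph" "x \<noteq> q" for x
    unfolding p_def using sphere_homeo_eq_iff[OF f that(1) qs] that by blast
  have fs: "f x \<in> usph" if "x \<in> usph" for x using sphere_homeo_in[OF f that] .
  define e0 where "e0 = sinv p (f c)"
  have e0: "e0 \<bullet> p = 0" unfolding e0_def by (rule sinv_sphere_orth[OF ps fs[OF cs] fp[OF cs qc]])
  define d0 where "d0 = norm (sinv p (f x1) - e0)"
  \<comment> \<open>\<open>d\<close> will be supported in the chart ball of radius \<open>B\<close>
    about \<open>e0\<close> and be a dilation within \<open>B / 2\<close>, which exceeds the radius
    \<open>d0\<close> of \<open>f x1\<close>.\<close>
  define B where "B = 2 * d0 + 1"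
  have B: "B > 0" "2 * d0 < B" "0 \<le> d0" by (auto simp: B_def d0_def add_nonneg_pos)
  \<comment> \<open>Outside \<open>K\<close> the map \<open>d\<close> fixes \<open>f x\<close>, so
    it is \<open>K\<close> that \<sigma> has to carry into \<open>U\<close>. As \<open>d\<close> is
    trivial near \<open>p\<close>, the set \<open>K\<close> keeps away from \<open>q\<close> and is
    bounded in the chart there.\<close>
  define K where "K = {x \<in> usph. x \<noteq> q \<and> norm (sinv p (f x) - e0) \<le> B}"
  obtain R where R: "R > 0" "\<And>x. x \<in> K \<Longrightarrow> norm (sinv q x - c0) \<le> R"
  proof -
    let ?C = "cball e0 B \<inter> {z. p \<bullet> z = 0}"
    have "p \<notin> ?C" using ps by (auto simp: norm_eq_1)
    moreover have "compact ?C" by (intro compact_Int_closed closed_hyperplane) auto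
    ultimately have "compact (sinv p ` ?C)"
      by (intro compact_continuous_image continuous_on_sinv)
    moreover have sub: "sinv p ` ?C \<subseteq> usph"
      using sinv_orth_sphere(1)[OF ps] by (auto simp: inner_commute)
    ultimately have "compact (inv_into usph f ` (sinv p ` ?C))"
      using sphere_homeo_compact[OF sphere_homeo_inv[OF f]] by blast
    moreover have "K \<subseteq> inv_into usph f ` (sinv p ` ?C)"
    proof
      fix x assume x: "x \<in> K"
      then have xs: "x \<in> usph" and xq: "x \<noteq> q" by (auto simp: K_def)
      have "sinv p (f x) \<in> ?C"
        using x sinv_sphere_orth[OF ps fs[OF xs] fp[OF xs xq]]
        by (auto simp: K_def dist_norm norm_minus_commute inner_commute)
      moreover have "x = inv_into usph f (sinv p (sinv p (f x)))"
        by (simp add: sinv_sinv[OF fp[OF xs xq]] sphere_homeo_inv_left[OF f xs])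
      ultimately show "x \<in> inv_into usph f ` (sinv p ` ?C)" by blast
    qed
    moreover have "q \<notin> inv_into usph f ` (sinv p ` ?C)"
    proof
      assume "q \<in> inv_into usph f ` (sinv p ` ?C)"
      then obtain z where z: "z \<in> ?C" "q = inv_into usph f (sinv p z)" by blast
      then have "p = sinv p z"
        using sub unfolding p_def by (metis (no_types) f image_subset_iff sphere_homeo_inv_right)
      moreover have "z \<noteq> p" using z \<open>p \<notin> ?C\<close> by blast
      ultimately show False using sinv_neq by metis
    qed
    ultimately show ?thesis using chart_bounded[of _ q c0] that by (metis subsetD)
  qed
  obtain \<epsilon> where \<epsilon>: "\<epsilon> > 0"
    "\<And>x. x \<in> usph \<Longrightarrow> x \<noteq> q \<Longrightarrow> norm (sinv q x - c0) < \<epsilon> \<Longrightarrow> x \<in> U"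
    unfolding c0_def using chart_ball[OF U(1) c qc] by blast
  define l where "l = min (1/2) (\<epsilon> / (2 * R))"
  have l: "0 < l" "l < 1" "l * R < \<epsilon>"
  proof -
    show "0 < l" "l < 1" using \<epsilon>(1) R(1) by (auto simp: l_def)
    have "l * R \<le> \<epsilon> / (2 * R) * R" using R(1) by (intro mult_right_mono) (auto simp: l_def)
    then show "l * R < \<epsilon>" using R(1) \<epsilon>(1) by (simp add: field_simps)
  qed
  define r1 where "r1 = norm (sinv q x1 - c0)"
  have r1: "0 < r1" using x1 sinv_eq_iff[OF x1(2) qc] by (simp add: r1_def c0_def)
  have x1K: "x1 \<in> K" using x1s x1(2) B by (simp add: K_def flip: d0_def)
  \<comment> \<open>The dilation range of \<open>core\<close> now starts at radius
    \<open>2 * a / l = r1 / 2\<close>, short of \<open>x1\<close>, while \<sigma> is still the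
    identity on the chart ball of radius \<open>a\<close> about \<open>c\<close>.\<close>
  define a where "a = l * r1 / 4"
  have a: "0 < a" "2 * a \<le> l * R" "2 * a < l * r1"
  proof -
    show "0 < a" "2 * a < l * r1" using l r1 by (auto simp: a_def)
    have "l * r1 \<le> l * R" using R(2)[OF x1K] l by (simp add: r1_def)
    then show "2 * a \<le> l * R" using \<open>2 * a < l * r1\<close> by linarith
  qed
  define \<sigma> where "\<sigma> = smap q c0 (core l a)"
  have pc: "profile l (core l a)" by (rule profile_core[OF l(1,2) a(1)])
  have \<sigma>: "sphere_homeo \<sigma>" unfolding \<sigma>_def by (rule smap_homeo[OF qs c0 pc])
  define b0 where "b0 = {x \<in> usph. x \<noteq> q \<and> sinv q x \<in> ball c0 a}"
  have b0: "openin (top_of_set usph) b0" "c \<in> b0"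
    using cs qc a unfolding b0_def by (intro chart_openin open_ball, simp add: c0_def)
  have \<sigma>b0: "\<sigma> x = x" if "x \<in> b0" for x
    unfolding \<sigma>_def
    by (rule smap_eq_self, use that in \<open>simp add: b0_def\<close>, rule core_small)
       (use that l in \<open>auto simp: b0_def dist_norm norm_minus_commute\<close>)
  have \<sigma>K: "\<sigma> x \<in> U" if "x \<in> K" for x
  proof -
    have x: "x \<in> usph" "x \<noteq> q" using that by (auto simp: K_def)
    have "norm (sinv q (\<sigma> x) - c0) = core l a (norm (sinv q x - c0))"
      unfolding \<sigma>_def by (rule smap_chart_norm[OF qs c0 x pc])
    also have "\<dots> \<le> l * R" by (rule core_bound[OF l(1) _ R(2)[OF that] a(2)]) simp
    also have "\<dots> < \<epsilon>" by (rule l(3))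
    finally show ?thesis using \<epsilon>(2) smap_chart(1,2)[OF qs c0 x] by (auto simp: \<sigma>_def)
  qed
  have "f c \<in> f ` b0" using b0 by blast
  then obtain \<epsilon>' where \<epsilon>': "\<epsilon>' > 0"
    "\<And>x. x \<in> usph \<Longrightarrow> x \<noteq> p \<Longrightarrow> norm (sinv p x - e0) < \<epsilon>' \<Longrightarrow> x \<in> f ` b0"
    unfolding e0_def using chart_ball[OF sphere_homeo_openin[OF f b0(1)] _ fp[OF cs qc]] by metis
  define m where "m = min (1/2) (\<epsilon>' / (2 * B))"
  have m: "0 < m" "m < 1" "m * d0 < \<epsilon>'"
  proof -
    show "0 < m" "m < 1" using \<epsilon>'(1) B by (auto simp: m_def)
    have "m * d0 \<le> \<epsilon>' / (2 * B) * d0" using B by (intro mult_right_mono) (auto simp: m_def)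
    also have "\<dots> < \<epsilon>'"
    proof -
      have "\<epsilon>' * d0 < \<epsilon>' * (2 * B)" using B \<epsilon>'(1) by (intro mult_strict_left_mono) auto
      then show ?thesis using B by (simp add: field_simps)
    qed
    finally show "m * d0 < \<epsilon>'" .
  qed
  define d where "d = smap p e0 (squeeze m B)"
  have pd: "profile m (squeeze m B)" by (rule profile_squeeze[OF m(1,2) B(1)])
  have d: "sphere_homeo d" unfolding d_def by (rule smap_homeo[OF ps e0 pd])
  let ?fi = "inv_into usph f" and ?\<sigma>i = "inv_into usph \<sigma>"
  \<comment> \<open>First a conjugate by \<sigma> of
    \<open>f\<^sup>-\<^sup>1 \<circ> d \<circ> f\<close>, then \<open>f\<close>. The map in the
    middle moves only points of \<open>K\<close>, so \<open>f'\<close> can differ from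
    \<open>f\<close> only on the image of \<open>K\<close> under \<sigma>, a subset of
    \<open>U\<close>.\<close>
  define f' where "f' = (\<lambda>y. f (\<sigma> (?fi (d (f (?\<sigma>i y))))))"
  have hf': "sphere_homeo f'"
    unfolding f'_def using f \<sigma> d sphere_homeo_inv[OF f] sphere_homeo_inv[OF \<sigma>]
    by (intro sphere_homeo_compose[OF _ f] sphere_homeo_compose[OF _ \<sigma>] sphere_homeo_compose[OF _ d]
        sphere_homeo_compose[OF _ sphere_homeo_inv[OF f]])
  have off: "f' y = f y" if "y \<in> usph - U" for y
  proof -
    let ?x = "?\<sigma>i y"
    have xs: "?x \<in> usph" and \<sigma>x: "\<sigma> ?x = y"
      using that sphere_homeo_in[OF sphere_homeo_inv[OF \<sigma>]] sphere_homeo_inv_right[OF \<sigma>] by auto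
    have xK: "?x \<notin> K" using \<sigma>K[of ?x] \<sigma>x that by auto
    have "d (f ?x) = f ?x"
    proof (cases "?x = q")
      case True
      then show ?thesis by (simp add: d_def p_def)
    next
      case False
      then have "B \<le> norm (sinv p (f ?x) - e0)" using xK xs by (auto simp: K_def)
      then show ?thesis unfolding d_def
        by (intro smap_eq_self fp[OF xs False] squeeze_large)
    qed
    then show ?thesis unfolding f'_def using sphere_homeo_inv_left[OF f xs] \<sigma>x by simp
  qed
  \<comment> \<open>On \<open>N\<close> the map \<open>f\<close> is conformal, \<sigma> and
    \<open>d\<close> are dilations of their charts, and \<open>d\<close> sends \<open>f x\<close>
    into the image of \<open>b0\<close>, where the outer \<sigma> has no effect. So
    \<open>f'\<close> is \<open>d \<circ> f \<circ> \<sigma>\<^sup>-\<^sup>1\<close> on the image of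
    \<open>N\<close> under \<sigma>.\<close>
  define N where "N = W \<inter> {x \<in> usph. x \<noteq> q \<and> sinv q x \<in> - cball c0 (2 * a / l)} \<inter>
    {x \<in> usph. f x \<in> {y \<in> usph. y \<noteq> p \<and> sinv p y \<in> ball e0 (min (B / 2) (\<epsilon>' / m))}}"
  have N: "openin (top_of_set usph) N"
    unfolding N_def by (intro openin_Int W(1) chart_openin sphere_homeo_vimage_openin[OF f]) auto
  have NW: "N \<subseteq> W" by (auto simp: N_def)
  have Ns: "N \<subseteq> usph - {q}" by (auto simp: N_def)
  have NK: "N \<subseteq> K" using B(1) by (auto simp: N_def K_def dist_norm norm_minus_commute)
  have x1N: "x1 \<in> N"
  proof -
    have "2 * a / l < r1" using a(3) l by (simp add: field_simps)
    moreover have "d0 < B / 2" using B by simp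
    moreover have "d0 < \<epsilon>' / m" using m by (simp add: field_simps)
    ultimately show ?thesis
      using x1 x1s fs[OF x1s] fp[OF x1s x1(2)]
      by (auto simp: N_def dist_norm norm_minus_commute r1_def d0_def)
  qed
  have \<sigma>N: "\<sigma> x = shom q c0 l x" if "x \<in> N" for x
  proof -
    have "2 * a / l < norm (sinv q x - c0)"
      using that by (auto simp: N_def dist_norm norm_minus_commute)
    then have "2 * a \<le> l * norm (sinv q x - c0)" using l by (simp add: field_simps)
    then show ?thesis unfolding \<sigma>_def
      using that Ns by (intro smap_eq_shom core_large) auto
  qed
  have dN: "d (f x) = shom p e0 m (f x)" "?fi (d (f x)) \<in> b0" if "x \<in> N" for x
  proof -
    have xs: "x \<in> usph" and fxp: "f x \<noteq> p" using that by (auto simp: N_def)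
    have n: "norm (sinv p (f x) - e0) < B / 2" "norm (sinv p (f x) - e0) < \<epsilon>' / m"
      using that by (auto simp: N_def dist_norm norm_minus_commute)
    have sq: "squeeze m B (norm (sinv p (f x) - e0)) = m * norm (sinv p (f x) - e0)"
      using n by (intro squeeze_small m) auto
    then show "d (f x) = shom p e0 m (f x)" unfolding d_def by (intro smap_eq_shom fxp)
    have "norm (sinv p (d (f x)) - e0) = m * norm (sinv p (f x) - e0)"
      unfolding d_def smap_chart_norm[OF ps e0 fs[OF xs] fxp pd] by (rule sq)
    also have "\<dots> < \<epsilon>'" using n(2) m(1) by (simp add: field_simps)
    finally have "d (f x) \<in> f ` b0"
      using \<epsilon>'(2) smap_chart(1,2)[OF ps e0 fs[OF xs] fxp] by (auto simp: d_def)
    then show "?fi (d (f x)) \<in> b0"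
      using sphere_homeo_inv_left[OF f] by (auto simp: b0_def)
  qed
  have fi: "f' (\<sigma> x) = d (f x)" "?\<sigma>i (\<sigma> x) = x" if "x \<in> N" for x
  proof -
    have xs: "x \<in> usph" using that Ns by auto
    show "?\<sigma>i (\<sigma> x) = x" by (rule sphere_homeo_inv_left[OF \<sigma> xs])
    then show "f' (\<sigma> x) = d (f x)"
      unfolding f'_def
      using \<sigma>b0[OF dN(2)[OF that]] sphere_homeo_inv_right[OF f sphere_homeo_in[OF d fs[OF xs]]] by simp
  qed
  have aN: "aconf N (\<lambda>x. d (f x))"
  proof (rule aconf_compose[OF aconf_subset[OF W(3) NW], of "f ` N"])
    show "aconf (f ` N) d"
      by (rule aconf_cong[OF aconf_shom[OF ps e0 m(1)]]) (use dN(1) in \<open>auto simp: N_def\<close>)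
  qed auto
  let ?t = "shom q c0 (1 / l)"
  have t: "?t (\<sigma> x) = x" if "x \<in> N" for x
    unfolding \<sigma>N[OF that] by (rule shom_shom[OF qs c0]) (use that Ns l in auto)
  have "\<sigma> ` N \<subseteq> usph - {q}"
  proof (rule image_subsetI)
    fix x assume "x \<in> N"
    then have "x \<in> usph" "x \<noteq> q" using Ns by auto
    then show "\<sigma> x \<in> usph - {q}" using smap_chart(1,2)[OF qs c0] by (simp add: \<sigma>_def)
  qed
  then have "aconf (\<sigma> ` N) ?t" using l by (intro aconf_shom qs c0) auto
  then have "aconf (\<sigma> ` N) (\<lambda>y. d (f (?t y)))"
    by (rule aconf_compose[OF _ aN]) (use t in auto)
  then have "aconf (\<sigma> ` N) f'"
    by (rule aconf_cong) (use t fi in auto)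
  moreover have "\<sigma> ` N \<subseteq> U" using NK \<sigma>K by blast
  ultimately show ?thesis
    using that[OF hf' off sphere_homeo_openin[OF \<sigma> N]] x1N by blast
qed

section \<open>Shrinking the complement of a cell\<close>

text \<open>Invariance of domain in the stereographic chart from a point \<open>u\<close> outside
  \<open>C\<close>: there the target is a hyperplane of the same dimension as
  \<open>'b\<close>.\<close>

lemma cell_interior_openin:
  fixes \<phi> :: "'a::euclidean_space \<Rightarrow> 'b::euclidean_space"
  assumes hom: "homeomorphism C (cball 0 1) \<phi> \<psi>" and C: "C \<subseteq> usph" "C \<noteq> usph"
    and dim: "DIM('a) = Suc DIM('b)"
  shows "openin (top_of_set usph) (\<psi> ` ball 0 1)"
proof -
  obtain u where u: "u \<in> usph" "u \<notin> C" using C by blast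
  let ?H = "{z. u \<bullet> z = 0}"
  have u0: "u \<noteq> 0" using u by auto
  have \<psi>C: "\<psi> t \<in> C" if "t \<in> ball 0 1" for t
    using hom that by (auto simp: homeomorphism_def)
  have "openin (top_of_set ?H) ((\<lambda>t. sinv u (\<psi> t)) ` ball 0 1)"
  proof (rule invariance_of_domain_affine_sets[of UNIV])
    show "openin (top_of_set UNIV) (ball 0 1 :: 'b set)" by simp
    show "affine ?H" by (rule affine_hyperplane)
    show "aff_dim ?H \<le> aff_dim (UNIV :: 'b set)"
      using aff_dim_hyperplane[OF u0, of 0] dim by simp
    have "continuous_on (ball 0 1) \<psi>"
      using hom by (auto simp: homeomorphism_def intro: continuous_on_subset[OF _ ball_subset_cball])
    then show "continuous_on (ball 0 1) (\<lambda>t. sinv u (\<psi> t))"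
      using u \<psi>C
      by (intro continuous_on_compose2[of "-{u}" "sinv u" "ball 0 1" \<psi>] continuous_on_sinv) auto
    show "(\<lambda>t. sinv u (\<psi> t)) \<in> ball 0 1 \<rightarrow> ?H"
    proof
      fix t :: 'b assume "t \<in> ball 0 1"
      then have "\<psi> t \<in> usph" "\<psi> t \<noteq> u" using \<psi>C C(1) u(2) by blast+
      then show "sinv u (\<psi> t) \<in> ?H" using sinv_sphere_orth[OF u(1)] by (simp add: inner_commute)
    qed
    show "inj_on (\<lambda>t. sinv u (\<psi> t)) (ball 0 1)"
    proof (rule inj_onI)
      fix s t assume *: "s \<in> ball 0 1" "t \<in> ball 0 1" "sinv u (\<psi> s) = sinv u (\<psi> t)"
      then have "\<psi> s = \<psi> t" using sinv_eq_iff \<psi>C u(2) by metis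
      then show "s = t" using hom * by (metis ball_subset_cball homeomorphism_def subsetD)
    qed
  qed simp
  then obtain G where G: "open G" "(\<lambda>t. sinv u (\<psi> t)) ` ball 0 1 = ?H \<inter> G"
    by (auto simp: openin_open)
  have "\<psi> ` ball 0 1 = {x \<in> usph. x \<noteq> u \<and> sinv u x \<in> G}"
  proof
    show "\<psi> ` ball 0 1 \<subseteq> {x \<in> usph. x \<noteq> u \<and> sinv u x \<in> G}"
      using \<psi>C C(1) u(2) G(2) by blast
    show "{x \<in> usph. x \<noteq> u \<and> sinv u x \<in> G} \<subseteq> \<psi> ` ball 0 1"
    proof clarify
      fix x assume x: "x \<in> usph" "x \<noteq> u" "sinv u x \<in> G"
      then have "sinv u x \<in> ?H \<inter> G" using sinv_sphere_orth[OF u(1) x(1,2)] by (simp add: inner_commute)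
      then obtain t where t: "t \<in> ball 0 1" "sinv u x = sinv u (\<psi> t)" using G(2) by blast
      then have "x = \<psi> t" using sinv_eq_iff[of x u "\<psi> t"] \<psi>C u(2) x by metis
      then show "x \<in> \<psi> ` ball 0 1" using t(1) by blast
    qed
  qed
  then show ?thesis using chart_openin[OF G(1)] by metis
qed

text \<open>Invariance of domain in the other direction: the image of \<open>G\<close> is open in
  \<open>'b\<close> and contained in the closed ball, so it misses the bounding sphere.\<close>

lemma cell_norm_less:
  fixes \<phi> :: "'a::euclidean_space \<Rightarrow> 'b::euclidean_space"
  assumes hom: "homeomorphism C (cball 0 1) \<phi> \<psi>" and dim: "DIM('a) = Suc DIM('b)"
    and G: "openin (top_of_set usph) G" "G \<subseteq> C" and x: "x \<in> G"
  shows "norm (\<phi> x) < 1"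
proof -
  have "openin (top_of_set UNIV) (\<phi> ` G)"
  proof (rule invariance_of_domain_sphere_affine_set[OF _ _ _ _ _ _ G(1)])
    show "continuous_on G \<phi>" using hom G continuous_on_subset by (auto simp: homeomorphism_def)
    show "inj_on \<phi> G"
      by (rule inj_on_inverseI[of _ \<psi>]) (use hom G in \<open>auto simp: homeomorphism_def\<close>)
  qed (use dim in auto)
  then have "open (\<phi> ` G)" by simp
  moreover have "\<phi> ` G \<subseteq> cball 0 1" using hom G by (auto simp: homeomorphism_def)
  ultimately have "\<phi> ` G \<subseteq> ball 0 1" by (metis interior_cball interior_maximal)
  then show ?thesis using x by auto
qed

text \<open>Diameters tending to 0, for an index set without order. Phrased by distances, the
  condition passes directly to images under uniformly continuous maps.\<close>

definition null_family :: "'i set \<Rightarrow> ('i \<Rightarrow> 'a::metric_space set) \<Rightarrow> bool"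
  where "null_family I W \<longleftrightarrow> (\<forall>e>0. finite {i \<in> I. \<not> (\<forall>x\<in>W i. \<forall>y\<in>W i. dist x y < e)})"

lemma null_family_image:
  assumes W: "null_family I W" "\<And>i. i \<in> I \<Longrightarrow> W i \<subseteq> A" and f: "uniformly_continuous_on A f"
  shows "null_family I (\<lambda>i. f ` W i)"
  unfolding null_family_def
proof (intro allI impI)
  fix e :: real assume "e > 0"
  then obtain d where d: "d > 0" "\<And>x y. x \<in> A \<Longrightarrow> y \<in> A \<Longrightarrow> dist x y < d \<Longrightarrow> dist (f x) (f y) < e"
    using f unfolding uniformly_continuous_on_def by metis
  have "{i \<in> I. \<not> (\<forall>x\<in>f ` W i. \<forall>y\<in>f ` W i. dist x y < e)} \<subseteq>
    {i \<in> I. \<not> (\<forall>x\<in>W i. \<forall>y\<in>W i. dist x y < d)}"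
    using d(2) W(2) by (blast dest: subsetD)
  then show "finite {i \<in> I. \<not> (\<forall>x\<in>f ` W i. \<forall>y\<in>f ` W i. dist x y < e)}"
    using W(1) d(1) finite_subset unfolding null_family_def by blast
qed

text \<open>
  Given sets \<open>A i\<close> of reals that are uniformly kept away from \<open>1\<close> as soon as they meet \<open>[0, r]\<close>,
  there is a profile that is small on \<open>[0, r\<^sub>0]\<close> and yet hardly expands any \<open>A i\<close>: it climbs by many
  small ramps, placed so that each \<open>A i\<close> meets at most two of them.
\<close>

lemma exists_slow_profile:
  fixes A :: "'i \<Rightarrow> real set"
  assumes gap: "\<And>r. 0 \<le> r \<Longrightarrow> r < 1 \<Longrightarrow>
      \<exists>r'. r < r' \<and> r' < 1 \<and> (\<forall>i\<in>I. (\<exists>x\<in>A i. x \<le> r) \<longrightarrow> (\<forall>x\<in>A i. x \<le> r'))"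
    and r0: "0 \<le> r0" "r0 < 1" and pos: "\<epsilon> > 0" "\<rho> > 0"
  obtains \<kappa> l where "profile l \<kappa>" "\<kappa> 1 = 1" "\<And>t. t \<le> r0 \<Longrightarrow> \<kappa> t < \<rho>"
    "\<And>i a b. i \<in> I \<Longrightarrow> a \<in> A i \<Longrightarrow> b \<in> A i \<Longrightarrow> \<bar>\<kappa> a - \<kappa> b\<bar> \<le> \<bar>a - b\<bar> + \<epsilon>"
proof -
  obtain g where g: "\<And>r. 0 \<le> r \<Longrightarrow> r < 1 \<Longrightarrow> r < g r \<and> g r < 1 \<and>
      (\<forall>i\<in>I. (\<exists>x\<in>A i. x \<le> r) \<longrightarrow> (\<forall>x\<in>A i. x \<le> g r))"
    using gap by metis
  \<comment> \<open>Thresholds from iterating the gap function: a set \<open>A i\<close> with a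
    point up to \<open>s n\<close> stays below or at \<open>s (Suc n)\<close>. Each ramp climbs
    between two consecutive thresholds.\<close>
  define s where "s n = (g ^^ n) r0" for n
  have s: "r0 \<le> s n \<and> s n < 1 \<and> s n < s (Suc n)" for n
  proof (induction n)
    case 0
    then show ?case using g[OF r0] r0 by (simp add: s_def)
  next
    case (Suc n)
    then have "0 \<le> s n" using r0 by linarith
    then have "s (Suc n) < 1" using g[of "s n"] Suc by (simp add: s_def)
    moreover have "0 \<le> s (Suc n)" using Suc r0 by linarith
    ultimately have "s (Suc n) < s (Suc (Suc n))" using g[of "s (Suc n)"] by (simp add: s_def)
    then show ?case using Suc \<open>s (Suc n) < 1\<close> by simp
  qed
  have sA: "y \<le> s (Suc n)" if "i \<in> I" "x \<in> A i" "y \<in> A i" "x \<le> s n" for i x y n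
    using g[of "s n"] s[of n] r0 that by (auto simp: s_def)
  have smono: "strict_mono s" using s by (simp add: strict_mono_Suc_iff)
  define ramp where "ramp n t = min 1 (max 0 ((t - s n) / (s (Suc n) - s n)))" for n t
  have ramp_mono: "ramp n t \<le> ramp n t'" if "t \<le> t'" for n t t'
  proof -
    have "(t - s n) / (s (Suc n) - s n) \<le> (t' - s n) / (s (Suc n) - s n)"
      using that s[of n] by (intro divide_right_mono) auto
    then show ?thesis by (auto simp: ramp_def)
  qed
  have ramp0: "ramp n t = 0" if "t \<le> s n" for n t
    using that s[of n] by (simp add: ramp_def divide_nonpos_pos max_absorb1)
  have ramp1: "ramp n t = 1" if "s (Suc n) \<le> t" for n t
  proof -
    have "1 \<le> (t - s n) / (s (Suc n) - s n)" using that s[of n] by (simp add: le_divide_eq)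
    then show ?thesis by (simp add: ramp_def)
  qed
  have ramp_bd: "0 \<le> ramp n t" "ramp n t \<le> 1" for n t by (auto simp: ramp_def)
  \<comment> \<open>The linear part \<open>\<alpha> * t\<close> makes \<kappa> strictly increasing
    and alone stays below \<rho>; \<open>m\<close> ramps of height \<open>w\<close> share the
    remaining rise to 1. Since a set sees at most two ramps, \<open>m\<close> is taken so large that
    \<open>2 * w \<le> \<epsilon>\<close>.\<close>
  obtain m :: nat where m: "2 / \<epsilon> < real m" using reals_Archimedean2 by blast
  have m0: "m > 0" using m pos(1) by (metis divide_pos_pos gr0I less_trans not_less_iff_gr_or_eq of_nat_0 zero_less_numeral)
  define \<alpha> where "\<alpha> = min (1/2) (\<rho> / 2)"
  have \<alpha>: "0 < \<alpha>" "\<alpha> < 1" "\<alpha> < \<rho>" using pos by (auto simp: \<alpha>_def)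
  define w where "w = (1 - \<alpha>) / real m"
  have w: "0 < w" "w * real m = 1 - \<alpha>" "2 * w \<le> \<epsilon>"
  proof -
    show "0 < w" "w * real m = 1 - \<alpha>" using \<alpha> m0 by (auto simp: w_def)
    have "2 < \<epsilon> * real m" using m pos(1) by (simp add: field_simps)
    then have "2 / real m \<le> \<epsilon>" using m0 by (simp add: field_simps)
    moreover have "w \<le> 1 / real m" unfolding w_def using \<alpha> by (intro divide_right_mono) auto
    ultimately show "2 * w \<le> \<epsilon>" by simp
  qed
  define \<kappa> where "\<kappa> t = \<alpha> * t + w * (\<Sum>n<m. ramp n t)" for t
  show ?thesis
  proof (rule that)
    show "profile \<alpha> \<kappa>"
      unfolding profile_def
    proof (intro conjI allI impI)
      have "ramp n 0 = 0" for n using ramp0 s[of n] r0 by simp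
      then show "\<kappa> 0 = 0" by (simp add: \<kappa>_def)
      show "continuous_on {0..} \<kappa>"
        unfolding \<kappa>_def ramp_def using s by (intro continuous_intros) (metis less_irrefl right_minus_eq)
      show "strict_mono_on {0..} \<kappa>"
      proof (rule strict_mono_onI)
        fix t t' :: real assume "t < t'"
        then have "\<alpha> * t < \<alpha> * t'" using \<alpha> by simp
        moreover have "w * (\<Sum>n<m. ramp n t) \<le> w * (\<Sum>n<m. ramp n t')"
          using w(1) \<open>t < t'\<close> ramp_mono by (intro mult_left_mono sum_mono) auto
        ultimately show "\<kappa> t < \<kappa> t'" by (simp add: \<kappa>_def)
      qed
      show "\<alpha> * t \<le> \<kappa> t" for t
        using w(1) ramp_bd(1) by (simp add: \<kappa>_def sum_nonneg)
    qed (rule \<alpha>)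
    have "ramp n 1 = 1" for n by (rule ramp1) (use s[of "Suc n"] in simp)
    then show "\<kappa> 1 = 1" using w(2) by (simp add: \<kappa>_def)
    show "\<kappa> t < \<rho>" if "t \<le> r0" for t
    proof -
      have "ramp n t = 0" for n by (rule ramp0) (use that s[of n] in linarith)
      moreover have "\<alpha> * t \<le> \<alpha> * 1" using that r0 \<alpha> by (intro mult_left_mono) auto
      ultimately show ?thesis using \<alpha>(3) by (simp add: \<kappa>_def)
    qed
    have key: "\<bar>\<kappa> a - \<kappa> b\<bar> \<le> \<bar>a - b\<bar> + \<epsilon>" if i: "i \<in> I" and a: "a \<in> A i" and b: "b \<in> A i" and "a \<le> b" for i a b
    proof -
      have "\<exists>k. \<forall>n<m. n \<notin> {k, Suc k} \<longrightarrow> ramp n b = ramp n a"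
      proof (cases "\<exists>n. a < s (Suc n)")
        case True
        \<comment> \<open>Ramps before \<open>k\<close> are complete at \<open>a\<close>. As
          \<open>a < s (Suc k)\<close>, the thresholds give \<open>b \<le> s (Suc (Suc k))\<close>,
          so ramps after \<open>Suc k\<close> have not begun at \<open>b\<close>.\<close>
        define k where "k = (LEAST n. a < s (Suc n))"
        have k: "a < s (Suc k)" unfolding k_def by (rule LeastI_ex[OF True])
        have "ramp n b = ramp n a" if "n \<notin> {k, Suc k}" for n
        proof (cases "n < k")
          case True
          then have "s (Suc n) \<le> a" unfolding k_def by (meson not_less_Least not_less)
          then show ?thesis using ramp1 \<open>a \<le> b\<close> by simp
        next
          case False
          then have "s (Suc (Suc k)) \<le> s n" using that smono by (simp add: strict_mono_less_eq)
          moreover have "b \<le> s (Suc (Suc k))" using sA[OF i a b, of "Suc k"] k by simp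
          ultimately show ?thesis using ramp0 \<open>a \<le> b\<close> by simp
        qed
        then show ?thesis by blast
      next
        case False
        then have "ramp n b = ramp n a" for n using ramp1[of n a] ramp1[of n b] \<open>a \<le> b\<close>
          by (metis not_less order_trans)
        then show ?thesis by blast
      qed
      then obtain k where k: "\<forall>n<m. n \<notin> {k, Suc k} \<longrightarrow> ramp n b = ramp n a" ..
      have "ramp n b - ramp n a \<le> (if n \<in> {k, Suc k} then 1 else 0)" if "n < m" for n
        using k that ramp_bd[of n b] ramp_bd[of n a] by auto
      then have "(\<Sum>n<m. ramp n b - ramp n a) \<le> (\<Sum>n<m. if n \<in> {k, Suc k} then 1 else 0)"
        by (intro sum_mono) auto
      also have "\<dots> = real (card ({..<m} \<inter> {k, Suc k}))"
        by (simp add: sum.If_cases del: insert_iff)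
      also have "\<dots> \<le> 2"
        using card_mono[of "{k, Suc k}" "{..<m} \<inter> {k, Suc k}"] by simp
      finally have "(\<Sum>n<m. ramp n b) - (\<Sum>n<m. ramp n a) \<le> 2" by (simp add: sum_subtractf)
      then have "w * ((\<Sum>n<m. ramp n b) - (\<Sum>n<m. ramp n a)) \<le> w * 2"
        using w(1) by (intro mult_left_mono) auto
      moreover have "0 \<le> w * ((\<Sum>n<m. ramp n b) - (\<Sum>n<m. ramp n a))"
        using w(1) \<open>a \<le> b\<close> ramp_mono by (simp add: sum_mono)
      moreover have "0 \<le> \<alpha> * (b - a)" using \<alpha> \<open>a \<le> b\<close> by simp
      moreover have "\<alpha> * (b - a) \<le> 1 * (b - a)"
        by (rule mult_right_mono) (use \<alpha> \<open>a \<le> b\<close> in auto)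
      moreover have "\<kappa> b - \<kappa> a = \<alpha> * (b - a) + w * ((\<Sum>n<m. ramp n b) - (\<Sum>n<m. ramp n a))"
        by (simp add: \<kappa>_def algebra_simps)
      ultimately show ?thesis using w(3) \<open>a \<le> b\<close> by simp
    qed
    show "\<bar>\<kappa> a - \<kappa> b\<bar> \<le> \<bar>a - b\<bar> + \<epsilon>" if "i \<in> I" "a \<in> A i" "b \<in> A i" for i a b
      using key[OF that] key[OF that(1,3,2)] by (cases "a \<le> b") (auto simp: abs_minus_commute)
  qed
qed

section \<open>Cells in the sphere and their radial homeomorphisms\<close>

lemma compact_closed_sphere_subset:
  assumes "closed K" "K \<subseteq> usph" shows "compact K"
proof -
  have "usph \<inter> K = K" using assms(2) by blast
  then show ?thesis using compact_Int_closed[OF compact_sphere assms(1)] by metis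
qed

lemma compact_sphere_diff:
  assumes "openin (top_of_set usph) U" shows "compact (usph - U)"
proof -
  obtain G where G: "open G" "U = usph \<inter> G" using assms by (auto simp: openin_open)
  then have "usph - U = usph \<inter> - G" by blast
  then show ?thesis using compact_Int_closed[OF compact_sphere] G(1) by (metis closed_Compl)
qed

text \<open>The image of the open ball is open in the sphere by \<open>cell_interior_openin\<close>
  and misses \<open>U\<close>, so it contains no limit point of \<open>U\<close>.\<close>

lemma cell_boundary_norm:
  fixes \<phi> :: "'a::euclidean_space \<Rightarrow> 'b::euclidean_space"
  assumes hom: "homeomorphism (usph - U) (cball 0 1) \<phi> \<psi>" and dim: "DIM('a) = Suc DIM('b)"
    and U: "U \<subseteq> usph" "U \<noteq> {}" and y: "y \<in> closure U" "y \<in> usph - U"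
  shows "norm (\<phi> y) = 1"
proof (rule ccontr)
  assume "norm (\<phi> y) \<noteq> 1"
  moreover have "\<phi> y \<in> cball 0 1" using hom y by (auto simp: homeomorphism_def)
  ultimately have "\<phi> y \<in> ball 0 1" by simp
  moreover have "\<psi> (\<phi> y) = y" using hom y by (simp add: homeomorphism_def)
  ultimately have yi: "y \<in> \<psi> ` ball 0 1" by force
  have "openin (top_of_set usph) (\<psi> ` ball 0 1)"
    by (rule cell_interior_openin[OF hom _ _ dim]) (use U in auto)
  then obtain G where G: "open G" "\<psi> ` ball 0 1 = usph \<inter> G" by (auto simp: openin_open)
  then obtain x where "x \<in> U" "x \<in> G"
    using y(1) yi by (metis IntD2 closure_iff_nhds_not_empty disjoint_iff subset_refl)
  then have "x \<in> \<psi> ` ball 0 1" using G(2) U by blast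
  then show False
    using hom \<open>x \<in> U\<close> by (auto simp: homeomorphism_def)
qed

text \<open>The maximum of the norm over \<open>K\<close> is attained at a point of the open set off
  \<open>closure U\<close>, where \<open>cell_norm_less\<close> applies.\<close>

lemma cell_compact_norm_bound:
  fixes \<phi> :: "'a::euclidean_space \<Rightarrow> 'b::euclidean_space"
  assumes hom: "homeomorphism (usph - U) (cball 0 1) \<phi> \<psi>" and dim: "DIM('a) = Suc DIM('b)"
    and K: "compact K" "K \<subseteq> usph" "K \<inter> closure U = {}"
  obtains a where "a < 1" "\<And>x. x \<in> K \<Longrightarrow> norm (\<phi> x) \<le> a"
proof (cases "K = {}")
  case False
  have sub: "usph - closure U \<subseteq> usph - U" using closure_subset by blast
  have "continuous_on (usph - U) \<phi>" using hom by (simp add: homeomorphism_def)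
  then have "continuous_on K (\<lambda>x. norm (\<phi> x))"
    using K sub by (intro continuous_intros) (blast intro: continuous_on_subset)
  then obtain y where y: "y \<in> K" "\<And>x. x \<in> K \<Longrightarrow> norm (\<phi> x) \<le> norm (\<phi> y)"
    using continuous_attains_sup[OF K(1) False] by blast
  have "openin (top_of_set usph) (usph \<inter> - closure U)" by (rule openin_open_Int) (simp add: open_Compl)
  then have "norm (\<phi> y) < 1"
    using cell_norm_less[OF hom dim, of "usph \<inter> - closure U" y] sub K y(1) by blast
  then show ?thesis using that y(2) by blast
next
  case True
  then show ?thesis using that[of 0] by simp
qed

text \<open>By \<open>\<kappa> 1 = 1\<close> the radial map fixes the boundary of the cell, and all
  points of \<open>closure U\<close> outside \<open>U\<close> lie there. So it fits together with
  the identity of \<open>closure U\<close>, and both pieces live on closed sets.\<close>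

lemma cell_radial_homeo:
  fixes \<phi> :: "'a::euclidean_space \<Rightarrow> 'b::euclidean_space"
  assumes hom: "homeomorphism (usph - U) (cball 0 1) \<phi> \<psi>" and dim: "DIM('a) = Suc DIM('b)"
    and U: "openin (top_of_set usph) U" "U \<noteq> {}" and \<kappa>: "profile l \<kappa>" "\<kappa> 1 = 1"
  defines "\<tau> \<equiv> \<lambda>x. if x \<in> U then x else \<psi> (rad \<kappa> (\<phi> x))"
  shows "sphere_homeo \<tau>" "\<And>x. x \<in> usph - U \<Longrightarrow> \<tau> x \<in> usph - U \<and> \<phi> (\<tau> x) = rad \<kappa> (\<phi> x)"
proof -
  have Us: "U \<subseteq> usph" using U openin_imp_subset by blast
  have \<psi>: "\<psi> t \<in> usph - U" "\<phi> (\<psi> t) = t" if "t \<in> cball 0 1" for t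
    using hom that by (auto simp: homeomorphism_def)
  have \<phi>: "\<phi> x \<in> cball 0 1" "\<psi> (\<phi> x) = x" if "x \<in> usph - U" for x
    using hom that by (auto simp: homeomorphism_def)
  have \<kappa>1: "\<kappa> a \<le> 1 \<longleftrightarrow> a \<le> 1" if "0 \<le> a" for a
  proof -
    have "\<kappa> a \<le> \<kappa> 1 \<longleftrightarrow> a \<le> 1"
      using \<kappa>(1) that strict_mono_on_leD[of "{0..}" \<kappa>] strict_mono_onD[of "{0..}" \<kappa> 1 a]
      by (force simp: profile_def not_le[symmetric])
    then show ?thesis using \<kappa>(2) by simp
  qed
  have rc: "rad \<kappa> t \<in> cball 0 1" if "t \<in> cball 0 1" for t :: 'b
    using that \<kappa>1[of "norm t"] by (simp add: norm_rad[OF \<kappa>(1)])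
  show C: "\<tau> x \<in> usph - U \<and> \<phi> (\<tau> x) = rad \<kappa> (\<phi> x)" if "x \<in> usph - U" for x
    using that \<psi>[OF rc[OF \<phi>(1)[OF that]]] by (simp add: \<tau>_def)
  have "inj_on \<tau> usph"
  proof (rule inj_onI)
    fix x y assume x: "x \<in> usph" and y: "y \<in> usph" and eq: "\<tau> x = \<tau> y"
    show "x = y"
    proof (cases "x \<in> U \<or> y \<in> U")
      case True
      then show ?thesis using C[of x] C[of y] x y eq by (auto simp: \<tau>_def split: if_splits)
    next
      case False
      then have "rad \<kappa> (\<phi> x) = rad \<kappa> (\<phi> y)" using C[of x] C[of y] x y eq by auto
      then have "\<phi> x = \<phi> y" using rad_eq_iff[OF \<kappa>(1)] by blast
      moreover have "\<psi> (\<phi> x) = x" "\<psi> (\<phi> y) = y" using \<phi>(2) x y False by blast+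
      ultimately show ?thesis by metis
    qed
  qed
  moreover have "\<tau> ` usph = usph"
  proof
    show "\<tau> ` usph \<subseteq> usph"
    proof (rule image_subsetI)
      fix x :: 'a assume "x \<in> usph"
      then show "\<tau> x \<in> usph" using C[of x] by (cases "x \<in> U") (auto simp: \<tau>_def)
    qed
    show "usph \<subseteq> \<tau> ` usph"
    proof
      fix y :: 'a assume y: "y \<in> usph"
      show "y \<in> \<tau> ` usph"
      proof (cases "y \<in> U")
        case True
        then show ?thesis using y by (intro image_eqI[of _ _ y]) (auto simp: \<tau>_def)
      next
        case False
        then have yC: "y \<in> usph - U" using y by simp
        obtain r where r: "0 \<le> r" "\<kappa> r = norm (\<phi> y)" "rad \<kappa> (r *\<^sub>R sgn (\<phi> y)) = \<phi> y"
          using rad_surj[OF \<kappa>(1), of "\<phi> y"] by metis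
        have "\<kappa> r \<le> 1" using \<phi>(1)[OF yC] r(2) by simp
        then have "r \<le> 1" using \<kappa>1 r(1) by simp
        then have t: "r *\<^sub>R sgn (\<phi> y) \<in> cball 0 1" using r(1) by (simp add: norm_sgn)
        have "\<tau> (\<psi> (r *\<^sub>R sgn (\<phi> y))) = y"
          using \<psi>[OF t] r(3) \<phi>(2)[OF yC] by (simp add: \<tau>_def)
        then show ?thesis using \<psi>(1)[OF t] by (metis DiffD1 image_eqI)
      qed
    qed
  qed
  moreover have "continuous_on usph \<tau>"
  proof -
    have cl: "closure U \<subseteq> usph" using Us by (simp add: closure_minimal)
    have "continuous_on (closure U) \<tau>"
    proof (rule continuous_on_eq[OF continuous_on_id])
      fix x assume x: "x \<in> closure U"
      show "x = \<tau> x"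
      proof (cases "x \<in> U")
        case False
        then have xC: "x \<in> usph - U" using x cl by blast
        have "norm (\<phi> x) = 1" by (rule cell_boundary_norm[OF hom dim Us U(2) x xC])
        then have "rad \<kappa> (\<phi> x) = 1 *\<^sub>R \<phi> x" using \<kappa>(2) by (intro rad_eq_scaleR) simp
        then show ?thesis using False \<phi>(2)[OF xC] by (simp add: \<tau>_def)
      qed (simp add: \<tau>_def)
    qed
    moreover have "continuous_on (usph - U) \<tau>"
    proof (rule continuous_on_eq[of _ "\<lambda>x. \<psi> (rad \<kappa> (\<phi> x))"])
      have "continuous_on (usph - U) \<phi>" "continuous_on (cball 0 1) \<psi>"
        using hom by (auto simp: homeomorphism_def)
      moreover have "(\<lambda>x. rad \<kappa> (\<phi> x)) ` (usph - U) \<subseteq> cball 0 1"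
        by (rule image_subsetI) (rule rc[OF \<phi>(1)])
      ultimately show "continuous_on (usph - U) (\<lambda>x. \<psi> (rad \<kappa> (\<phi> x)))"
        by (metis continuous_on_compose2 continuous_on_rad[OF \<kappa>(1)])
    qed (auto simp: \<tau>_def)
    moreover have "closed (usph - U)"
      by (rule compact_imp_closed[OF compact_sphere_diff[OF U(1)]])
    ultimately have "continuous_on (closure U \<union> (usph - U)) \<tau>"
      by (intro continuous_on_closed_Un) auto
    moreover have "closure U \<union> (usph - U) = usph" using cl closure_subset by blast
    ultimately show ?thesis by simp
  qed
  ultimately show "sphere_homeo \<tau>" by (simp add: sphere_homeo_def bij_betw_def)
qed

text \<open>Points near \<open>q\<close> are far from \<open>c\<close> in the chart, where
  \<open>squeeze\<close> is the identity.\<close>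

lemma squeeze_near_pole:
  assumes "0 < B"
  obtains e where "e > 0" "\<And>x. dist x q < e \<Longrightarrow> smap q c (squeeze m B) x = x"
proof (rule that)
  let ?e = "2 / (B + norm (c - q))"
  have d: "B + norm (c - q) > 0" using assms by (simp add: add_pos_nonneg)
  then show "?e > 0" by simp
  fix x assume x: "dist x q < ?e"
  show "smap q c (squeeze m B) x = x"
  proof (cases "x = q")
    case False
    then have "norm (x - q) > 0" by simp
    then have "B + norm (c - q) < 2 / norm (x - q)"
      using x d by (simp add: dist_norm field_simps)
    moreover have "norm (sinv q x - q) \<le> norm (sinv q x - c) + norm (c - q)"
      using norm_triangle_ineq[of "sinv q x - c" "c - q"] by simp
    ultimately have "B \<le> norm (sinv q x - c)" by (simp add: norm_sinv_diff)
    then show ?thesis by (intro smap_eq_self False squeeze_large)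
  qed simp
qed

text \<open>The difference splits into a radial and an angular part. Only the radial part sees the
  slope of \<kappa>; the constant 4 bounds the angular part because \<open>u\<close> keeps away from
  0.\<close>

lemma norm_rad_diff_le:
  fixes u v :: "'b::real_normed_vector"
  assumes "profile l \<kappa>" "\<kappa> (norm v) \<le> 1" "1 / 2 \<le> norm u"
  shows "norm (rad \<kappa> u - rad \<kappa> v) \<le> \<bar>\<kappa> (norm u) - \<kappa> (norm v)\<bar> + 4 * norm (u - v)"
proof -
  have u0: "norm u > 0" using assms(3) by linarith
  have "norm (sgn u - sgn v) \<le> 4 * norm (u - v)"
  proof (cases "v = 0")
    case True
    then show ?thesis using assms(3) u0 by (simp add: norm_sgn)
  next
    case False
    have "norm u *\<^sub>R (sgn u - sgn v) = (u - v) + (norm v - norm u) *\<^sub>R sgn v"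
      by (simp add: scaleR_diff_right scaleR_diff_left norm_scaleR_sgn)
    then have "norm u * norm (sgn u - sgn v) \<le> norm (u - v) + norm ((norm v - norm u) *\<^sub>R sgn v)"
      by (metis abs_norm_cancel norm_scaleR norm_triangle_ineq)
    also have "\<dots> \<le> 2 * norm (u - v)"
      using norm_triangle_ineq3[of u v] False by (simp add: norm_sgn abs_minus_commute)
    finally have "norm u * norm (sgn u - sgn v) \<le> 2 * norm (u - v)" .
    moreover have "1 / 2 * norm (sgn u - sgn v) \<le> norm u * norm (sgn u - sgn v)"
      by (rule mult_right_mono[OF assms(3)]) simp
    ultimately show ?thesis by linarith
  qed
  moreover have "\<kappa> (norm v) * norm (sgn u - sgn v) \<le> 1 * norm (sgn u - sgn v)"
    by (rule mult_right_mono[OF assms(2)]) simp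
  moreover have "rad \<kappa> u - rad \<kappa> v = (\<kappa> (norm u) - \<kappa> (norm v)) *\<^sub>R sgn u + \<kappa> (norm v) *\<^sub>R (sgn u - sgn v)"
    by (simp add: rad_def scaleR_diff_left scaleR_diff_right)
  then have "norm (rad \<kappa> u - rad \<kappa> v) \<le> \<bar>\<kappa> (norm u) - \<kappa> (norm v)\<bar> * norm (sgn u) + \<bar>\<kappa> (norm v)\<bar> * norm (sgn u - sgn v)"
    by (metis norm_scaleR norm_triangle_ineq)
  moreover have "norm (sgn u) = 1" using u0 by (auto simp: norm_sgn)
  moreover have "0 \<le> \<kappa> (norm v)" using profile_nonneg[OF assms(1)] by simp
  ultimately show ?thesis by simp
qed

text \<open>
  The complement of \<open>U\<close> is a cell, with centre \<open>q\<close> say, but \<open>U\<close> may have no collar. A map \<open>M\<close> which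
  squeezes most of the sphere conformally into \<open>b\<close> and is the identity near \<open>q\<close> is conjugated by a
  radial map \<open>\<tau>\<close> of the cell which moves the complement of \<open>V\<close> close to \<open>q\<close>. Points that are
  moved by \<open>M\<close> return from \<open>\<tau>\<^sup>-\<^sup>1\<close> close to the image of the radial projection \<open>T\<close> to the
  boundary of the cell, and \<open>T\<close> does not depend on \<open>\<tau>\<close>; this controls the sets \<open>W i\<close>.
\<close>

lemma shrink_into:
  fixes \<phi> :: "'a::euclidean_space \<Rightarrow> 'b::euclidean_space"
  assumes hom: "homeomorphism (usph - U) (cball 0 1) \<phi> \<psi>" and dim: "DIM('a) = Suc DIM('b)"
    and U: "openin (top_of_set usph) U" "U \<noteq> {}"
    and b: "openin (top_of_set usph) b" "b \<noteq> {}" "b \<subseteq> U"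
    and V: "openin (top_of_set usph) V" "closure U \<subseteq> V"
    and W: "null_family I W" "\<And>i. i \<in> I \<Longrightarrow> W i \<subseteq> usph" "\<And>i. i \<in> I \<Longrightarrow> closure (W i) \<inter> closure U = {}"
    and \<delta>: "\<delta> > 0"
  obtains s where "sphere_homeo s" "\<And>x. x \<in> usph - V \<Longrightarrow> s x = x" "s ` U \<subseteq> b" "aconf U s"
    "\<And>i. i \<in> I \<Longrightarrow> (\<forall>x\<in>W i. s x = x) \<or> (\<forall>x\<in>W i. \<forall>y\<in>W i. dist (s x) (s y) < \<delta>)"
proof -
  let ?C = "usph - U"
  have Us: "U \<subseteq> usph" using U openin_imp_subset by blast
  then have clUs: "closure U \<subseteq> usph" by (simp add: closure_minimal)
  then have clU: "compact (closure U)" by (intro compact_closed_sphere_subset closed_closure)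
  have Cc: "compact ?C" by (rule compact_sphere_diff[OF U(1)])
  then have closedC: "closed ?C" by (rule compact_imp_closed)
  have \<psi>: "\<psi> t \<in> usph - U" "\<phi> (\<psi> t) = t" if "t \<in> cball 0 1" for t
    using hom that by (auto simp: homeomorphism_def)
  have \<phi>: "\<phi> x \<in> cball 0 1" "\<psi> (\<phi> x) = x" if "x \<in> usph - U" for x
    using hom that by (auto simp: homeomorphism_def)
  have \<phi>c: "continuous_on ?C \<phi>" and \<psi>c: "continuous_on (cball 0 1) \<psi>"
    using hom by (auto simp: homeomorphism_def)
  have \<phi>uc: "uniformly_continuous_on ?C \<phi>" by (rule compact_uniformly_continuous[OF \<phi>c Cc])
  have \<psi>uc: "uniformly_continuous_on (cball 0 1) \<psi>"
    by (rule compact_uniformly_continuous[OF \<psi>c compact_cball])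

  define q where "q = \<psi> 0"
  have qC: "q \<in> ?C" and \<phi>q: "\<phi> q = 0" using \<psi>[of 0] by (auto simp: q_def)
  then have qs: "q \<in> usph" by blast
  have qclU: "q \<notin> closure U"
    using cell_boundary_norm[OF hom dim Us U(2) _ qC] \<phi>q by auto
  obtain c where c: "c \<in> b" using b by blast
  have cs: "c \<in> usph" and qc: "c \<noteq> q" using c b Us qC by auto
  define c0 where "c0 = sinv q c"
  have c0: "c0 \<bullet> q = 0" unfolding c0_def by (rule sinv_sphere_orth[OF qs cs qc])
  obtain R where R: "R > 0" "\<And>x. x \<in> closure U \<Longrightarrow> norm (sinv q x - c0) \<le> R"
    using chart_bounded[OF clU qclU] by metis
  obtain \<epsilon> where \<epsilon>: "\<epsilon> > 0"
    "\<And>x. x \<in> usph \<Longrightarrow> x \<noteq> q \<Longrightarrow> norm (sinv q x - c0) < \<epsilon> \<Longrightarrow> x \<in> b"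
    unfolding c0_def using chart_ball[OF b(1) c qc] by metis
  define m where "m = min (1/2) (\<epsilon> / (2 * R))"
  have m: "0 < m" "m < 1" "m * R < \<epsilon>"
  proof -
    show "0 < m" "m < 1" using \<epsilon>(1) R(1) by (auto simp: m_def)
    have "m * R \<le> \<epsilon> / (2 * R) * R" using R(1) by (intro mult_right_mono) (auto simp: m_def)
    then show "m * R < \<epsilon>" using R(1) \<epsilon>(1) by (simp add: field_simps)
  qed
  \<comment> \<open>With \<open>B = 2 * R\<close> the map \<open>M\<close> is a true dilation on all
    of \<open>closure U\<close>, and its factor \<open>m\<close> takes this set into
    \<open>b\<close>.\<close>
  define B where "B = 2 * R"
  have B: "B > 0" using R by (simp add: B_def)
  define M where "M = smap q c0 (squeeze m B)"
  have pM: "profile m (squeeze m B)" by (rule profile_squeeze[OF m(1,2) B])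
  have M: "sphere_homeo M" unfolding M_def by (rule smap_homeo[OF qs c0 pM])
  have sqU: "squeeze m B (norm (sinv q x - c0)) = m * norm (sinv q x - c0)" if "x \<in> closure U" for x
    using R(2)[OF that] by (intro squeeze_small m) (auto simp: B_def)
  have MU: "M x \<in> b" "M x = shom q c0 m x" if "x \<in> closure U" for x
  proof -
    have x: "x \<in> usph" "x \<noteq> q" using that clUs qclU by auto
    show "M x = shom q c0 m x" unfolding M_def by (intro smap_eq_shom x(2)) (rule sqU[OF that])
    have "norm (sinv q (M x) - c0) = m * norm (sinv q x - c0)"
      unfolding M_def smap_chart_norm[OF qs c0 x pM] by (rule sqU[OF that])
    also have "\<dots> \<le> m * R" using R(2)[OF that] m(1) by simp
    finally show "M x \<in> b"
      using \<epsilon>(2) m(3) smap_chart(1,2)[OF qs c0 x] by (simp add: M_def)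
  qed
  obtain e where e: "e > 0" "\<And>x. dist x q < e \<Longrightarrow> M x = x"
    unfolding M_def using squeeze_near_pole[OF B] by metis
  obtain d where d: "d > 0" "\<And>t. t \<in> cball 0 1 \<Longrightarrow> dist t 0 < d \<Longrightarrow> dist (\<psi> t) (\<psi> 0) < e"
    using \<psi>c e(1) unfolding continuous_on_iff by (metis centre_in_cball zero_le_one)
  \<comment> \<open>\<open>M\<close> is the identity within radius \<open>2 * \<rho>\<close> of the
    cell. The factor 2 leaves room for a small set containing a moved point to lie wholly outside
    radius \<rho>.\<close>
  define \<rho> where "\<rho> = d / 2"
  have \<rho>: "\<rho> > 0" using d by (simp add: \<rho>_def)
  have Mid: "M x = x" if "x \<in> ?C" "norm (\<phi> x) < 2 * \<rho>" for x
    using d(2)[OF \<phi>(1)[OF that(1)]] that \<phi>(2)[OF that(1)] e(2) by (simp add: \<rho>_def q_def)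

  \<comment> \<open>\<open>Q\<close> avoids the centre of the cell, so that \<open>T\<close> is
    continuous on it. \<open>M\<close> maps it into itself: points of the sphere outside
    \<open>Q\<close> are fixed by \<open>M\<close>, hence are not images of other points.\<close>
  define Q where "Q = closure U \<union> {x \<in> ?C. \<rho> \<le> norm (\<phi> x)}"
  have Qs: "Q \<subseteq> usph" using clUs by (auto simp: Q_def)
  have "{x \<in> ?C. \<rho> \<le> norm (\<phi> x)} = ?C \<inter> (\<lambda>x. norm (\<phi> x)) -` {\<rho>..}" by auto
  also have "closed \<dots>"
    by (intro continuous_closed_preimage closedC continuous_intros \<phi>c closed_atLeast)
  finally have closed2: "closed {x \<in> ?C. \<rho> \<le> norm (\<phi> x)}" .
  then have "compact Q"
    by (intro compact_closed_sphere_subset[OF _ Qs]) (auto simp: Q_def)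
  define T where "T y = (if y \<in> U then y else \<psi> (sgn (\<phi> y)))" for y
  have Tbd: "T y = y" if "y \<in> closure U" for y
  proof (cases "y \<in> U")
    case False
    then have yC: "y \<in> ?C" using that clUs by blast
    have "norm (\<phi> y) = 1" by (rule cell_boundary_norm[OF hom dim Us U(2) that yC])
    then show ?thesis using False \<phi>(2)[OF yC] by (simp add: T_def sgn_div_norm)
  qed (simp add: T_def)
  have sgncb: "sgn t \<in> cball 0 1" for t :: 'b by (simp add: norm_sgn)
  have "continuous_on Q T"
    unfolding Q_def
  proof (intro continuous_on_closed_Un closed_closure closed2)
    show "continuous_on (closure U) T"
      by (rule continuous_on_eq[OF continuous_on_id]) (simp add: Tbd)
    have "continuous_on {x \<in> ?C. \<rho> \<le> norm (\<phi> x)} (\<lambda>y. \<psi> (sgn (\<phi> y)))"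
    proof (rule continuous_on_compose2[OF \<psi>c])
      have "continuous_on {x \<in> ?C. \<rho> \<le> norm (\<phi> x)} \<phi>" by (rule continuous_on_subset[OF \<phi>c]) auto
      then show "continuous_on {x \<in> ?C. \<rho> \<le> norm (\<phi> x)} (\<lambda>y. sgn (\<phi> y))"
        using \<rho> by (intro continuous_on_sgn) auto
    qed (use sgncb in auto)
    then show "continuous_on {x \<in> ?C. \<rho> \<le> norm (\<phi> x)} T"
      by (rule continuous_on_eq) (auto simp: T_def)
  qed
  moreover have MQ: "M x \<in> Q" if "x \<in> Q" for x
  proof (rule ccontr)
    assume n: "M x \<notin> Q"
    have xs: "x \<in> usph" using that Qs by blast
    then have Ms: "M x \<in> usph" by (rule sphere_homeo_in[OF M])
    have "M x \<notin> U" using n closure_subset by (auto simp: Q_def)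
    then have "M x \<in> ?C" "norm (\<phi> (M x)) < 2 * \<rho>" using Ms n \<rho> by (auto simp: Q_def)
    then have "M (M x) = M x" by (rule Mid)
    then have "M x = x" using sphere_homeo_eq_iff[OF M Ms xs] by blast
    then show False using n that by simp
  qed
  moreover have "continuous_on Q M" using M Qs continuous_on_subset by (auto simp: sphere_homeo_def)
  ultimately have "continuous_on Q (\<lambda>x. T (M x))"
    by (intro continuous_on_compose2[of Q T Q M]) auto
  then have "uniformly_continuous_on Q (\<lambda>x. T (M x))"
    by (rule compact_uniformly_continuous[OF _ \<open>compact Q\<close>])
  \<comment> \<open>The constants \<delta>2, \<delta>3 and \<eta> come from \<open>M\<close>,
    \<open>T\<close> and the cell. They have to precede \<kappa>, because \<kappa> will be chosen in
    terms of them and \<tau> has no modulus of continuity known in advance.\<close>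
  then obtain \<delta>2 where \<delta>2: "\<delta>2 > 0"
    "\<And>x y. x \<in> Q \<Longrightarrow> y \<in> Q \<Longrightarrow> dist x y < \<delta>2 \<Longrightarrow> dist (T (M x)) (T (M y)) < \<delta> / 3"
    using \<delta> unfolding uniformly_continuous_on_def by (metis divide_pos_pos zero_less_numeral)
  obtain \<delta>3' where \<delta>3': "\<delta>3' > 0"
    "\<And>s t. s \<in> cball 0 1 \<Longrightarrow> t \<in> cball 0 1 \<Longrightarrow> dist s t < \<delta>3' \<Longrightarrow> dist (\<psi> s) (\<psi> t) < \<delta>2"
    using \<psi>uc \<delta>2(1) unfolding uniformly_continuous_on_def by metis
  obtain \<eta> where \<eta>: "\<eta> > 0"
    "\<And>s t. s \<in> cball 0 1 \<Longrightarrow> t \<in> cball 0 1 \<Longrightarrow> dist s t < \<eta> \<Longrightarrow> dist (\<psi> s) (\<psi> t) < \<delta> / 3"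
    using \<psi>uc \<delta> unfolding uniformly_continuous_on_def by (metis divide_pos_pos zero_less_numeral)
  define \<delta>3 where "\<delta>3 = min \<delta>3' \<rho>"
  have \<delta>3: "\<delta>3 > 0" "\<delta>3 \<le> \<rho>" "\<delta>3 \<le> \<delta>3'" using \<rho> \<delta>3' by (auto simp: \<delta>3_def)

  have WC: "W i \<subseteq> ?C" if "i \<in> I" for i
    using W(2,3)[OF that] closure_subset[of "W i"] closure_subset[of U] by blast
  have Wbd: "\<exists>a<1. \<forall>i\<in>F. \<forall>x\<in>W i. norm (\<phi> x) \<le> a" if "finite F" "F \<subseteq> I" for F
    using that
  proof (induction F)
    case empty
    then show ?case by (auto intro!: exI[of _ 0])
  next
    case (insert i F)
    then obtain a where a: "a < 1" "\<And>j x. j \<in> F \<Longrightarrow> x \<in> W j \<Longrightarrow> norm (\<phi> x) \<le> a" by auto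
    have Ws: "closure (W i) \<subseteq> usph" using W(2)[of i] insert by (simp add: closure_minimal)
    then have "compact (closure (W i))"
      by (intro compact_closed_sphere_subset closed_closure)
    then obtain a' where a': "a' < 1" "\<And>x. x \<in> closure (W i) \<Longrightarrow> norm (\<phi> x) \<le> a'"
      using cell_compact_norm_bound[OF hom dim _ Ws] W(3)[of i] insert by blast
    have "\<forall>j\<in>insert i F. \<forall>x\<in>W j. norm (\<phi> x) \<le> max a a'"
      using a(2) a'(2) closure_subset[of "W i"] by (metis insertE max.coboundedI1 max.coboundedI2 subsetD)
    then show ?case using a a' by (intro exI[of _ "max a a'"]) auto
  qed
  define big where "big r = {i \<in> I. \<not> (\<forall>x\<in>W i. \<forall>y\<in>W i. dist (\<phi> x) (\<phi> y) < r)}" for r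
  have fin: "finite (big r)" if "r > 0" for r
    using null_family_image[OF W(1) WC \<phi>uc] that by (simp add: null_family_def big_def)
  \<comment> \<open>Among the sets that reach into radius \<open>r\<close>, the finitely many big
    ones stay below some \<open>a < 1\<close>; the others have diameter at most
    \<open>(1 - r) / 2\<close> in the cell and cannot pass \<open>(1 + r) / 2\<close>.\<close>
  have gap: "\<exists>r'. r < r' \<and> r' < 1 \<and>
      (\<forall>i\<in>I. (\<exists>x\<in>(\<lambda>x. norm (\<phi> x)) ` W i. x \<le> r) \<longrightarrow> (\<forall>x\<in>(\<lambda>x. norm (\<phi> x)) ` W i. x \<le> r'))"
    if "r < 1" for r
  proof -
    obtain a where a: "a < 1" "\<And>i x. i \<in> big ((1 - r) / 2) \<Longrightarrow> x \<in> W i \<Longrightarrow> norm (\<phi> x) \<le> a"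
      using Wbd[OF fin, of "(1 - r) / 2"] \<open>r < 1\<close> by (auto simp: big_def)
    have "norm (\<phi> y) \<le> max a ((1 + r) / 2)"
      if i: "i \<in> I" and x: "x \<in> W i" "norm (\<phi> x) \<le> r" and y: "y \<in> W i" for i x y
    proof (cases "i \<in> big ((1 - r) / 2)")
      case False
      then have "dist (\<phi> y) (\<phi> x) < (1 - r) / 2" using i x y by (auto simp: big_def)
      then have "norm (\<phi> y) < norm (\<phi> x) + (1 - r) / 2"
        using norm_triangle_ineq2[of "\<phi> y" "\<phi> x"] unfolding dist_norm by linarith
      then have "norm (\<phi> y) \<le> (1 + r) / 2" using x(2) by (simp add: field_simps)
      then show ?thesis by (rule max.coboundedI2)
    next
      case True
      show ?thesis by (rule max.coboundedI1[OF a(2)[OF True y]])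
    qed
    moreover have "r < max a ((1 + r) / 2)"
      by (rule less_le_trans[OF _ max.cobounded2]) (use \<open>r < 1\<close> in simp)
    moreover have "max a ((1 + r) / 2) < 1"
      unfolding max_less_iff_conj using a(1) \<open>r < 1\<close> by simp
    ultimately show ?thesis by (intro exI[of _ "max a ((1 + r) / 2)"]) blast
  qed
  have \<delta>310: "\<delta>3 / 10 > 0" using \<delta>3 by simp
  obtain a1 where a1: "a1 < 1" "\<And>i x. i \<in> big (\<delta>3 / 10) \<Longrightarrow> x \<in> W i \<Longrightarrow> norm (\<phi> x) \<le> a1"
    using Wbd[OF fin[OF \<delta>310]] by (auto simp: big_def)
  obtain a2 where a2: "a2 < 1" "\<And>x. x \<in> usph - V \<Longrightarrow> norm (\<phi> x) \<le> a2"
    using cell_compact_norm_bound[OF hom dim compact_sphere_diff[OF V(1)]] V(2) by blast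
  \<comment> \<open>\<tau> will send everything within radius \<open>r0\<close> to where
    \<open>M\<close> is the identity. So \<open>r0\<close> covers the big sets (\<open>a1\<close>)
    and the complement of \<open>V\<close> (\<open>a2\<close>). Points beyond it are \<eta>-close to
    the bounding sphere and have the radius 1/2 that \<open>norm_rad_diff_le\<close> asks
    for.\<close>
  define r0 where "r0 = max (max a1 a2) (max (1 - \<eta>) (1 / 2))"
  have r0: "r0 < 1" "1 / 2 \<le> r0" "a1 \<le> r0" "a2 \<le> r0" "1 - \<eta> \<le> r0"
    unfolding r0_def max_less_iff_conj le_max_iff_disj using a1(1) a2(1) \<eta>(1) by simp_all
  obtain \<kappa> l where \<kappa>: "profile l \<kappa>" "\<kappa> 1 = 1" "\<And>t. t \<le> r0 \<Longrightarrow> \<kappa> t < \<rho>"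
    "\<And>i a b. i \<in> I \<Longrightarrow> a \<in> (\<lambda>x. norm (\<phi> x)) ` W i \<Longrightarrow> b \<in> (\<lambda>x. norm (\<phi> x)) ` W i
      \<Longrightarrow> \<bar>\<kappa> a - \<kappa> b\<bar> \<le> \<bar>a - b\<bar> + \<delta>3 / 4"
  proof (rule exists_slow_profile[of I "\<lambda>i. (\<lambda>x. norm (\<phi> x)) ` W i" r0 "\<delta>3 / 4" \<rho>])
    show "0 \<le> r0" "0 < \<delta>3 / 4" using r0 \<delta>3(1) by auto
  qed (use gap r0(1) \<rho> that in blast)+
  define \<tau> where "\<tau> x = (if x \<in> U then x else \<psi> (rad \<kappa> (\<phi> x)))" for x
  have \<tau>: "sphere_homeo \<tau>" "\<And>x. x \<in> ?C \<Longrightarrow> \<tau> x \<in> ?C \<and> \<phi> (\<tau> x) = rad \<kappa> (\<phi> x)"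
    unfolding \<tau>_def using cell_radial_homeo[OF hom dim U \<kappa>(1,2)] by blast+
  have n\<tau>: "norm (\<phi> (\<tau> x)) = \<kappa> (norm (\<phi> x))" if "x \<in> ?C" for x
    using \<tau>(2)[OF that] norm_rad[OF \<kappa>(1)] by metis
  let ?\<tau>i = "inv_into usph \<tau>"
  define s where "s x = ?\<tau>i (M (\<tau> x))" for x
  have s: "sphere_homeo s"
    unfolding s_def
    by (rule sphere_homeo_compose[OF sphere_homeo_compose[OF \<tau>(1) M] sphere_homeo_inv[OF \<tau>(1)]])
  have sid: "s x = x" if x: "x \<in> ?C" "\<kappa> (norm (\<phi> x)) < 2 * \<rho>" for x
    using Mid[of "\<tau> x"] \<tau>(2)[OF x(1)] n\<tau>[OF x(1)] x sphere_homeo_inv_left[OF \<tau>(1), of x]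
    by (simp add: s_def)
  have offV: "s x = x" if "x \<in> usph - V" for x
  proof (rule sid)
    show "x \<in> ?C" using that V(2) closure_subset by blast
    have "norm (\<phi> x) \<le> r0" using a2(2)[OF that] r0 by linarith
    then show "\<kappa> (norm (\<phi> x)) < 2 * \<rho>" using \<kappa>(3) \<rho> by fastforce
  qed
  \<comment> \<open>\<tau> preserves rays, and a point of \<open>Q\<close> in the cell can only come
    from radius above \<open>r0\<close>; so its preimage is \<eta>-close, in the cell, to its radial
    projection.\<close>
  have \<tau>i: "dist (?\<tau>i z) (T z) < \<delta> / 3" if "z \<in> Q" for z
  proof (cases "z \<in> U")
    case True
    then have "\<tau> z = z" by (simp add: \<tau>_def)
    then have "?\<tau>i z = z" using sphere_homeo_inv_left[OF \<tau>(1), of z] True Us by auto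
    then show ?thesis using True \<delta> by (simp add: T_def)
  next
    case False
    have zC: "z \<in> ?C" using that False Qs by auto
    \<comment> \<open>Nothing relates \<rho> to 1, so boundary points, which belong to
      \<open>Q\<close> through \<open>closure U\<close>, require the second alternative.\<close>
    have zn: "\<rho> \<le> norm (\<phi> z) \<or> norm (\<phi> z) = 1"
      using that cell_boundary_norm[OF hom dim Us U(2) _ zC] by (auto simp: Q_def)
    define x where "x = ?\<tau>i z"
    have xs: "x \<in> usph" and \<tau>x: "\<tau> x = z"
      unfolding x_def
      using zC sphere_homeo_in[OF sphere_homeo_inv[OF \<tau>(1)]] sphere_homeo_inv_right[OF \<tau>(1)] by auto
    have xC: "x \<in> ?C" using xs \<tau>x False by (auto simp: \<tau>_def split: if_splits)
    have n1: "norm (\<phi> x) \<le> 1" using \<phi>(1)[OF xC] by simp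
    have "\<not> norm (\<phi> x) \<le> r0"
    proof
      assume *: "norm (\<phi> x) \<le> r0"
      then have "norm (\<phi> z) < \<rho>" using \<kappa>(3) n\<tau>[OF xC] \<tau>x by simp
      then have "\<kappa> (norm (\<phi> x)) = \<kappa> 1" using zn n\<tau>[OF xC] \<tau>x \<kappa>(2) by simp
      then have "norm (\<phi> x) = 1" using profile_eq_iff[OF \<kappa>(1)] by simp
      then show False using * r0 by simp
    qed
    then have "1 - norm (\<phi> x) < \<eta>" and x0: "norm (\<phi> x) > 0" using r0 by linarith+
    moreover have "\<phi> x - sgn (\<phi> x) = (norm (\<phi> x) - 1) *\<^sub>R sgn (\<phi> x)"
      by (simp add: scaleR_diff_left norm_scaleR_sgn)
    then have "norm (\<phi> x - sgn (\<phi> x)) = 1 - norm (\<phi> x)" using n1 x0 by (simp add: norm_sgn)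
    ultimately have "dist (\<phi> x) (sgn (\<phi> x)) < \<eta>" by (simp add: dist_norm)
    then have "dist (\<psi> (\<phi> x)) (\<psi> (sgn (\<phi> x))) < \<delta> / 3" by (intro \<eta>(2) \<phi>(1) xC sgncb)
    moreover have "T z = \<psi> (sgn (\<phi> x))"
      using False \<tau>(2)[OF xC] \<tau>x sgn_rad[OF \<kappa>(1), of "\<phi> x"] by (simp add: T_def)
    ultimately show ?thesis using \<phi>(2)[OF xC] by (simp add: x_def)
  qed
  have sU: "s x = M x" if "x \<in> U" for x
  proof -
    have "M x \<in> U" using MU(1) that b(3) closure_subset by blast
    then have "?\<tau>i (M x) = M x"
      using sphere_homeo_inv_left[OF \<tau>(1), of "M x"] Us by (auto simp: \<tau>_def)
    then show ?thesis using that by (simp add: s_def \<tau>_def)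
  qed
  have "s ` U \<subseteq> b" using sU MU(1) closure_subset by fastforce
  moreover have "aconf U s"
  proof (rule aconf_cong[OF aconf_shom[OF qs c0 m(1)]])
    show "U \<subseteq> usph - {q}" using Us qC by blast
    show "s x = shom q c0 m x" if "x \<in> U" for x
      using sU[OF that] MU(2) that closure_subset by auto
  qed
  moreover have "(\<forall>x\<in>W i. s x = x) \<or> (\<forall>x\<in>W i. \<forall>y\<in>W i. dist (s x) (s y) < \<delta>)" if i: "i \<in> I" for i
  proof (cases "\<forall>x\<in>W i. s x = x")
    case False
    then obtain x0 where x0: "x0 \<in> W i" "s x0 \<noteq> x0" by blast
    have inC: "x \<in> ?C" if "x \<in> W i" for x using WC[OF i] that by blast
    have \<kappa>x0: "2 * \<rho> \<le> \<kappa> (norm (\<phi> x0))" using sid[OF inC[OF x0(1)]] x0(2) by linarith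
    have nr: "r0 < norm (\<phi> x)" if "\<rho> \<le> \<kappa> (norm (\<phi> x))" for x using \<kappa>(3) that by (meson not_le)
    have "i \<notin> big (\<delta>3 / 10)"
      using a1(2)[OF _ x0(1)] nr[of x0] \<kappa>x0 \<rho> r0 by force
    then have small: "dist (\<phi> x) (\<phi> y) < \<delta>3 / 10" if "x \<in> W i" "y \<in> W i" for x y
      using that i by (auto simp: big_def)
    \<comment> \<open>The total stays below
      \<open>\<delta>3 / 10 + \<delta>3 / 4 + 4 * \<delta>3 / 10\<close>: the radial growth allowed
      by \<kappa> and the angular part.\<close>
    have close: "dist (\<phi> (\<tau> x)) (\<phi> (\<tau> y)) < \<delta>3"
      if x: "x \<in> W i" "\<rho> \<le> \<kappa> (norm (\<phi> x))" and y: "y \<in> W i" for x y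
    proof -
      have "\<tau> y \<in> ?C" using \<tau>(2)[OF inC[OF y]] by blast
      from \<phi>(1)[OF this] have "norm (\<phi> (\<tau> y)) \<le> 1" by simp
      then have "\<kappa> (norm (\<phi> y)) \<le> 1" using n\<tau>[OF inC[OF y]] by simp
      moreover have "1 / 2 \<le> norm (\<phi> x)" using nr[OF x(2)] r0 by linarith
      ultimately have "dist (\<phi> (\<tau> x)) (\<phi> (\<tau> y)) \<le>
          \<bar>\<kappa> (norm (\<phi> x)) - \<kappa> (norm (\<phi> y))\<bar> + 4 * norm (\<phi> x - \<phi> y)"
        using norm_rad_diff_le[OF \<kappa>(1)] \<tau>(2)[OF inC[OF x(1)]] \<tau>(2)[OF inC[OF y]] by (simp add: dist_norm)
      moreover have "\<bar>\<kappa> (norm (\<phi> x)) - \<kappa> (norm (\<phi> y))\<bar> \<le> \<bar>norm (\<phi> x) - norm (\<phi> y)\<bar> + \<delta>3 / 4"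
        using \<kappa>(4)[OF i] x(1) y by blast
      moreover have "\<bar>norm (\<phi> x) - norm (\<phi> y)\<bar> \<le> norm (\<phi> x - \<phi> y)" by (rule norm_triangle_ineq3)
      moreover have "norm (\<phi> x - \<phi> y) < \<delta>3 / 10" using small[OF x(1) y] by (simp add: dist_norm)
      ultimately show ?thesis using \<delta>3(1) by linarith
    qed
    \<comment> \<open>After \<tau> the moved point \<open>x0\<close> has radius at least
      \<open>2 * \<rho>\<close>, and the other points of \<open>W i\<close> are within \<delta>3
      \<le> \<rho> of it. So \<tau> takes all of \<open>W i\<close> into \<open>Q\<close>, where
      \<open>T\<close> controls the inverse of \<tau>.\<close>
    have big\<kappa>: "\<rho> \<le> \<kappa> (norm (\<phi> y))" if "y \<in> W i" for y
    proof -
      have "norm (\<phi> (\<tau> x0)) \<le> norm (\<phi> (\<tau> y)) + dist (\<phi> (\<tau> x0)) (\<phi> (\<tau> y))"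
        using norm_triangle_ineq2[of "\<phi> (\<tau> x0)" "\<phi> (\<tau> y)"] by (simp add: dist_norm)
      moreover have "\<rho> \<le> \<kappa> (norm (\<phi> x0))" using \<kappa>x0 \<rho> by linarith
      then have "dist (\<phi> (\<tau> x0)) (\<phi> (\<tau> y)) < \<delta>3" by (intro close x0(1) that)
      ultimately show ?thesis
        using \<kappa>x0 \<delta>3(2) n\<tau>[OF inC[OF x0(1)]] n\<tau>[OF inC[OF that]] by linarith
    qed
    have \<tau>Q: "\<tau> y \<in> Q" if "y \<in> W i" for y
      using \<tau>(2)[OF inC[OF that]] n\<tau>[OF inC[OF that]] big\<kappa>[OF that] by (simp add: Q_def)
    have "\<forall>x\<in>W i. \<forall>y\<in>W i. dist (s x) (s y) < \<delta>"
    proof (intro ballI)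
      fix x y assume x: "x \<in> W i" and y: "y \<in> W i"
      have \<tau>C: "\<tau> x \<in> ?C" "\<tau> y \<in> ?C" using \<tau>(2) inC x y by blast+
      have "dist (\<phi> (\<tau> x)) (\<phi> (\<tau> y)) < \<delta>3'"
        using close[OF x big\<kappa>[OF x] y] \<delta>3(3) by linarith
      then have "dist (\<psi> (\<phi> (\<tau> x))) (\<psi> (\<phi> (\<tau> y))) < \<delta>2"
        by (intro \<delta>3'(2) \<phi>(1) \<tau>C)
      then have "dist (\<tau> x) (\<tau> y) < \<delta>2" unfolding \<phi>(2)[OF \<tau>C(1)] \<phi>(2)[OF \<tau>C(2)] .
      then have "dist (T (M (\<tau> x))) (T (M (\<tau> y))) < \<delta> / 3"
        by (intro \<delta>2(2) \<tau>Q x y)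
      moreover have "dist (s x) (T (M (\<tau> x))) < \<delta> / 3" "dist (s y) (T (M (\<tau> y))) < \<delta> / 3"
        unfolding s_def by (intro \<tau>i MQ \<tau>Q x y)+
      ultimately show "dist (s x) (s y) < \<delta>"
        using dist_triangle[of "s x" "s y" "T (M (\<tau> x))"] dist_triangle[of "T (M (\<tau> x))" "s y" "T (M (\<tau> y))"]
        by (simp add: dist_commute)
    qed
    then show ?thesis ..
  qed blast
  ultimately show ?thesis using that s offV by blast
qed

section \<open>The inductive construction\<close>

lemma sets_sphere_measureI: "A \<in> sets borel \<Longrightarrow> A \<subseteq> usph \<Longrightarrow> A \<in> sets sphere_measure"
  by (auto simp: sphere_measure_def sets_restrict_space_iff)

lemma openin_sphere_borel: "openin (top_of_set usph) A \<Longrightarrow> A \<in> sets borel"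
  by (auto simp: openin_open)

lemma emeasure_sphere_measure_finite: "emeasure sphere_measure (usph :: 'a::euclidean_space set) < \<infinity>"
proof -
  let ?A = "{t *\<^sub>R x | t x. 0 < t \<and> t \<le> 1 \<and> x \<in> (usph :: 'a set)}"
  have "emeasure lborel ?A \<le> emeasure lborel (cball 0 1 :: 'a set)"
    by (rule emeasure_mono) auto
  also have "\<dots> < \<infinity>" by (rule emeasure_lborel_cball_finite)
  finally have "of_nat DIM('a) * emeasure lborel ?A < \<infinity>"
    by (simp add: ennreal_mult_less_top of_nat_less_top)
  then show ?thesis by (simp add: emeasure_sphere_measure)
qed

lemma emeasure_sphere_measure_pos: "emeasure sphere_measure (usph :: 'a::euclidean_space set) > 0"
proof -
  let ?A = "{t *\<^sub>R x | t x. 0 < t \<and> t \<le> 1 \<and> x \<in> (usph :: 'a set)}"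
  have "?A = cball 0 1 - {0}"
  proof
    show "?A \<subseteq> cball 0 1 - {0}" by auto
    show "cball 0 1 - {0} \<subseteq> ?A"
    proof
      fix y :: 'a assume "y \<in> cball 0 1 - {0}"
      then have "y = norm y *\<^sub>R sgn y \<and> 0 < norm y \<and> norm y \<le> 1 \<and> sgn y \<in> usph"
        by (auto simp: norm_scaleR_sgn norm_sgn)
      then show "y \<in> ?A" by blast
    qed
  qed
  moreover have "emeasure lborel (cball 0 1 - {0} :: 'a set) \<noteq> 0"
  proof
    assume 0: "emeasure lborel (cball 0 1 - {0} :: 'a set) = 0"
    have "ball ((1/2) *\<^sub>R b) (1/2) \<subseteq> cball 0 1 - {0}" if "b \<in> Basis" for b :: 'a
    proof
      fix x assume "x \<in> ball ((1/2) *\<^sub>R b) (1/2)"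
      then have *: "norm ((1/2) *\<^sub>R b - x) < 1/2" by (simp add: dist_norm)
      have b: "norm ((1/2) *\<^sub>R b) = 1/2" using that by simp
      then have "norm x < 1" using norm_triangle_ineq2[of x "(1/2) *\<^sub>R b"] *
        by (simp add: norm_minus_commute)
      moreover have "x \<noteq> 0" using * b by auto
      ultimately show "x \<in> cball 0 1 - {0}" by simp
    qed
    then obtain b :: 'a where b: "ball ((1/2) *\<^sub>R b) (1/2) \<subseteq> cball 0 1 - {0}"
      using nonempty_Basis by blast
    have "emeasure lborel (ball ((1/2) *\<^sub>R b) (1/2)) \<le> 0"
      using emeasure_mono[OF b, of lborel] 0 by simp
    then have "emeasure lborel (ball ((1/2) *\<^sub>R b) (1/2)) = 0" by simp
    then show False
      using open_not_negligible[of "ball ((1/2) *\<^sub>R b) (1/2)"]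
      by (simp add: negligible_iff_null_sets null_sets_def)
  qed
  ultimately show ?thesis
    by (simp add: emeasure_sphere_measure zero_less_iff_neq_zero)
qed

text \<open>Continuity of the measure from above along caps shrinking to \<open>p\<close>. The cone
  over a single point is a segment, which is negligible in dimension at least 2.\<close>

lemma small_cap:
  fixes p :: "'a::euclidean_space"
  assumes dim: "DIM('a) \<ge> 2" and p: "p \<in> usph" and \<eta>: "\<eta> > 0"
  obtains e where "e > 0" "emeasure sphere_measure (usph \<inter> cball p e) < \<eta>"
proof -
  define A where "A n = usph \<inter> cball p (1 / real (Suc n))" for n
  have As: "A n \<in> sets sphere_measure" for n
    unfolding A_def by (intro sets_sphere_measureI) auto
  have "(\<lambda>n. emeasure sphere_measure (A n)) \<longlonglongrightarrow> emeasure sphere_measure (\<Inter>n. A n)"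
  proof (rule Lim_emeasure_decseq)
    show "range A \<subseteq> sets sphere_measure" using As by blast
    have "1 / real (Suc n) \<le> 1 / real (Suc m)" if "m \<le> n" for m n
      using that by (intro divide_left_mono) auto
    then show "decseq A" unfolding A_def decseq_def by (fastforce simp del: of_nat_Suc)
    show "emeasure sphere_measure (A n) \<noteq> \<infinity>" for n
    proof -
      have "emeasure sphere_measure (A n) \<le> emeasure sphere_measure (usph :: 'a set)"
        by (rule emeasure_mono) (auto simp: A_def intro: sets_sphere_measureI)
      then show ?thesis using emeasure_sphere_measure_finite by (metis infinity_ennreal_def less_top neq_top_trans order.strict_trans1)
    qed
  qed
  moreover have "(\<Inter>n. A n) = {p}"
  proof
    show "{p} \<subseteq> (\<Inter>n. A n)" using p by (auto simp: A_def)
    show "(\<Inter>n. A n) \<subseteq> {p}"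
    proof
      fix x assume x: "x \<in> (\<Inter>n. A n)"
      have "dist p x \<le> 1 / real (Suc n)" for n
        using x by (simp add: A_def)
      then have "\<not> 0 < dist p x" by (metis nat_approx_posE not_le)
      then show "x \<in> {p}" by simp
    qed
  qed
  moreover have "emeasure sphere_measure {p} = 0"
  proof -
    let ?R = "{t *\<^sub>R x | t x. 0 < t \<and> t \<le> 1 \<and> x \<in> {p}}"
    have "dim ?R \<le> dim {p}"
      by (rule dim_mono) (auto intro: span_mul span_base)
    also have "\<dots> < DIM('a)" using dim dim_le_card'[of "{p}"] by simp
    finally have "negligible ?R" by (rule negligible_lowdim)
    \<comment> \<open>On a non-measurable set \<open>emeasure\<close> is 0 by convention, so both
      cases give 0.\<close>
    then have "emeasure lborel ?R = 0"
      by (cases "?R \<in> sets lborel")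
         (auto simp: negligible_iff_null_sets null_sets_completion_iff emeasure_notin_sets)
    then show ?thesis using p emeasure_sphere_measure[of "{p}"] by simp
  qed
  ultimately have "(\<lambda>n. emeasure sphere_measure (A n)) \<longlonglongrightarrow> 0" by simp
  then have "eventually (\<lambda>n. emeasure sphere_measure (A n) < \<eta>) sequentially"
    using \<eta> by (rule order_tendstoD)
  then obtain n where "emeasure sphere_measure (A n) < \<eta>"
    by (auto simp: eventually_sequentially)
  then show ?thesis using that[of "1 / real (Suc n)"] by (simp add: A_def)
qed

lemma sphere_homeo_uniform:
  assumes "sphere_homeo f" "e > 0"
  obtains d where "d > 0" "\<And>x y. x \<in> usph \<Longrightarrow> y \<in> usph \<Longrightarrow> dist x y < d \<Longrightarrow> dist (f x) (f y) < e"
proof -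
  have "uniformly_continuous_on usph f"
    using assms(1) by (intro compact_uniformly_continuous compact_sphere) (simp add: sphere_homeo_def)
  then show ?thesis using assms(2) that unfolding uniformly_continuous_on_def by metis
qed

section \<open>Making finitely many components conformal\<close>

locale sphere_cells =
  fixes U :: "nat \<Rightarrow> 'a::euclidean_space set"
    and \<phi> :: "nat \<Rightarrow> 'a \<Rightarrow> 'b::euclidean_space" and \<psi> :: "nat \<Rightarrow> 'b \<Rightarrow> 'a"
  assumes dim: "DIM('a) = Suc DIM('b)"
    and U_openin: "\<And>i. openin (top_of_set usph) (U i)"
    and U_nonempty: "\<And>i. U i \<noteq> {}"
    and hom: "\<And>i. homeomorphism (usph - U i) (cball 0 1) (\<phi> i) (\<psi> i)"
    and closure_disjoint: "\<And>i j. i \<noteq> j \<Longrightarrow> closure (U i) \<inter> closure (U j) = {}"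
    and null: "null_family UNIV U"
begin

lemma dim2: "DIM('a) \<ge> 2"
  using dim DIM_positive[where 'a='b] by simp

lemma U_sphere: "U i \<subseteq> usph"
  using U_openin openin_imp_subset by blast

lemma U_disjoint: "i \<noteq> j \<Longrightarrow> U i \<inter> U j = {}"
  using closure_disjoint[of i j] closure_subset[of "U i"] closure_subset[of "U j"] by blast

text \<open>The invariant under which \<open>conformal_germ_transplant\<close> can be applied again.
  The identity has it, and so has any map conformal on one of the components.\<close>

definition germ :: "('a \<Rightarrow> 'a) \<Rightarrow> bool"
  where "germ f \<longleftrightarrow> (\<exists>W. openin (top_of_set usph) W \<and> W \<noteq> {} \<and> aconf W f)"

lemma germ_cell: "aconf (U i) f \<Longrightarrow> germ f"
  unfolding germ_def using U_openin U_nonempty by blast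

text \<open>\<open>g\<close> is the shrinking map \<open>s\<close> followed by the transplant
  \<open>f'\<close>. As \<open>f'\<close> equals \<open>f\<close> off \<open>U j\<close>, a
  component fixed by \<open>s\<close> keeps the values of \<open>f\<close>; any other is made so
  small by \<open>s\<close> that uniform continuity of \<open>f'\<close> keeps its image
  small.\<close>

lemma make_conformal:
  assumes f: "sphere_homeo f" "germ f"
    and V: "openin (top_of_set usph) V" "closure (U j) \<subseteq> V" and \<delta>: "\<delta> > 0" and \<eta>: "\<eta> > 0"
  obtains g where "sphere_homeo g" "\<And>x. x \<in> usph - V \<Longrightarrow> g x = f x" "aconf (U j) g"
    "emeasure sphere_measure (g ` U j) \<le> \<eta>"
    "\<And>i. i \<noteq> j \<Longrightarrow> (\<forall>x\<in>U i. g x = f x) \<or> (\<forall>x\<in>U i. \<forall>y\<in>U i. dist (g x) (g y) < \<delta>)"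
proof -
  obtain W where W: "openin (top_of_set usph) W" "W \<noteq> {}" "aconf W f"
    using f(2) by (auto simp: germ_def)
  have "\<psi> j 0 \<in> usph - U j" using hom[of j] by (auto simp: homeomorphism_def)
  from conformal_germ_transplant[OF dim2 f(1) W U_openin U_nonempty this]
  obtain f' b where f': "sphere_homeo f'" "\<And>x. x \<in> usph - U j \<Longrightarrow> f' x = f x"
    and b: "openin (top_of_set usph) b" "b \<noteq> {}" "b \<subseteq> U j" "aconf b f'"
    by metis
  obtain c where c: "c \<in> b" using b by blast
  then have "f' c \<in> usph" using b U_sphere sphere_homeo_in[OF f'(1)] by blast
  then obtain e where e: "e > 0" "emeasure sphere_measure (usph \<inter> cball (f' c) e) < \<eta>"
    using small_cap[OF dim2 _ \<eta>] by metis
  \<comment> \<open>Only points with images in a small cap are kept as a target, which bounds the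
    measure of the image of \<open>U j\<close>.\<close>
  define b' where "b' = b \<inter> {x \<in> usph. f' x \<in> usph \<inter> ball (f' c) e}"
  have b': "openin (top_of_set usph) b'" "b' \<noteq> {}" "b' \<subseteq> U j"
  proof -
    show "openin (top_of_set usph) b'"
      unfolding b'_def by (intro openin_Int b(1) sphere_homeo_vimage_openin[OF f'(1)] openin_open_Int open_ball)
    have "c \<in> usph" using c b U_sphere by blast
    then have "c \<in> b'" using c e(1) \<open>f' c \<in> usph\<close> by (simp add: b'_def)
    then show "b' \<noteq> {}" by blast
    show "b' \<subseteq> U j" using b by (auto simp: b'_def)
  qed
  obtain d where d: "d > 0" "\<And>x y. x \<in> usph \<Longrightarrow> y \<in> usph \<Longrightarrow> dist x y < d \<Longrightarrow> dist (f' x) (f' y) < \<delta>"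
    using sphere_homeo_uniform[OF f'(1) \<delta>] by metis
  have "null_family (UNIV - {j}) U"
    using null unfolding null_family_def by (metis (no_types, lifting) DiffD1 finite_subset mem_Collect_eq subsetI)
  note nf = this
  have cl: "closure (U i) \<inter> closure (U j) = {}" if "i \<in> UNIV - {j}" for i
    using closure_disjoint that by auto
  obtain s where s: "sphere_homeo s" "\<And>x. x \<in> usph - V \<Longrightarrow> s x = x" "s ` U j \<subseteq> b'" "aconf (U j) s"
    "\<And>i. i \<in> UNIV - {j} \<Longrightarrow> (\<forall>x\<in>U i. s x = x) \<or> (\<forall>x\<in>U i. \<forall>y\<in>U i. dist (s x) (s y) < d)"
    by (rule shrink_into[OF hom dim U_openin U_nonempty b' V nf U_sphere cl d(1)]) (assumption, rule that)
  let ?g = "\<lambda>x. f' (s x)"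
  show ?thesis
  proof (rule that)
    show "sphere_homeo ?g" by (rule sphere_homeo_compose[OF s(1) f'(1)])
    show "?g x = f x" if "x \<in> usph - V" for x
      using s(2)[OF that] f'(2)[of x] that V(2) closure_subset[of "U j"] by auto
    show "aconf (U j) ?g"
      by (rule aconf_compose[OF s(4) b(4)]) (use s(3) in \<open>auto simp: b'_def\<close>)
    have "?g ` U j \<subseteq> usph \<inter> cball (f' c) e" using s(3) by (auto simp: b'_def)
    then have "emeasure sphere_measure (?g ` U j) \<le> emeasure sphere_measure (usph \<inter> cball (f' c) e)"
      by (rule emeasure_mono) (auto intro: sets_sphere_measureI)
    then show "emeasure sphere_measure (?g ` U j) \<le> \<eta>" using e(2) by simp
    show "(\<forall>x\<in>U i. ?g x = f x) \<or> (\<forall>x\<in>U i. \<forall>y\<in>U i. dist (?g x) (?g y) < \<delta>)" if "i \<noteq> j" for i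
    proof (cases "\<forall>x\<in>U i. s x = x")
      case *: True
      have "?g x = f x" if "x \<in> U i" for x
      proof -
        have "x \<in> usph - U j" using that U_disjoint[OF \<open>i \<noteq> j\<close>] U_sphere[of i] by blast
        then show ?thesis using * that f'(2) by simp
      qed
      then show ?thesis by blast
    next
      case False
      then have *: "\<forall>x\<in>U i. \<forall>y\<in>U i. dist (s x) (s y) < d" using s(5)[of i] that by blast
      have "dist (?g x) (?g y) < \<delta>" if "x \<in> U i" "y \<in> U i" for x y
        using * that U_sphere[of i] by (intro d(2) sphere_homeo_in[OF s(1)]) auto
      then show ?thesis by blast
    qed
  qed
qed

lemma make_conformal_finite:
  assumes "finite J" and f: "sphere_homeo f" "germ f"
    and V: "\<And>j. j \<in> J \<Longrightarrow> openin (top_of_set usph) (V j)" "\<And>j. j \<in> J \<Longrightarrow> closure (U j) \<subseteq> V j"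
      "\<And>i j. i \<in> J \<Longrightarrow> j \<in> J \<Longrightarrow> i \<noteq> j \<Longrightarrow> V i \<inter> V j = {}"
    and \<delta>: "\<delta> > 0" and \<eta>: "\<And>j. \<eta> j > 0"
  shows "\<exists>g. sphere_homeo g \<and> germ g \<and> (\<forall>x\<in>usph - (\<Union>j\<in>J. V j). g x = f x) \<and>
    (\<forall>j\<in>J. \<forall>x\<in>V j. g x \<in> f ` V j) \<and>
    (\<forall>j\<in>J. aconf (U j) g \<and> emeasure sphere_measure (g ` U j) \<le> \<eta> j) \<and>
    (\<forall>i. i \<notin> J \<longrightarrow> (\<forall>x\<in>U i. g x = f x) \<or> (\<forall>x\<in>U i. \<forall>y\<in>U i. dist (g x) (g y) < \<delta>))"
  using assms(1) V
proof (induction J)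
  case empty
  then show ?case using f by (intro exI[of _ f]) simp
next
  case (insert j J)
  have "\<exists>g. sphere_homeo g \<and> germ g \<and> (\<forall>x\<in>usph - (\<Union>j\<in>J. V j). g x = f x) \<and>
    (\<forall>j\<in>J. \<forall>x\<in>V j. g x \<in> f ` V j) \<and>
    (\<forall>j\<in>J. aconf (U j) g \<and> emeasure sphere_measure (g ` U j) \<le> \<eta> j) \<and>
    (\<forall>i. i \<notin> J \<longrightarrow> (\<forall>x\<in>U i. g x = f x) \<or> (\<forall>x\<in>U i. \<forall>y\<in>U i. dist (g x) (g y) < \<delta>))"
    by (rule insert.IH) (use insert.prems in auto)
  then obtain g where g: "sphere_homeo g" "germ g" "\<forall>x\<in>usph - (\<Union>j\<in>J. V j). g x = f x"
    "\<forall>k\<in>J. \<forall>x\<in>V k. g x \<in> f ` V k"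
    "\<forall>k\<in>J. aconf (U k) g \<and> emeasure sphere_measure (g ` U k) \<le> \<eta> k"
    "\<forall>i. i \<notin> J \<longrightarrow> (\<forall>x\<in>U i. g x = f x) \<or> (\<forall>x\<in>U i. \<forall>y\<in>U i. dist (g x) (g y) < \<delta>)"
    by blast
  have Vj: "openin (top_of_set usph) (V j)" "closure (U j) \<subseteq> V j" using insert.prems by auto
  obtain h where h: "sphere_homeo h" "\<And>x. x \<in> usph - V j \<Longrightarrow> h x = g x" "aconf (U j) h"
    "emeasure sphere_measure (h ` U j) \<le> \<eta> j"
    "\<And>i. i \<noteq> j \<Longrightarrow> (\<forall>x\<in>U i. h x = g x) \<or> (\<forall>x\<in>U i. \<forall>y\<in>U i. dist (h x) (h y) < \<delta>)"
    by (rule make_conformal[OF g(1,2) Vj \<delta> \<eta>[of j]]) (rule that)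
  have Vs: "V k \<subseteq> usph" if "k \<in> insert j J" for k using insert.prems(1)[OF that] openin_imp_subset by blast
  have dis: "V k \<inter> V j = {}" if "k \<in> J" for k using insert.prems(3)[of k j] insert.hyps that by auto
  have hg: "h x = g x" if "k \<in> J" "x \<in> V k" for k x
  proof (rule h(2))
    show "x \<in> usph - V j" using dis[OF that(1)] Vs[of k] that by blast
  qed
  have UV: "U k \<subseteq> V k" if "k \<in> insert j J" for k
    using insert.prems(2)[OF that] closure_subset[of "U k"] by blast
  show ?case
  proof (intro exI[of _ h] conjI ballI allI impI h(1) germ_cell[OF h(3)])
    fix x assume "x \<in> usph - (\<Union>k\<in>insert j J. V k)"
    then show "h x = f x" using h(2)[of x] g(3) by auto
  next
    fix k x assume k: "k \<in> insert j J" and x: "x \<in> V k"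
    show "h x \<in> f ` V k"
    proof (cases "k \<in> J")
      case True
      then show ?thesis using hg x g(4) by metis
    next
      case False
      then have x: "x \<in> V j" and kj: "k = j" using k x by auto
      then have xs: "x \<in> usph" using Vs by blast
      then have "h x \<in> g ` usph" using sphere_homeo_in[OF h(1)] g(1) by (simp add: sphere_homeo_def bij_betw_def)
      then obtain y where y: "y \<in> usph" "h x = g y" by blast
      \<comment> \<open>\<open>h\<close> is injective and agrees with \<open>g\<close> off
        \<open>V j\<close>, so it takes \<open>V j\<close> into the image of \<open>V j\<close>
        under \<open>g\<close>; there \<open>g\<close> is still \<open>f\<close>.\<close>
      have "y \<in> V j"
      proof (rule ccontr)
        assume "y \<notin> V j"
        then have "h y = h x" using h(2)[of y] y by simp
        then have "y = x" using sphere_homeo_eq_iff[OF h(1) y(1) xs] by simp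
        then show False using \<open>y \<notin> V j\<close> x by simp
      qed
      moreover have "y \<notin> (\<Union>k\<in>J. V k)" using dis \<open>y \<in> V j\<close> by blast
      ultimately show ?thesis using g(3) y kj by auto
    qed
  next
    fix k assume k: "k \<in> insert j J"
    show "aconf (U k) h" "emeasure sphere_measure (h ` U k) \<le> \<eta> k"
    proof -
      have eq: "h x = g x" if "k \<in> J" "x \<in> U k" for x using hg that UV[OF k] by blast
      then have "h ` U k = g ` U k" if "k \<in> J" using that by (intro image_cong) auto
      then show "aconf (U k) h" "emeasure sphere_measure (h ` U k) \<le> \<eta> k"
        using k h(3,4) bspec[OF g(5), of k] aconf_cong[of "U k" g h] eq by auto
    qed
  next
    fix i assume i: "i \<notin> insert j J"
    then show "(\<forall>x\<in>U i. h x = f x) \<or> (\<forall>x\<in>U i. \<forall>y\<in>U i. dist (h x) (h y) < \<delta>)"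
      using h(5)[of i] spec[OF g(6), of i] by auto
  qed
qed

text \<open>Disjoint compact sets have positive distance; the form with \<open>at_right 0\<close>
  lets finitely many bounds on the radius be combined.\<close>

lemma separated_nhds:
  assumes "finite F" "i \<in> F"
  shows "\<forall>\<^sub>F r in at_right 0. \<forall>k\<in>F. k \<noteq> i \<longrightarrow> (\<forall>x\<in>U i. \<forall>y\<in>U k. 2 * r < dist x y)"
proof -
  have "\<forall>\<^sub>F r in at_right 0. k \<noteq> i \<longrightarrow> (\<forall>x\<in>U i. \<forall>y\<in>U k. 2 * r < dist x y)" for k
  proof (cases "k = i")
    case False
    have "compact (closure (U i))"
      using U_sphere by (intro compact_closed_sphere_subset) (auto simp: closure_minimal)
    then obtain d where d: "d > 0" "\<forall>x\<in>closure (U i). \<forall>y\<in>closure (U k). d \<le> dist x y"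
      using separate_compact_closed[OF _ closed_closure closure_disjoint[OF False[symmetric]]] by blast
    have "\<forall>\<^sub>F r in at_right 0. r < d / 2"
      using d(1) by (intro eventually_at_right_less[THEN eventually_mono] eventually_at_rightI[of 0 "d / 2"]) auto
    then show ?thesis
    proof eventually_elim
      case (elim r)
      show ?case
      proof (intro impI ballI)
        fix x y assume "x \<in> U i" "y \<in> U k"
        then have "d \<le> dist x y" using d(2) closure_subset by blast
        then show "2 * r < dist x y" using elim by linarith
      qed
    qed
  qed simp
  then show ?thesis using assms(1) by (simp add: eventually_ball_finite)
qed

text \<open>\<open>P\<close> lists the components treated so far; the others are smaller than
  \<open>d\<close> both in the domain and in the image. A new support is a thin neighbourhood of one
  of these and inherits both bounds up to a factor. In the last clause, the bound on
  \<open>dist x x'\<close> will serve the inverses and the bound on \<open>dist (f x) (f x')\<close>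
  the maps.\<close>

lemma refine:
  assumes f: "sphere_homeo f" "germ f" and P: "finite P"
    and small: "\<And>i x y. i \<notin> P \<Longrightarrow> x \<in> U i \<Longrightarrow> y \<in> U i \<Longrightarrow> dist x y < d \<and> dist (f x) (f y) < d"
    and pos: "d > 0" "e > 0" "\<And>j. \<eta> j > 0"
  shows "\<exists>g P'. sphere_homeo g \<and> germ g \<and> finite P' \<and> P \<subseteq> P' \<and> m \<in> P' \<and>
    (\<forall>i\<in>P. \<forall>x\<in>U i. g x = f x) \<and>
    (\<forall>i\<in>P' - P. aconf (U i) g \<and> emeasure sphere_measure (g ` U i) \<le> \<eta> i) \<and>
    (\<forall>i. i \<notin> P' \<longrightarrow> (\<forall>x\<in>U i. \<forall>y\<in>U i. dist x y < e \<and> dist (g x) (g y) < e)) \<and>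
    (\<forall>x\<in>usph. \<exists>x'\<in>usph. g x = f x' \<and> dist x x' \<le> 2 * d \<and> dist (f x) (f x') \<le> 2 * d)"
proof -
  have fu: "uniformly_continuous_on usph f"
    using f(1) by (intro compact_uniformly_continuous compact_sphere) (simp add: sphere_homeo_def)
  have nf: "null_family UNIV (\<lambda>i. f ` U i)"
    by (rule null_family_image[OF null U_sphere fu])
  \<comment> \<open>\<open>m\<close> is put in so that every component gets its turn. The components
    that are big in the domain or in the image are put in so that the next round can start with
    \<open>e\<close> for \<open>d\<close>; they are finitely many.\<close>
  define P' where "P' = insert m P \<union> {i. \<not> (\<forall>x\<in>U i. \<forall>y\<in>U i. dist x y < e)} \<union>
    {i. \<not> (\<forall>x\<in>f ` U i. \<forall>y\<in>f ` U i. dist x y < e)}"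
  have finP': "finite P'"
    using null nf pos(2) P by (simp add: P'_def null_family_def)
  define J where "J = P' - P"
  \<comment> \<open>A neighbourhood of radius below \<open>a\<close> adds at most
    \<open>d / 2\<close> at either end in the image, as a radius below \<open>d / 2\<close> does in
    the domain; hence the bounds \<open>2 * d\<close>.\<close>
  obtain a where a: "a > 0" "\<And>x y. x \<in> usph \<Longrightarrow> y \<in> usph \<Longrightarrow> dist x y < a \<Longrightarrow> dist (f x) (f y) < d / 2"
    using sphere_homeo_uniform[OF f(1), of "d / 2"] pos(1) by auto
  have "\<forall>\<^sub>F r in at_right 0. \<forall>i\<in>P'. \<forall>k\<in>P'. k \<noteq> i \<longrightarrow> (\<forall>x\<in>U i. \<forall>y\<in>U k. 2 * r < dist x y)"
    using separated_nhds[OF finP'] finP' by (simp add: eventually_ball_finite)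
  moreover have "\<forall>\<^sub>F r in at_right 0. r < min a (d / 2)"
    using a(1) pos(1) by (intro eventually_at_rightI[of 0 "min a (d / 2)"]) auto
  moreover have "\<forall>\<^sub>F r in at_right 0. (0::real) < r"
    by (rule eventually_at_right_less)
  ultimately have "\<forall>\<^sub>F r in at_right 0. (\<forall>i\<in>P'. \<forall>k\<in>P'. k \<noteq> i \<longrightarrow> (\<forall>x\<in>U i. \<forall>y\<in>U k. 2 * r < dist x y)) \<and>
      r < min a (d / 2) \<and> 0 < r"
    by eventually_elim simp
  then have "\<exists>r. (\<forall>i\<in>P'. \<forall>k\<in>P'. k \<noteq> i \<longrightarrow> (\<forall>x\<in>U i. \<forall>y\<in>U k. 2 * r < dist x y)) \<and>
      r < min a (d / 2) \<and> 0 < r"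
    by (rule eventually_happens'[OF trivial_limit_at_right_real])
  then obtain r where r0: "\<forall>i\<in>P'. \<forall>k\<in>P'. k \<noteq> i \<longrightarrow> (\<forall>x\<in>U i. \<forall>y\<in>U k. 2 * r < dist x y)"
    and r: "r < a" "r < d / 2" "0 < r"
    by (elim exE conjE) simp
  have sep: "2 * r < dist x y" if "i \<in> P'" "k \<in> P'" "k \<noteq> i" "x \<in> U i" "y \<in> U k" for i k x y
    using r0 that by blast
  define V where "V j = usph \<inter> (\<Union>y\<in>U j. ball y r)" for j
  have V1: "openin (top_of_set usph) (V j)" for j
    unfolding V_def by (intro openin_open_Int open_UN) auto
  have V2: "closure (U j) \<subseteq> V j" for j
  proof
    fix x assume x: "x \<in> closure (U j)"
    then have "x \<in> usph" using U_sphere closure_minimal[of "U j" usph] by auto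
    moreover obtain y where "y \<in> U j" "dist y x < r"
      using x r(3) closure_approachable by blast
    ultimately show "x \<in> V j" by (auto simp: V_def)
  qed
  have V3: "V i \<inter> V j = {}" if "i \<in> P'" "j \<in> P'" "i \<noteq> j" for i j
  proof (rule ccontr)
    assume "V i \<inter> V j \<noteq> {}"
    then obtain x y z where "y \<in> U i" "z \<in> U j" "dist y x < r" "dist z x < r" by (auto simp: V_def)
    then show False using sep[OF that(1,2) that(3)[symmetric]] dist_triangle2[of y z x] by fastforce
  qed
  have Vdist: "dist x x' \<le> 2 * d \<and> dist (f x) (f x') \<le> 2 * d"
    if j: "j \<in> J" and x: "x \<in> V j" and x': "x' \<in> V j" for j x x'
  proof -
    obtain y where y: "y \<in> U j" "dist y x < r" using x by (auto simp: V_def)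
    obtain y' where y': "y' \<in> U j" "dist y' x' < r" using x' by (auto simp: V_def)
    have s: "x \<in> usph" "x' \<in> usph" "y \<in> usph" "y' \<in> usph" using x x' y(1) y'(1) U_sphere[of j] by (auto simp: V_def)
    have 1: "dist y y' < d" "dist (f y) (f y') < d" using small[of j y y'] j y(1) y'(1) by (auto simp: J_def)
    have 2: "dist (f y) (f x) < d / 2" "dist (f y') (f x') < d / 2" using a(2) s y(2) y'(2) r(1) by force+
    have "dist x x' \<le> dist y x + dist y y' + dist y' x'"
      using dist_triangle[of x x' y] dist_triangle[of y x' y'] by (simp add: dist_commute)
    moreover have "dist (f x) (f x') \<le> dist (f y) (f x) + dist (f y) (f y') + dist (f y') (f x')"
      using dist_triangle[of "f x" "f x'" "f y"] dist_triangle[of "f y" "f x'" "f y'"] by (simp add: dist_commute)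
    ultimately show ?thesis using 1 2 y(2) y'(2) r(2) by linarith
  qed
  have "finite J" using finP' by (simp add: J_def)
  have "V i \<inter> V j = {}" if "i \<in> J" "j \<in> J" "i \<noteq> j" for i j
    using V3[of i j] that by (simp add: J_def)
  then have "\<exists>g. sphere_homeo g \<and> germ g \<and> (\<forall>x\<in>usph - (\<Union>j\<in>J. V j). g x = f x) \<and>
    (\<forall>j\<in>J. \<forall>x\<in>V j. g x \<in> f ` V j) \<and>
    (\<forall>j\<in>J. aconf (U j) g \<and> emeasure sphere_measure (g ` U j) \<le> \<eta> j) \<and>
    (\<forall>i. i \<notin> J \<longrightarrow> (\<forall>x\<in>U i. g x = f x) \<or> (\<forall>x\<in>U i. \<forall>y\<in>U i. dist (g x) (g y) < e))"
    by (rule make_conformal_finite[OF \<open>finite J\<close> f V1 V2 _ pos(2) pos(3)])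
  then obtain g where g: "sphere_homeo g" "germ g" "\<forall>x\<in>usph - (\<Union>j\<in>J. V j). g x = f x"
    "\<forall>k\<in>J. \<forall>x\<in>V k. g x \<in> f ` V k"
    "\<forall>k\<in>J. aconf (U k) g \<and> emeasure sphere_measure (g ` U k) \<le> \<eta> k"
    "\<forall>i. i \<notin> J \<longrightarrow> (\<forall>x\<in>U i. g x = f x) \<or> (\<forall>x\<in>U i. \<forall>y\<in>U i. dist (g x) (g y) < e)"
    by blast
  show ?thesis
  proof (intro exI[of _ g] exI[of _ P'] conjI g(1,2) finP' ballI allI impI)
    show "P \<subseteq> P'" "m \<in> P'" by (auto simp: P'_def)
    fix i x assume i: "i \<in> P" and x: "x \<in> U i"
    have "x \<notin> V j" if "j \<in> J" for j
      using V3[of i j] V2[of i] closure_subset[of "U i"] x i that by (auto simp: J_def P'_def)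
    moreover have "x \<in> usph" using x U_sphere by blast
    ultimately show "g x = f x" using g(3) by blast
  next
    fix i assume "i \<in> P' - P"
    then show "aconf (U i) g" "emeasure sphere_measure (g ` U i) \<le> \<eta> i" using g(5) by (auto simp: J_def)
  next
    fix i x y assume i: "i \<notin> P'" and x: "x \<in> U i" and y: "y \<in> U i"
    show "dist x y < e" using i x y by (auto simp: P'_def)
    have "dist (f x) (f y) < e" using i x y by (auto simp: P'_def)
    moreover have "i \<notin> J" using i by (simp add: J_def)
    ultimately show "dist (g x) (g y) < e" using spec[OF g(6), of i] x y by auto
  next
    fix x :: 'a assume x: "x \<in> usph"
    show "\<exists>x'\<in>usph. g x = f x' \<and> dist x x' \<le> 2 * d \<and> dist (f x) (f x') \<le> 2 * d"
    proof (cases "x \<in> (\<Union>j\<in>J. V j)")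
      case True
      then obtain j where j: "j \<in> J" "x \<in> V j" by blast
      then obtain x' where x': "x' \<in> V j" "g x = f x'" using g(4) by blast
      then show ?thesis using Vdist[OF j x'(1)] by (auto simp: V_def)
    next
      case False
      then show ?thesis using g(3) x pos(1) by (intro bexI[of _ x]) auto
    qed
  qed
qed

end

section \<open>Uniform limits of homeomorphisms of the sphere\<close>

lemma geometric_uniform_limit:
  fixes F :: "nat \<Rightarrow> 'a \<Rightarrow> 'b::banach"
  assumes "\<And>n x. x \<in> A \<Longrightarrow> dist (F (Suc n) x) (F n x) \<le> c / 2 ^ n"
  shows "\<exists>f. uniform_limit A F f sequentially"
proof -
  have "summable (\<lambda>n. c * (1 / 2) ^ n)" by (intro summable_mult summable_geometric) simp
  moreover have "norm (F (Suc n) x - F n x) \<le> c * (1 / 2) ^ n" if "x \<in> A" for n x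
    using assms[OF that, of n] by (simp add: dist_norm power_one_over)
  ultimately have "uniform_limit A (\<lambda>n x. \<Sum>i<n. F (Suc i) x - F i x)
      (\<lambda>x. \<Sum>i. F (Suc i) x - F i x) sequentially"
    by (intro Weierstrass_m_test)
  then have "uniform_limit A (\<lambda>n x. (\<Sum>i<n. F (Suc i) x - F i x) + F 0 x)
      (\<lambda>x. (\<Sum>i. F (Suc i) x - F i x) + F 0 x) sequentially"
    by (intro uniform_limit_intros)
  moreover have "(\<Sum>i<n. F (Suc i) x - F i x) + F 0 x = F n x" for n x
    using sum_lessThan_telescope[of "\<lambda>i. F i x" n] by simp
  ultimately show ?thesis by auto
qed

lemma uniform_limit_compose_tendsto:
  assumes "uniform_limit A F f sequentially" "continuous_on A f" "G \<longlonglongrightarrow> y"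
    "\<And>n. G n \<in> A" "y \<in> A"
  shows "(\<lambda>n. F n (G n)) \<longlonglongrightarrow> f y"
proof (rule tendstoI)
  fix e :: real assume "e > 0"
  then have e2: "e / 2 > 0" by simp
  have "(\<lambda>n. f (G n)) \<longlonglongrightarrow> f y"
    by (rule continuous_on_tendsto_compose[OF assms(2,3,5)]) (simp add: assms(4))
  then have "\<forall>\<^sub>F n in sequentially. dist (f (G n)) (f y) < e / 2" using e2 by (rule tendstoD)
  moreover have "\<forall>\<^sub>F n in sequentially. \<forall>x\<in>A. dist (F n x) (f x) < e / 2"
    by (rule uniform_limitD[OF assms(1) e2])
  ultimately show "\<forall>\<^sub>F n in sequentially. dist (F n (G n)) (f y) < e"
  proof eventually_elim
    case (elim n)
    then show ?case
      using dist_triangle[of "F n (G n)" "f y" "f (G n)"] assms(4)[of n] by force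
  qed
qed

text \<open>
  Writing \<open>F (Suc n) x = F n x'\<close> with \<open>x\<close> close to \<open>x'\<close> bounds the distance between the inverses of
  \<open>F (Suc n)\<close> and \<open>F n\<close>.
\<close>

lemma sphere_homeo_limit:
  assumes F: "\<And>n. sphere_homeo (F n)"
    and close: "\<And>n x. x \<in> usph \<Longrightarrow> \<exists>x'\<in>usph. F (Suc n) x = F n x' \<and> dist x x' \<le> c / 2 ^ n \<and>
      dist (F n x) (F n x') \<le> c / 2 ^ n"
  obtains f where "sphere_homeo f" "\<And>x. x \<in> usph \<Longrightarrow> (\<lambda>n. F n x) \<longlonglongrightarrow> f x"
proof -
  let ?G = "\<lambda>n. inv_into usph (F n)"
  have "dist (F (Suc n) x) (F n x) \<le> c / 2 ^ n" if "x \<in> usph" for n x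
    using close[OF that, of n] by (auto simp: dist_commute)
  then obtain f where f: "uniform_limit usph F f sequentially"
    using geometric_uniform_limit[of usph F c] by blast
  have "dist (?G (Suc n) y) (?G n y) \<le> c / 2 ^ n" if y: "y \<in> usph" for n y
  proof -
    let ?x = "?G (Suc n) y"
    have x: "?x \<in> usph" by (rule sphere_homeo_in[OF sphere_homeo_inv[OF F] y])
    obtain x' where x': "x' \<in> usph" "F (Suc n) ?x = F n x'" "dist ?x x' \<le> c / 2 ^ n"
      using close[OF x, of n] by blast
    have "F n x' = y" using x'(2) sphere_homeo_inv_right[OF F y, of "Suc n"] by simp
    then have "?G n y = x'" using sphere_homeo_inv_left[OF F x'(1)] by blast
    then show ?thesis using x'(3) by simp
  qed
  then obtain g where g: "uniform_limit usph ?G g sequentially"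
    using geometric_uniform_limit[of usph ?G c] by blast
  have cf: "continuous_on usph f"
    by (rule uniform_limit_theorem[OF always_eventually f])
       (use F in \<open>auto simp: sphere_homeo_def\<close>)
  have cg: "continuous_on usph g"
    by (rule uniform_limit_theorem[OF always_eventually g])
       (use sphere_homeo_inv[OF F] in \<open>auto simp: sphere_homeo_def\<close>)
  have tf: "(\<lambda>n. F n x) \<longlonglongrightarrow> f x" if "x \<in> usph" for x
    by (rule tendsto_uniform_limitI[OF f that])
  have tg: "(\<lambda>n. ?G n x) \<longlonglongrightarrow> g x" if "x \<in> usph" for x
    by (rule tendsto_uniform_limitI[OF g that])
  have fs: "f x \<in> usph" if "x \<in> usph" for x
    by (rule Lim_in_closed_set[OF closed_sphere _ _ tf[OF that]])
       (use sphere_homeo_in[OF F that] in auto)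
  have gs: "g x \<in> usph" if "x \<in> usph" for x
    by (rule Lim_in_closed_set[OF closed_sphere _ _ tg[OF that]])
       (use sphere_homeo_in[OF sphere_homeo_inv[OF F] that] in auto)
  have fg: "f (g y) = y" if y: "y \<in> usph" for y
  proof -
    have "(\<lambda>n. F n (?G n y)) \<longlonglongrightarrow> f (g y)"
      by (rule uniform_limit_compose_tendsto[OF f cf tg[OF y] _ gs[OF y]])
         (rule sphere_homeo_in[OF sphere_homeo_inv[OF F] y])
    then show ?thesis using sphere_homeo_inv_right[OF F y] by (simp add: LIMSEQ_const_iff)
  qed
  have gf: "g (f x) = x" if x: "x \<in> usph" for x
  proof -
    have "(\<lambda>n. ?G n (F n x)) \<longlonglongrightarrow> g (f x)"
      by (rule uniform_limit_compose_tendsto[OF g cg tf[OF x] _ fs[OF x]])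
         (rule sphere_homeo_in[OF F x])
    then show ?thesis using sphere_homeo_inv_left[OF F x] by (simp add: LIMSEQ_const_iff)
  qed
  have "bij_betw f usph usph"
    by (rule bij_betw_byWitness[of _ g]) (use fg gf fs gs in auto)
  then show ?thesis using that[of f] cf tf by (simp add: sphere_homeo_def)
qed

context sphere_cells
begin

lemma conformal_homeo:
  assumes \<eta>: "\<And>j. \<eta> j > 0"
  obtains f where "sphere_homeo f"
    "\<And>i. aconf (U i) f \<and> emeasure sphere_measure (f ` U i) \<le> \<eta> i"
proof -
  \<comment> \<open>The clause \<open>{..<n} \<subseteq> P\<close> ensures that every component is
    reached. The scale starts at 3, more than the diameter of the sphere, so that the empty set of
    treated components is a valid start.\<close>
  define Inv where "Inv n s \<longleftrightarrow> (case s of (f, P) \<Rightarrow> sphere_homeo f \<and> germ f \<and> finite P \<and> {..<n} \<subseteq> P \<and>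
    (\<forall>i\<in>P. aconf (U i) f \<and> emeasure sphere_measure (f ` U i) \<le> \<eta> i) \<and>
    (\<forall>i. i \<notin> P \<longrightarrow> (\<forall>x\<in>U i. \<forall>y\<in>U i. dist x y < 3 / 2 ^ n \<and> dist (f x) (f y) < 3 / 2 ^ n)))" for n s
  define Nxt where "Nxt n s s' \<longleftrightarrow> (case s of (f, P) \<Rightarrow> case s' of (g, P') \<Rightarrow> P \<subseteq> P' \<and>
    (\<forall>i\<in>P. \<forall>x\<in>U i. g x = f x) \<and>
    (\<forall>x\<in>usph. \<exists>x'\<in>usph. g x = f x' \<and> dist x x' \<le> 2 * (3 / 2 ^ n) \<and> dist (f x) (f x') \<le> 2 * (3 / 2 ^ n)))"
    for n and s s' :: "('a \<Rightarrow> 'a) \<times> nat set"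
  have "\<exists>S. \<forall>n. Inv n (S n) \<and> Nxt n (S n) (S (Suc n))"
  proof (rule dependent_nat_choice)
    have "dist x y < 3" if "x \<in> usph" "y \<in> usph" for x y :: 'a
      using that norm_triangle_ineq4[of x y] by (simp add: dist_norm)
    then have "dist x y < 3" if "x \<in> U i" "y \<in> U i" for i and x y :: 'a
      using that U_sphere by blast
    moreover have "germ (\<lambda>x. x)" by (rule germ_cell[OF aconf_id])
    ultimately have "Inv 0 (\<lambda>x. x, {})"
      by (simp add: Inv_def sphere_homeo_id)
    then show "\<exists>s. Inv 0 s" by blast
  next
    fix s n assume "Inv n s"
    obtain f P where s: "s = (f, P)" by (cases s)
    then have inv: "sphere_homeo f" "germ f" "finite P" "{..<n} \<subseteq> P"
      "\<And>i. i \<in> P \<Longrightarrow> aconf (U i) f \<and> emeasure sphere_measure (f ` U i) \<le> \<eta> i"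
      "\<And>i x y. i \<notin> P \<Longrightarrow> x \<in> U i \<Longrightarrow> y \<in> U i \<Longrightarrow> dist x y < 3 / 2 ^ n \<and> dist (f x) (f y) < 3 / 2 ^ n"
      using \<open>Inv n s\<close> by (auto simp: Inv_def)
    have "\<exists>g P'. sphere_homeo g \<and>
      germ g \<and>
      finite P' \<and>
      P \<subseteq> P' \<and>
      n \<in> P' \<and>
      (\<forall>i\<in>P. \<forall>x\<in>U i. g x = f x) \<and>
      (\<forall>i\<in>P' - P. aconf (U i) g \<and> emeasure sphere_measure (g ` U i) \<le> \<eta> i) \<and>
      (\<forall>i. i \<notin> P' \<longrightarrow> (\<forall>x\<in>U i. \<forall>y\<in>U i. dist x y < 3 / 2 ^ Suc n \<and> dist (g x) (g y) < 3 / 2 ^ Suc n)) \<and>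
      (\<forall>x\<in>usph. \<exists>x'\<in>usph. g x = f x' \<and> dist x x' \<le> 2 * (3 / 2 ^ n) \<and> dist (f x) (f x') \<le> 2 * (3 / 2 ^ n))"
      by (rule refine[OF inv(1,2,3,6) _ _ \<eta>]) simp_all
    then obtain g P' where g: "sphere_homeo g" "germ g" "finite P'" "P \<subseteq> P'" "n \<in> P'"
      "\<forall>i\<in>P. \<forall>x\<in>U i. g x = f x"
      "\<forall>i\<in>P' - P. aconf (U i) g \<and> emeasure sphere_measure (g ` U i) \<le> \<eta> i"
      "\<forall>i. i \<notin> P' \<longrightarrow> (\<forall>x\<in>U i. \<forall>y\<in>U i. dist x y < 3 / 2 ^ Suc n \<and> dist (g x) (g y) < 3 / 2 ^ Suc n)"
      "\<forall>x\<in>usph. \<exists>x'\<in>usph. g x = f x' \<and> dist x x' \<le> 2 * (3 / 2 ^ n) \<and> dist (f x) (f x') \<le> 2 * (3 / 2 ^ n)"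
      by blast
    have "aconf (U i) g \<and> emeasure sphere_measure (g ` U i) \<le> \<eta> i" if "i \<in> P'" for i
    proof (cases "i \<in> P")
      case True
      then have eq: "g x = f x" if "x \<in> U i" for x using g(6) that by blast
      then have "g ` U i = f ` U i" by (rule image_cong[OF refl])
      then show ?thesis using inv(5)[OF True] aconf_cong[of "U i" f g] eq by simp
    qed (use g(7) that in blast)
    moreover have "{..<Suc n} \<subseteq> P'" using g(4,5) inv(4) by (auto simp: less_Suc_eq)
    ultimately have "Inv (Suc n) (g, P')" using g(1,2,3,8) by (simp add: Inv_def)
    moreover have "Nxt n s (g, P')" using g(4,6,9) by (simp add: Nxt_def s)
    ultimately show "\<exists>s'. Inv (Suc n) s' \<and> Nxt n s s'" by blast
  qed
  then obtain S where S: "\<And>n. Inv n (S n)" "\<And>n. Nxt n (S n) (S (Suc n))" by blast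
  define F where "F n = fst (S n)" for n
  define P where "P n = snd (S n)" for n
  have F: "sphere_homeo (F n)" and Pn: "{..<n} \<subseteq> P n"
    and FP: "\<And>i. i \<in> P n \<Longrightarrow> aconf (U i) (F n) \<and> emeasure sphere_measure (F n ` U i) \<le> \<eta> i" for n
    using S(1)[of n] by (auto simp: Inv_def F_def P_def split: prod.splits)
  have PS: "P n \<subseteq> P (Suc n)" and FS: "\<And>i x. i \<in> P n \<Longrightarrow> x \<in> U i \<Longrightarrow> F (Suc n) x = F n x"
    and close: "\<And>x. x \<in> usph \<Longrightarrow> \<exists>x'\<in>usph. F (Suc n) x = F n x' \<and> dist x x' \<le> 6 / 2 ^ n \<and> dist (F n x) (F n x') \<le> 6 / 2 ^ n" for n
    using S(2)[of n] by (auto simp: Nxt_def F_def P_def split: prod.splits)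
  obtain f where f: "sphere_homeo f" "\<And>x. x \<in> usph \<Longrightarrow> (\<lambda>n. F n x) \<longlonglongrightarrow> f x"
    using sphere_homeo_limit[OF F close] by metis
  have "aconf (U i) f \<and> emeasure sphere_measure (f ` U i) \<le> \<eta> i" for i
  proof -
    \<comment> \<open>Round \<open>Suc i\<close> is the first certain to have treated
      \<open>U i\<close>. From then on the maps do not change on \<open>U i\<close>, so the limit
      equals \<open>F (Suc i)\<close> there, and conformality requires no limit of
      derivatives.\<close>
    have iP: "i \<in> P (Suc i)" using Pn[of "Suc i"] by auto
    have eq: "f x = F (Suc i) x" if x: "x \<in> U i" for x
    proof -
      have "i \<in> P (Suc i + k) \<and> F (Suc i + k) x = F (Suc i) x" for k
      proof (induction k)
        case (Suc k)
        then show ?case using PS[of "Suc i + k"] FS[of i "Suc i + k" x] x by auto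
      qed (use iP in simp)
      then have "(\<lambda>k. F (k + Suc i) x) \<longlonglongrightarrow> F (Suc i) x" by (simp add: add.commute)
      then have "(\<lambda>n. F n x) \<longlonglongrightarrow> F (Suc i) x" by (rule LIMSEQ_offset)
      moreover have "(\<lambda>n. F n x) \<longlonglongrightarrow> f x" using f(2) x U_sphere by blast
      ultimately show ?thesis using LIMSEQ_unique by blast
    qed
    then have "f ` U i = F (Suc i) ` U i" by (rule image_cong[OF refl])
    then show ?thesis using FP[OF iP] aconf_cong[of "U i" "F (Suc i)" f] eq by simp
  qed
  then show ?thesis using that f(1) by blast
qed

end

section \<open>Sierpinski spaces under homeomorphisms\<close>

text \<open>Maximality among connected subsets is pulled back along the inverse map.\<close>

lemma homeomorphism_image_components:
  assumes hom: "homeomorphism S T f g" and C: "C \<in> components S"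
  shows "f ` C \<in> components T"
proof -
  have CS: "C \<noteq> {}" "C \<subseteq> S" "connected C"
    using C by (auto simp: in_components_maximal)
  have max: "d = C" if "d \<noteq> {}" "C \<subseteq> d" "d \<subseteq> S" "connected d" for d
    using C that by (auto simp: in_components_maximal)
  have f: "continuous_on S f" "f ` S = T" "\<And>x. x \<in> S \<Longrightarrow> g (f x) = x"
    and g: "continuous_on T g" "g ` T = S" "\<And>y. y \<in> T \<Longrightarrow> f (g y) = y"
    using hom by (auto simp: homeomorphism_def)
  show ?thesis
    unfolding in_components_maximal
  proof (intro conjI allI impI)
    show "f ` C \<noteq> {}" using CS by blast
    show "f ` C \<subseteq> T" using CS f(2) by blast
    show "connected (f ` C)" using CS f(1) by (meson connected_continuous_image continuous_on_subset)
    fix d assume d: "d \<noteq> {} \<and> f ` C \<subseteq> d \<and> d \<subseteq> T \<and> connected d"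
    have "g ` d = C"
    proof (rule max)
      show "g ` d \<noteq> {}" using d by blast
      show "g ` d \<subseteq> S" using d g(2) by blast
      show "connected (g ` d)" using d g(1) by (meson connected_continuous_image continuous_on_subset)
      show "C \<subseteq> g ` d"
      proof
        fix x assume "x \<in> C"
        then have "f x \<in> d" "g (f x) = x" using d CS f(3) by blast+
        then show "x \<in> g ` d" by force
      qed
    qed
    then have "f ` C = f ` g ` d" by simp
    also have "\<dots> = (\<lambda>y. y) ` d"
      unfolding image_image using d g(3) by (intro image_cong refl) blast
    also have "\<dots> = d" by simp
    finally show "d = f ` C" ..
  qed
qed

lemma components_homeomorphism:
  assumes hom: "homeomorphism S T f g"
  shows "components T = image f ` components S"
proof
  show "image f ` components S \<subseteq> components T"
    using homeomorphism_image_components[OF hom] by blast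
  show "components T \<subseteq> image f ` components S"
  proof
    fix D assume D: "D \<in> components T"
    then have "g ` D \<in> components S"
      using homeomorphism_image_components[OF homeomorphism_symD[OF hom]] by blast
    moreover have "f ` g ` D = (\<lambda>y. y) ` D"
      unfolding image_image using hom in_components_subset[OF D]
      by (intro image_cong refl) (auto simp: homeomorphism_def)
    then have "f ` g ` D = D" by simp
    ultimately show "D \<in> image f ` components S" by (metis image_eqI)
  qed
qed

lemma sphere_homeo_image_diff:
  assumes "sphere_homeo f" "A \<subseteq> usph"
  shows "f ` (usph - A) = usph - f ` A"
proof -
  have "f ` (usph - A) = f ` usph - f ` A"
    using assms by (intro inj_on_image_set_diff[of f usph]) (auto simp: sphere_homeo_def bij_betw_def)
  then show ?thesis using assms(1) by (simp add: sphere_homeo_def bij_betw_def)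
qed

lemma sphere_homeo_sub_homeomorphism:
  assumes "sphere_homeo f" "A \<subseteq> usph"
  shows "homeomorphism A (f ` A) f (inv_into usph f)"
  by (rule homeomorphism_of_subsets[OF sphere_homeo_homeomorphism[OF assms(1)]])
     (use assms sphere_homeo_in[OF assms(1)] in auto)

lemma sphere_homeo_closure_image:
  assumes f: "sphere_homeo f" and A: "A \<subseteq> usph"
  shows "closure (f ` A) = f ` closure A"
proof
  have cl: "closure A \<subseteq> usph" using A by (simp add: closure_minimal)
  have cont: "continuous_on (closure A) f"
    using f cl by (auto simp: sphere_homeo_def intro: continuous_on_subset)
  have "compact (f ` closure A)"
    by (rule sphere_homeo_compact[OF f cl]) (intro compact_closed_sphere_subset closed_closure cl)
  then show "closure (f ` A) \<subseteq> f ` closure A"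
    using closure_subset by (intro closure_minimal image_mono compact_imp_closed)
  show "f ` closure A \<subseteq> closure (f ` A)"
    by (rule image_closure_subset[OF cont closed_closure closure_subset])
qed

text \<open>All clauses are topological except the one on diameters, which survives because
  \<open>f\<close> is uniformly continuous on the sphere.\<close>

lemma sierpinski_space_image:
  fixes f :: "(real^'n) \<times> real \<Rightarrow> (real^'n) \<times> real"
  assumes f: "sphere_homeo f" and X: "sierpinski_space X"
  shows "sierpinski_space (f ` X)"
proof -
  obtain U :: "nat \<Rightarrow> ((real^'n) \<times> real) set" where XS: "X \<subseteq> Sn" and Xc: "compact X" "connected X"
    and U: "bij_betw U UNIV (components (Sn - X))" "\<And>i. cell (Sn - U i)"
      "\<And>i j. i \<noteq> j \<Longrightarrow> closure (U i) \<inter> closure (U j) = {}"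
      "closure (\<Union>i. U i) = Sn" "(\<lambda>i. diameter (U i)) \<longlonglongrightarrow> 0"
    using X unfolding sierpinski_space_def continuum_def by blast
  have UX: "U i \<subseteq> Sn - X" for i
  proof (rule in_components_subset)
    show "U i \<in> components (Sn - X)" using U(1) by (auto simp: bij_betw_def)
  qed
  have US: "U i \<subseteq> Sn" for i using UX by blast
  have inj: "inj_on f Sn" using f by (simp add: sphere_homeo_def bij_betw_def)
  let ?U = "\<lambda>i. f ` U i"
  have "f ` X \<subseteq> Sn" using XS sphere_homeo_in[OF f] by blast
  moreover have "continuum (f ` X)"
    unfolding continuum_def
    using sphere_homeo_compact[OF f XS Xc(1)] f XS Xc(2)
    by (auto simp: sphere_homeo_def intro: connected_continuous_image continuous_on_subset)
  moreover have "bij_betw ?U UNIV (components (Sn - f ` X))"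
  proof -
    have eq: "components (Sn - f ` X) = image f ` components (Sn - X)"
      using components_homeomorphism[OF sphere_homeo_sub_homeomorphism[OF f Diff_subset], of X]
      unfolding sphere_homeo_image_diff[OF f XS] .
    have "inj_on (image f) (components (Sn - X))"
    proof (rule inj_on_subset[OF inj_on_image_Pow[OF inj]])
      show "components (Sn - X) \<subseteq> Pow Sn" using in_components_subset by blast
    qed
    then have "bij_betw (image f) (components (Sn - X)) (components (Sn - f ` X))"
      by (simp add: bij_betw_def eq)
    then have "bij_betw (image f \<circ> U) UNIV (components (Sn - f ` X))"
      by (rule bij_betw_trans[OF U(1)])
    then show ?thesis by (simp add: o_def)
  qed
  moreover have "cell (Sn - ?U i)" for i
  proof -
    have "(Sn - U i) homeomorphic (Sn - ?U i)"
      unfolding homeomorphic_def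
      using sphere_homeo_sub_homeomorphism[OF f Diff_subset] sphere_homeo_image_diff[OF f US] by metis
    then show ?thesis using U(2) unfolding cell_def
      by (meson homeomorphic_sym homeomorphic_trans)
  qed
  moreover have "closure (?U i) \<inter> closure (?U j) = {}" if "i \<noteq> j" for i j
  proof -
    have "closure (U k) \<subseteq> Sn" for k using US by (simp add: closure_minimal)
    then have "f ` closure (U i) \<inter> f ` closure (U j) = f ` (closure (U i) \<inter> closure (U j))"
      using inj_on_image_Int[OF inj] by metis
    then show ?thesis using U(3)[OF that] by (simp add: sphere_homeo_closure_image[OF f US])
  qed
  moreover have "closure (\<Union>i. ?U i) = Sn"
  proof -
    have "(\<Union>i. ?U i) = f ` (\<Union>i. U i)" by blast
    moreover have "closure (f ` (\<Union>i. U i)) = f ` closure (\<Union>i. U i)"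
      using US by (intro sphere_homeo_closure_image[OF f]) blast
    ultimately show ?thesis using U(4) f by (simp add: sphere_homeo_def bij_betw_def)
  qed
  moreover have "(\<lambda>i. diameter (?U i)) \<longlonglongrightarrow> 0"
  proof (rule tendstoI)
    fix e :: real assume e: "e > 0"
    then obtain d where d: "d > 0" "\<And>x y. x \<in> usph \<Longrightarrow> y \<in> usph \<Longrightarrow> dist x y < d \<Longrightarrow> dist (f x) (f y) < e / 2"
      using sphere_homeo_uniform[OF f, of "e / 2"] by auto
    have "\<forall>\<^sub>F i in sequentially. dist (diameter (U i)) 0 < d"
      using U(5) d(1) by (rule tendstoD)
    then show "\<forall>\<^sub>F i in sequentially. dist (diameter (?U i)) 0 < e"
    proof eventually_elim
      case (elim i)
      have bd: "bounded (U i)" "bounded (?U i)"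
        using US[of i] sphere_homeo_in[OF f] by (auto intro!: bounded_subset[OF bounded_sphere[of 0 1]])
      have "diameter (?U i) \<le> e / 2"
      proof (rule diameter_le)
        show "?U i \<noteq> {} \<or> 0 \<le> e / 2" using e by simp
        fix x y assume "x \<in> ?U i" "y \<in> ?U i"
        then obtain a b where ab: "a \<in> U i" "b \<in> U i" "x = f a" "y = f b" by blast
        have "dist a b \<le> diameter (U i)" by (rule diameter_bounded_bound[OF bd(1) ab(1,2)])
        also have "\<dots> < d" using elim by simp
        finally have "dist a b < d" .
        moreover have "a \<in> Sn" "b \<in> Sn" using ab US by blast+
        ultimately have "dist (f a) (f b) < e / 2" by (intro d(2))
        then show "norm (x - y) \<le> e / 2" using ab by (simp add: dist_norm)
      qed
      then show ?case using diameter_ge_0[OF bd(2)] e by simp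
    qed
  qed
  ultimately show ?thesis
    unfolding sierpinski_space_def by blast
qed

theorem theorem1p3:
  fixes X :: "((real^'n) \<times> real) set"
  assumes "CARD('n) \<ge> 2"
    and "sierpinski_space X"
  shows "\<exists>(Y :: ((real^'n) \<times> real) set) f g.
    sierpinski_space Y \<and>
    emeasure sphere_measure Y > 0 \<and>
    homeomorphism Sn Sn f g \<and>
    f ` X = Y \<and>
    (\<forall>U \<in> components (Sn - X). conformal_on U f)"
proof -
  obtain U :: "nat \<Rightarrow> ((real^'n) \<times> real) set" where XS: "X \<subseteq> Sn" and Xc: "compact X"
    and U: "bij_betw U UNIV (components (Sn - X))" "\<And>i. cell (Sn - U i)"
      "\<And>i j. i \<noteq> j \<Longrightarrow> closure (U i) \<inter> closure (U j) = {}"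
      "(\<lambda>i. diameter (U i)) \<longlonglongrightarrow> 0"
    using assms(2) unfolding sierpinski_space_def continuum_def by blast
  have comp: "U i \<in> components (Sn - X)" for i using U(1) by (auto simp: bij_betw_def)
  have "openin (top_of_set Sn) (Sn \<inter> - X)"
    by (rule openin_open_Int) (use Xc in \<open>simp add: compact_imp_closed open_Compl\<close>)
  then have op: "openin (top_of_set Sn) (Sn - X)" by (simp add: Diff_eq)
  obtain \<phi> \<psi> where hom: "\<And>i. homeomorphism (Sn - U i) (cball (0 :: real^'n) 1) (\<phi> i) (\<psi> i)"
    using U(2) unfolding cell_def homeomorphic_def by metis
  interpret sphere_cells U \<phi> \<psi>
  proof
    show "DIM((real^'n) \<times> real) = Suc DIM(real^'n)" by simp
    show "openin (top_of_set Sn) (U i)" for i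
      using locally_connected_sphere[of 0 1] op comp locally_connected_open_component by blast
    show "U i \<noteq> {}" for i using comp in_components_nonempty by blast
    show "null_family UNIV U"
      unfolding null_family_def
    proof (intro allI impI)
      fix e :: real assume "e > 0"
      with U(4) have "\<forall>\<^sub>F i in sequentially. dist (diameter (U i)) 0 < e" by (rule tendstoD)
      then obtain N where N: "\<And>i. i \<ge> N \<Longrightarrow> diameter (U i) < e"
        by (auto simp: eventually_sequentially abs_less_iff)
      have "dist x y < e" if "i \<ge> N" "x \<in> U i" "y \<in> U i" for i x y
      proof -
        have "U i \<subseteq> Sn" using in_components_subset[OF comp] by blast
        then have "bounded (U i)" by (rule bounded_subset[OF bounded_sphere])
        then show ?thesis using diameter_bounded_bound[of "U i" x y] N[of i] that by linarith
      qed
      then have "{i \<in> UNIV. \<not> (\<forall>x\<in>U i. \<forall>y\<in>U i. dist x y < e)} \<subseteq> {..<N}" by (force simp: not_le)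
      then show "finite {i \<in> UNIV. \<not> (\<forall>x\<in>U i. \<forall>y\<in>U i. dist x y < e)}"
        by (rule finite_subset) simp
    qed
  qed (fact hom U(3))+
  define \<mu> where "\<mu> = enn2real (emeasure sphere_measure (Sn :: ((real^'n) \<times> real) set))"
  have \<mu>: "emeasure sphere_measure (Sn :: ((real^'n) \<times> real) set) = ennreal \<mu>"
    unfolding \<mu>_def
    by (rule ennreal_enn2real[symmetric])
       (use emeasure_sphere_measure_finite[where 'a="(real^'n) \<times> real"] in simp)
  then have \<mu>0: "\<mu> > 0" using emeasure_sphere_measure_pos[where 'a="(real^'n) \<times> real"] by simp
  \<comment> \<open>A geometric series with sum \<open>\<mu> / 2\<close>: the images of the
    components cover at most half the measure of the sphere, so the image of \<open>X\<close> cannot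
    be null.\<close>
  define \<eta> where "\<eta> i = \<mu> / 2 * (1 / 2) ^ Suc i" for i
  have \<eta>: "\<eta> i > 0" for i using \<mu>0 by (simp add: \<eta>_def)
  obtain f where f: "sphere_homeo f"
    "\<And>i. aconf (U i) f \<and> emeasure sphere_measure (f ` U i) \<le> ennreal (\<eta> i)"
    using conformal_homeo[of "\<lambda>i. ennreal (\<eta> i)"] \<eta> by auto
  let ?Y = "f ` X"
  have Ym: "?Y \<in> sets sphere_measure"
    using sphere_homeo_compact[OF f(1) XS Xc] sphere_homeo_in[OF f(1)] XS
    by (intro sets_sphere_measureI borel_compact) auto
  have Um: "f ` U i \<in> sets sphere_measure" for i
    using sphere_homeo_openin[OF f(1) U_openin]
    by (intro sets_sphere_measureI openin_sphere_borel) (auto dest: openin_imp_subset)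
  have "emeasure sphere_measure ?Y > 0"
  proof (rule ccontr)
    assume "\<not> emeasure sphere_measure ?Y > 0"
    then have Y0: "emeasure sphere_measure ?Y = 0" by simp
    have "X \<union> (\<Union>i. U i) = Sn"
    proof -
      have "(\<Union>i. U i) = \<Union> (components (Sn - X))" using U(1) by (simp add: bij_betw_def)
      then show ?thesis using XS by auto
    qed
    then have "Sn = ?Y \<union> (\<Union>i. f ` U i)"
      using f(1) by (metis bij_betw_imp_surj_on image_UN image_Un sphere_homeo_def)
    then have "emeasure sphere_measure (Sn :: ((real^'n) \<times> real) set) \<le> emeasure sphere_measure ?Y + emeasure sphere_measure (\<Union>i. f ` U i)"
      using emeasure_subadditive[OF Ym, of "\<Union>i. f ` U i"] Um by auto
    also have "\<dots> \<le> (\<Sum>i. emeasure sphere_measure (f ` U i))"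
      using emeasure_subadditive_countably[of "\<lambda>i. f ` U i" sphere_measure] Um Y0 by auto
    also have "\<dots> \<le> (\<Sum>i. ennreal (\<eta> i))"
      using f(2) by (intro suminf_le) auto
    also have "\<dots> = ennreal (\<mu> / 2)"
    proof (rule suminf_ennreal_eq)
      show "\<eta> sums (\<mu> / 2)"
        unfolding \<eta>_def using sums_mult[OF power_half_series, of "\<mu> / 2"] by simp
    qed (use \<eta> less_imp_le in blast)
    finally show False using \<mu>0 by (simp add: \<mu>)
  qed
  moreover have "conformal_on C f" if "C \<in> components (Sn - X)" for C
  proof -
    have "range U = components (Sn - X)" using U(1) by (simp add: bij_betw_def)
    then have "C \<in> range U" using that by simp
    then obtain i where "C = U i" by (rule rangeE)
    then show ?thesis using aconf_conformal_on[of "U i" f] f(2)[of i] by simp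
  qed
  ultimately show ?thesis
    using sierpinski_space_image[OF f(1) assms(2)] sphere_homeo_homeomorphism[OF f(1)] by blast
qed

end
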